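(* Consider the data-driven setting described in the context (with $F(0)=0$, the data generated by $(A_{\mathrm{true}},B_{\mathrm{true}})$ with noise satisfying the energy bound, and $\begin{bmatrix}\mathcal F\\ \mathcal G\mathcal U\end{bmatrix}$ of full row rank). Suppose that there exist polynomials $a,b,\beta\in\mathbb R[x]$, $c\in\mathbb R^m[x]$ and real numbers $\alpha,\epsilon>0$ such that (i) $b(x)>0$ and $\beta(x)>0$ for all $x\in\mathbb R^n\setminus\{0\}$; (ii) the vectors $\dfrac{a(x)F(x)}{b^{\alpha}(x)\|x\|}$ and $\dfrac{G(x)c(x)}{b^{\alpha}(x)\|x\|}$ are integrable on $\{x\in\mathbb R^n\mid \|x\|\ge 1\}$; (iii) $c(0)=0$; (iv) $a(x)-\epsilon\in \mathrm{SOS}[x]$; (v) $$\begin{bmatrix} -R_{\bar s}^{\top}(x)N_{22}^{-1}N_{21}+R_s^{\top}(x)v_s-\beta(x) & (N|N_{22})^{\frac12}R_{\bar s}^{\top}(x)\\ (N|N_{22})^{\frac12}R_{\bar s}(x) & \left(R_{\bar s}^{\top}(x)N_{22}^{-1}N_{21}-R_s^{\top}(x)v_s\right)N_{22} \end{bmatrix}\in \mathrm{SOS}^{1+\ell}[x],$$ where $R(x)\in\mathbb R^{n(f+g)}[x]$ is the vector obtained by stacking, in this order, the $n$ blocks $$b(x)\frac{\partial (a(x)F(x))}{\partial x_i}-\alpha\frac{\partial b(x)}{\partial x_i}a(x)F(x)\in\mathbb R^f,\qquad i=1,\dots,n,$$ followed by the $n$ blocks $$b(x)\frac{\partial (G(x)c(x))}{\partial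 x_i}-\alpha\frac{\partial b(x)}{\partial x_i}G(x)c(x)\in\mathbb R^g,\qquad i=1,\dots,n.$$ Let $K(x)=\frac{c(x)}{a(x)}$. Then, for any $(A,B)\in\Sigma$ and almost all initial conditions $x(0)\in\mathbb R^n$ (i.e., all except a set of Lebesgue measure zero), the state trajectory $x(t)$ of the closed-loop system $\dot x=AF(x)+BG(x)K(x)$ tends to $0$ as $t\to\infty$.
   Context: Notation. $\mathbb S^k$: real symmetric $k\times k$ matrices; $>0,\ge 0,<0,\le 0$ for symmetric matrices denote (semi)definiteness. $\mathbb R^{p\times q}[x]$: $p\times q$ matrices of real polynomials in $x=(x_1,\dots,x_n)$; $\mathbb R^p[x]=\mathbb R^{p\times 1}[x]$, $\mathbb R[x]=\mathbb R^{1\times 1}[x]$. $\mathrm{SOS}^q[x]$ is the set of $Q\in\mathbb R^{q\times q}[x]$ for which there exist $p$ and $\hat Q\in\mathbb R^{p\times q}[x]$ with $Q(x)=\hat Q^\top(x)\hat Q(x)$; $\mathrm{SOS}[x]=\mathrm{SOS}^1[x]$. For a vector $v$ and index set $\sigma$, $v_\sigma$ is the subvector with entries indexed by $\sigma$; for a matrix $M$, $M_{\sigma\bullet}$ is the submatrix of rows indexed by $\sigma$. $\mathrm{vec}$ stacks the columns of a matrix; $\otimes$ is the Kronecker product. Setting. $F\in\mathbb R^f[x]$ with $F(0)=0$ and $G\in\mathbb R^{g\times m}[x]$ are given. The true system is $\dot x=A_{\mathrm{true}}F(x)+B_{\mathrm{true}}G(x)u+w$ with $A_{\mathrm{true}}\in\mathbb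 R^{n\times f}$, $B_{\mathrm{true}}\in\mathbb R^{n\times g}$. For sample times $t_0<\dots<t_{T-1}$ put $\dot{\mathcal X}=[\dot x(t_0)\cdots\dot x(t_{T-1})]$, $\mathcal X=[x(t_0)\cdots x(t_{T-1})]$, $\mathcal F=[F(x(t_0))\cdots F(x(t_{T-1}))]$, $\mathcal G=[G(x(t_0))\cdots G(x(t_{T-1}))]$, $\mathcal U=\mathrm{blockdiag}(u(t_0),\dots,u(t_{T-1}))\in\mathbb R^{mT\times T}$, $\mathcal W=[w(t_0)\cdots w(t_{T-1})]$. The data satisfy $\dot{\mathcal X}=A_{\mathrm{true}}\mathcal F+B_{\mathrm{true}}\mathcal G\mathcal U+\mathcal W$, where the unknown $\mathcal W\in\mathbb R^{n\times T}$ satisfies the noise bound $$\begin{bmatrix}1\\ \mathrm{vec}(\mathcal W^\top)\end{bmatrix}^\top\Phi\begin{bmatrix}1\\ \mathrm{vec}(\mathcal W^\top)\end{bmatrix}\ge 0,\qquad \Phi=\begin{bmatrix}\Phi_{11}&0\\0&-I\end{bmatrix},$$ with given $\Phi_{11}\ge 0$. Standing assumption: $\begin{bmatrix}\mathcal F\\ \mathcal G\mathcal U\end{bmatrix}$ has full row rank. $\Sigma_d$ is the set of $(A,B)\in\mathbb R^{n\times f}\times\mathbb R^{n\times g}$ such that $\dot{\mathcal X}=A\mathcal F+B\mathcal G\mathcal U+\mathcal W$ for some $\mathcal W$ satisfying the noise bound. For a given $S\subseteq\{1,\dots,n\}\times\{1,\dots,f+g\}$ (entries known a priori), $\Sigma_{pk}(S)$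 is the set of $(A,B)$ with $[A\ B]_{ij}=[A_{\mathrm{true}}\ B_{\mathrm{true}}]_{ij}$ for all $(i,j)\in S$. $\Sigma:=\Sigma_d\cap\Sigma_{pk}(S)$. Put $\mathcal D=\begin{bmatrix}I_n\otimes\mathcal F\\ I_n\otimes\mathcal G\mathcal U\end{bmatrix}$ and, for $(A,B)$, $v=\begin{bmatrix}\mathrm{vec}(A^\top)\\ \mathrm{vec}(B^\top)\end{bmatrix}\in\mathbb R^{n(f+g)}$. Let $s$ be the set of indices of entries of $v$ that are known (those corresponding to entries in $S$), $\bar s=\{1,\dots,n(f+g)\}\setminus s$, $\ell=|\bar s|$; $v_s$ denotes the known vector of values from $(A_{\mathrm{true}},B_{\mathrm{true}})$. Define $$N=\begin{bmatrix}1&0\\ \mathrm{vec}(\dot{\mathcal X}^\top)-\mathcal D_{s\bullet}^\top v_s&-\mathcal D_{\bar s\bullet}^\top\end{bmatrix}^\top\Phi\begin{bmatrix}1&0\\ \mathrm{vec}(\dot{\mathcal X}^\top)-\mathcal D_{s\bullet}^\top v_s&-\mathcal D_{\bar s\bullet}^\top\end{bmatrix}\in\mathbb S^{1+\ell},$$ partitioned as $N=\begin{bmatrix}N_{11}&N_{12}\\N_{21}&N_{22}\end{bmatrix}$ with $N_{11}\in\mathbb R$, and $N|N_{22}=N_{11}-N_{12}N_{22}^{-1}N_{21}\in\mathbb R$. In this setting $N_{22}<0$ and $N|N_{22}\ge 0$, so the inverse and square root are well defined. *)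

theory Defs
  imports "HOL-Analysis.Analysis"
begin

(* Polynomials in x = (x_1, ..., x_n) are represented by polynomial functions on real^'n
   (predicate polynomial_function); over the reals this loses nothing. *)

section \<open>Block matrices, vectorization, Kronecker product\<close>

(* A matrix is the vector of its rows, so vstack stacks vectors as well as matrices. *)
definition vstack :: "'a ^ 'i::finite \<Rightarrow> 'a ^ 'j::finite \<Rightarrow> 'a ^ ('i + 'j)" where
  "vstack u v = (\<chi> k. case k of Inl i \<Rightarrow> u $ i | Inr j \<Rightarrow> v $ j)"

definition hstack :: "'a ^ 'i::finite ^ 'r::finite \<Rightarrow> 'a ^ 'j::finite ^ 'r \<Rightarrow> 'a ^ ('i + 'j) ^ 'r" where
  "hstack M N = (\<chi> r. vstack (M $ r) (N $ r))"

(* The entry in row r of column c of M gets the index (c, r) in the stack of columns. *)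
definition vectorize :: "'a ^ 'c::finite ^ 'r::finite \<Rightarrow> 'a ^ ('c \<times> 'r)" where
  "vectorize M = (\<chi> p. M $ snd p $ fst p)"

definition kronecker ::
  "real ^ 'c::finite ^ 'r::finite \<Rightarrow> real ^ 'd::finite ^ 'q::finite \<Rightarrow> real ^ ('c \<times> 'd) ^ ('r \<times> 'q)" where
  "kronecker M N = (\<chi> p q. M $ fst p $ fst q * N $ snd p $ snd q)"

section \<open>Subvectors and submatrices\<close>

(* The number of unknown entries, possibly 0, depends on a set and cannot be the cardinality of
   an index type.  The subvector with indices in \<sigma> (for a matrix: the submatrix of
   the rows in \<sigma>) is therefore kept at full length, with zeros outside \<sigma>.  Inner
   products and matrix products contracted over \<sigma> are those of the subvectors. *)
definition sub_on :: "'k set \<Rightarrow> 'a::zero ^ 'k::finite \<Rightarrow> 'a ^ 'k" where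
  "sub_on \<sigma> v = (\<chi> k. if k \<in> \<sigma> then v $ k else 0)"

(* Inverse of the \<sigma> x \<sigma> block of a matrix M that vanishes outside this block;
   the result vanishes outside the block as well.  The matrix sub_on \<sigma> (mat 1) is the
   identity of that block.  For \<sigma> = UNIV this is matrix_inv. *)
definition inverse_on :: "'k set \<Rightarrow> real ^ 'k::finite ^ 'k \<Rightarrow> real ^ 'k ^ 'k" where
  "inverse_on \<sigma> M =
     (SOME X. sub_on \<sigma> X = X \<and> M ** X = sub_on \<sigma> (mat 1) \<and> X ** M = sub_on \<sigma> (mat 1))"

section \<open>Sums of squares and partial derivatives\<close>

(* The J x J block of Q is Qh^T Qh for a polynomial matrix Qh with rows k < p and
   columns indexed by J. *)
definition SOS_on :: "'k set \<Rightarrow> (real ^ 'n::finite \<Rightarrow> real ^ 'k::finite ^ 'k) \<Rightarrow> bool" where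
  "SOS_on J Q \<longleftrightarrow>
     (\<exists>(p::nat) (Qh :: nat \<Rightarrow> 'k \<Rightarrow> real ^ 'n \<Rightarrow> real).
        (\<forall>k<p. \<forall>i\<in>J. polynomial_function (Qh k i)) \<and>
        (\<forall>x. \<forall>i\<in>J. \<forall>j\<in>J. Q x $ i $ j = (\<Sum>k<p. Qh k i x * Qh k j x)))"

definition SOS :: "(real ^ 'n::finite \<Rightarrow> real) \<Rightarrow> bool" where
  "SOS q \<longleftrightarrow> SOS_on (UNIV :: 1 set) (\<lambda>x. \<chi> i j. q x)"

definition partial_deriv ::
  "'n \<Rightarrow> (real ^ 'n::finite \<Rightarrow> 'b::real_normed_vector) \<Rightarrow> real ^ 'n \<Rightarrow> 'b" where
  "partial_deriv i h x = frechet_derivative h (at x) (axis i 1)"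

section \<open>Data\<close>

(* The matrix with columns z (t_k). *)
definition samples :: "('t::finite \<Rightarrow> real) \<Rightarrow> (real \<Rightarrow> real ^ 'i::finite) \<Rightarrow> real ^ 't ^ 'i" where
  "samples tm z = (\<chi> i k. z (tm k) $ i)"

(* The matrix [Z (t_0) ... Z (t_{T-1})] for a matrix-valued Z; column (k, j) is column j of Z (t_k). *)
definition block_samples ::
  "('t::finite \<Rightarrow> real) \<Rightarrow> (real \<Rightarrow> real ^ 'm::finite ^ 'i::finite) \<Rightarrow> real ^ ('t \<times> 'm) ^ 'i" where
  "block_samples tm Z = (\<chi> i q. Z (tm (fst q)) $ i $ snd q)"

definition blockdiag_samples ::
  "('t::finite \<Rightarrow> real) \<Rightarrow> (real \<Rightarrow> real ^ 'm::finite) \<Rightarrow> real ^ 't ^ ('t \<times> 'm)" where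
  "blockdiag_samples tm u = (\<chi> q k. if fst q = k then u (tm k) $ snd q else 0)"

definition noise_matrix :: "real \<Rightarrow> real ^ (1 + 'k::finite) ^ (1 + 'k)" where
  "noise_matrix \<phi> = vstack (hstack (\<phi> *\<^sub>R mat 1) 0) (hstack 0 (- mat 1))"

definition noise_bound :: "real \<Rightarrow> real ^ 't::finite ^ 'n::finite \<Rightarrow> bool" where
  "noise_bound \<phi> W \<longleftrightarrow>
     (let y = vstack (1 :: real ^ 1) (vectorize (transpose W)) in y \<bullet> (noise_matrix \<phi> *v y) \<ge> 0)"

section \<open>Consistent systems\<close>

(* Xd: samples of the state derivative; Fd, Gd: the data matrices multiplied by A and B, i.e.
   columns F (x (t_k)) and G (x (t_k)) u (t_k). *)
definition Sigma_d ::
  "real \<Rightarrow> real ^ 't::finite ^ 'n::finite \<Rightarrow> real ^ 't ^ 'f::finite \<Rightarrow> real ^ 't ^ 'g::finite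
   \<Rightarrow> ((real ^ 'f ^ 'n) \<times> (real ^ 'g ^ 'n)) set" where
  "Sigma_d \<phi> Xd Fd Gd = {(A, B). \<exists>W. Xd = A ** Fd + B ** Gd + W \<and> noise_bound \<phi> W}"

definition Sigma_pk ::
  "('n \<times> ('f + 'g)) set \<Rightarrow> real ^ 'f::finite ^ 'n::finite \<Rightarrow> real ^ 'g::finite ^ 'n
   \<Rightarrow> ((real ^ 'f ^ 'n) \<times> (real ^ 'g ^ 'n)) set" where
  "Sigma_pk S At Bt = {(A, B). \<forall>(i, j)\<in>S. hstack A B $ i $ j = hstack At Bt $ i $ j}"

definition coeff_vec ::
  "real ^ 'f::finite ^ 'n::finite \<Rightarrow> real ^ 'g::finite ^ 'n \<Rightarrow> real ^ ('n \<times> 'f + 'n \<times> 'g)" where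
  "coeff_vec A B = vstack (vectorize (transpose A)) (vectorize (transpose B))"

(* Positions in coeff_vec A B of the entries of [A B] listed in S. *)
definition known_indices :: "('n \<times> ('f + 'g)) set \<Rightarrow> ('n \<times> 'f + 'n \<times> 'g) set" where
  "known_indices S =
     {k. case k of Inl (i, j) \<Rightarrow> (i, Inl j) \<in> S | Inr (i, j) \<Rightarrow> (i, Inr j) \<in> S}"

definition data_kron ::
  "real ^ 't::finite ^ 'f::finite \<Rightarrow> real ^ 't ^ 'g::finite
   \<Rightarrow> real ^ ('n::finite \<times> 't) ^ ('n \<times> 'f + 'n \<times> 'g)" where
  "data_kron Fd Gd = vstack (kronecker (mat 1) Fd) (kronecker (mat 1) Gd)"

(* The matrix N for the set s of known indices and known values v; its rows and columns
   Inr k with k in s are padding and vanish. *)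
definition data_N ::
  "real \<Rightarrow> real ^ 't::finite ^ 'n::finite \<Rightarrow> real ^ 't ^ 'f::finite \<Rightarrow> real ^ 't ^ 'g::finite
   \<Rightarrow> ('n \<times> 'f + 'n \<times> 'g) set \<Rightarrow> real ^ ('n \<times> 'f + 'n \<times> 'g)
   \<Rightarrow> real ^ (1 + ('n \<times> 'f + 'n \<times> 'g)) ^ (1 + ('n \<times> 'f + 'n \<times> 'g))" where
  "data_N \<phi> Xd Fd Gd s v =
     (let D = data_kron Fd Gd;
          z = vectorize (transpose Xd) - transpose (sub_on s D) *v sub_on s v;
          E = vstack (hstack (mat 1 :: real ^ 1 ^ 1) 0)
                (hstack (columnvector z) (- transpose (sub_on (- s) D)))
      in transpose E ** noise_matrix \<phi> ** E)"

definition blk11 :: "real ^ (1 + 'k::finite) ^ (1 + 'k) \<Rightarrow> real" where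
  "blk11 N = N $ Inl 1 $ Inl 1"

definition blk12 :: "real ^ (1 + 'k::finite) ^ (1 + 'k) \<Rightarrow> real ^ 'k" where
  "blk12 N = (\<chi> k. N $ Inl 1 $ Inr k)"

definition blk21 :: "real ^ (1 + 'k::finite) ^ (1 + 'k) \<Rightarrow> real ^ 'k" where
  "blk21 N = (\<chi> k. N $ Inr k $ Inl 1)"

definition blk22 :: "real ^ (1 + 'k::finite) ^ (1 + 'k) \<Rightarrow> real ^ 'k ^ 'k" where
  "blk22 N = (\<chi> k l. N $ Inr k $ Inr l)"

definition schur_compl :: "'k set \<Rightarrow> real ^ (1 + 'k::finite) ^ (1 + 'k) \<Rightarrow> real" where
  "schur_compl \<sigma> N = blk11 N - blk12 N \<bullet> (inverse_on \<sigma> (blk22 N) *v blk21 N)"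

section \<open>The matrix inequality\<close>

definition R_vec ::
  "real \<Rightarrow> (real ^ 'n::finite \<Rightarrow> real) \<Rightarrow> (real ^ 'n \<Rightarrow> real ^ 'f::finite) \<Rightarrow> (real ^ 'n \<Rightarrow> real ^ 'g::finite)
   \<Rightarrow> real ^ 'n \<Rightarrow> real ^ ('n \<times> 'f + 'n \<times> 'g)" where
  "R_vec \<alpha> b aF Gc x =
     vstack
       (\<chi> p. (b x *\<^sub>R partial_deriv (fst p) aF x - (\<alpha> * partial_deriv (fst p) b x) *\<^sub>R aF x) $ snd p)
       (\<chi> p. (b x *\<^sub>R partial_deriv (fst p) Gc x - (\<alpha> * partial_deriv (fst p) b x) *\<^sub>R Gc x) $ snd p)"

(* The matrix required to be a sum of squares, for r = R(x) and \<beta> = \<beta>(x). *)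
definition certificate ::
  "real ^ (1 + 'k::finite) ^ (1 + 'k) \<Rightarrow> 'k set \<Rightarrow> real ^ 'k \<Rightarrow> real ^ 'k \<Rightarrow> real
   \<Rightarrow> real ^ (1 + 'k) ^ (1 + 'k)" where
  "certificate N s v r \<beta> =
     (let N22 = blk22 N;
          h = sub_on (- s) r \<bullet> (inverse_on (- s) N22 *v blk21 N);
          k = sub_on s r \<bullet> sub_on s v;
          q = sqrt (schur_compl (- s) N) *\<^sub>R sub_on (- s) r
      in vstack (hstack ((- h + k - \<beta>) *\<^sub>R (mat 1 :: real ^ 1 ^ 1)) (rowvector q))
           (hstack (columnvector q) ((h - k) *\<^sub>R N22)))"

section \<open>Trajectories\<close>

definition trajectory :: "(real ^ 'n::finite \<Rightarrow> real ^ 'n) \<Rightarrow> real ^ 'n \<Rightarrow> (real \<Rightarrow> real ^ 'n) \<Rightarrow> bool" where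
  "trajectory f x0 x \<longleftrightarrow>
     x 0 = x0 \<and> (\<forall>t\<ge>0. (x has_vector_derivative f (x t)) (at t within {0..}))"

end

theory Submission
  imports Defs
begin

text \<open>
  With \<open>\<rho> = a / b\<^sup>\<alpha>\<close>, the divergence of \<open>\<rho> f\<close> along the closed loop \<open>f\<close> equals
  \<open>b\<^sup>-\<^sup>\<alpha>\<^sup>-\<^sup>1\<close> times the inner product of \<open>R\<close> with the coefficients of \<open>(A, B)\<close>, and the certificate makes
  this positive for all consistent \<open>(A, B)\<close> (S-lemma).  What remains is Rantzer's dual Lyapunov theorem.

  Dividing \<open>f\<close> and multiplying \<open>\<rho>\<close> by the same positive \<open>\<gamma>\<close> changes neither the orbits nor \<open>\<rho> f\<close>; a suitable
  \<open>\<gamma>\<close> gives \<open>f\<close> linear growth, hence a global flow, and gives \<open>\<rho>\<close> finite mass away from the origin.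
  An Euler step \<open>x + h f x\<close> multiplies the mass of a compact set by at least \<open>1 + r h\<close>, because the derivative in \<open>h\<close> of
  \<open>\<rho>\<close> times the Jacobian is the divergence of \<open>\<rho> f\<close>; iterating and passing to the limit, the time-one map strictly expands mass.
  For such a map the points that return infinitely often to a set of finite mass form a null set, so almost
  every orbit eventually stays in any given ball about the origin.
\<close>

section \<open>Ordinary differential equations\<close>

text \<open>Nothing prevents the closed loop from escaping in finite time, and the integrability
  hypothesis controls \<open>\<rho> |f| / |x|\<close> but not \<open>\<rho>\<close>. One function
  cures both: \<open>\<gamma> = sqrt (\<sigma>^2 + |f|^2 / (1 + |x|^2))\<close> is positive and
  continuously differentiable, bounds \<open>f / \<gamma>\<close> by
  \<open>sqrt (1 + |x|^2)\<close>, and is at most \<open>\<sigma> + |f| / |x|\<close>, so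
  \<open>\<rho> \<gamma>\<close> is integrable at infinity once \<open>\<rho> \<sigma>\<close> is.
  Global existence for the original speed is recovered only at the end, along orbits already known
  to converge. Euler steps are explicit maps to which a change of variables applies directly; only
  continuity of the time-one map enters the limit. The gain \<open>r\<close> depends on one compact
  set avoiding 0 that holds all Euler iterates, hence survives the limit. The mass may be infinite
  near 0, where \<open>b\<close> may vanish, so all measure estimates are made on compact sets
  avoiding 0 and extended by inner regularity. This also converts expansion of images, which Euler
  steps give, into contraction of preimages, which the recurrence argument uses.\<close>

lemma differential_inequality:
  fixes u :: "real \<Rightarrow> real"
  assumes der: "\<And>t. t \<in> {0..T} \<Longrightarrow> (u has_real_derivative u' t) (at t within {0..T})"
    and le: "\<And>t. t \<in> {0..T} \<Longrightarrow> u' t \<le> c * u t"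
    and t: "t \<in> {0..T}"
  shows "u t \<le> u 0 * exp (c * t)"
proof -
  define g where "g t = u t * exp (- c * t)" for t
  define g' where "g' t = (u' t - c * u t) * exp (- c * t)" for t
  have der_g: "(g has_real_derivative g' t) (at t within {0..T})" if "t \<in> {0..T}" for t
    unfolding g_def g'_def
    by (rule derivative_eq_intros der[OF that] refl | simp add: algebra_simps)+
  have "g t \<le> g 0"
  proof (cases "t = 0")
    case False
    then have "0 < t" using t by auto
    then have "0 \<le> t" by simp
    then show ?thesis
    proof (rule DERIV_nonpos_imp_decreasing_open)
      fix s assume s: "0 < s" "s < t"
      then have "s \<in> interior {0..T}" using t by auto
      then have "(g has_real_derivative g' s) (at s)"
        using der_g[of s] at_within_interior[of s "{0..T}"] s t by auto
      moreover have "g' s \<le> 0"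
        using le[of s] s t unfolding g'_def by (auto simp: mult_le_0_iff)
      ultimately show "\<exists>y. (g has_real_derivative y) (at s) \<and> y \<le> 0" by blast
    next
      have "continuous_on {0..T} g"
        using der_g by (meson DERIV_continuous continuous_on_eq_continuous_within)
      then show "continuous_on {0..t} g" by (rule continuous_on_subset) (use t in auto)
    qed
  qed simp
  then have "u t * exp (- c * t) * exp (c * t) \<le> u 0 * exp (c * t)"
    by (auto simp: g_def intro!: mult_right_mono)
  then show ?thesis by (simp add: mult.assoc flip: exp_add)
qed

lemma has_real_derivative_norm_power2:
  fixes x :: "real \<Rightarrow> 'a::real_inner"
  assumes "(x has_vector_derivative v) (at t within S)"
  shows "((\<lambda>t. (norm (x t))\<^sup>2) has_real_derivative 2 * (x t \<bullet> v)) (at t within S)"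
proof -
  have "((\<lambda>t. x t \<bullet> x t) has_derivative (\<lambda>h. x t \<bullet> (h *\<^sub>R v) + (h *\<^sub>R v) \<bullet> x t)) (at t within S)"
    using assms unfolding has_vector_derivative_def by (intro has_derivative_inner) auto
  moreover have "(\<lambda>h. x t \<bullet> (h *\<^sub>R v) + (h *\<^sub>R v) \<bullet> x t) = (*) (2 * (x t \<bullet> v))"
    by (auto simp: inner_commute fun_eq_iff)
  ultimately show ?thesis
    by (simp add: has_field_derivative_def power2_norm_eq_inner)
qed

text \<open>Gronwall's estimate, run on the squared distance because that stays differentiable where
  the two solutions meet.\<close>

lemma solutions_distance:
  fixes x y :: "real \<Rightarrow> 'a::real_inner"
  assumes x: "\<And>t. t \<in> {0..T} \<Longrightarrow> (x has_vector_derivative f (x t)) (at t within {0..T})"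
    and y: "\<And>t. t \<in> {0..T} \<Longrightarrow> (y has_vector_derivative f (y t)) (at t within {0..T})"
    and B: "\<And>t. t \<in> {0..T} \<Longrightarrow> x t \<in> B \<and> y t \<in> B"
    and L: "L-lipschitz_on B f"
    and t: "t \<in> {0..T}"
  shows "norm (x t - y t) \<le> norm (x 0 - y 0) * exp (L * t)"
proof -
  have "(norm (x t - y t))\<^sup>2 \<le> (norm (x 0 - y 0))\<^sup>2 * exp ((2 * L) * t)"
  proof (rule differential_inequality[OF _ _ t])
    fix t assume t: "t \<in> {0..T}"
    show "((\<lambda>t. (norm (x t - y t))\<^sup>2) has_real_derivative
        2 * ((x t - y t) \<bullet> (f (x t) - f (y t)))) (at t within {0..T})"
      by (rule has_real_derivative_norm_power2) (intro has_vector_derivative_diff x y t)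
    have "(x t - y t) \<bullet> (f (x t) - f (y t)) \<le> norm (x t - y t) * norm (f (x t) - f (y t))"
      by (rule norm_cauchy_schwarz)
    also have "\<dots> \<le> norm (x t - y t) * (L * norm (x t - y t))"
      using lipschitz_onD[OF L, of "x t" "y t"] B[OF t] by (intro mult_left_mono) (auto simp: dist_norm)
    finally show "2 * ((x t - y t) \<bullet> (f (x t) - f (y t))) \<le> 2 * L * (norm (x t - y t))\<^sup>2"
      by (simp add: power2_eq_square algebra_simps)
  qed
  also have "\<dots> = (norm (x 0 - y 0) * exp (L * t))\<^sup>2"
    by (simp add: power_mult_distrib exp_double[symmetric] mult.assoc)
  finally show ?thesis by (rule power2_le_imp_le) simp
qed

text \<open>The lower bound is what keeps orbits away from the origin; it later makes the time-one
  map proper and keeps its images of compact sets off 0.\<close>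

lemma solution_growth:
  fixes x :: "real \<Rightarrow> 'a::real_inner"
  assumes x: "\<And>t. t \<in> {0..T} \<Longrightarrow> (x has_vector_derivative f (x t)) (at t within {0..T})"
    and C: "\<And>z. norm (f z) \<le> C * norm z"
    and t: "t \<in> {0..T}"
  shows "norm (x t) \<le> norm (x 0) * exp (C * t)" and "norm (x 0) * exp (- (C * t)) \<le> norm (x t)"
proof -
  have inner: "\<bar>x t \<bullet> f (x t)\<bar> \<le> C * (norm (x t))\<^sup>2" for t
  proof -
    have "\<bar>x t \<bullet> f (x t)\<bar> \<le> norm (x t) * norm (f (x t))" by (rule Cauchy_Schwarz_ineq2)
    also have "\<dots> \<le> norm (x t) * (C * norm (x t))" using C by (intro mult_left_mono) auto
    finally show ?thesis by (simp add: power2_eq_square algebra_simps)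
  qed
  have "(norm (x t))\<^sup>2 \<le> (norm (x 0))\<^sup>2 * exp (2 * C * t)"
    by (rule differential_inequality[OF has_real_derivative_norm_power2[OF x] _ t])
       (use inner in \<open>auto simp: abs_le_iff algebra_simps\<close>)
  also have "\<dots> = (norm (x 0) * exp (C * t))\<^sup>2"
    by (simp add: power_mult_distrib exp_double[symmetric] mult.assoc)
  finally show "norm (x t) \<le> norm (x 0) * exp (C * t)" by (rule power2_le_imp_le) simp
  \<comment> \<open>The lower bound is the same differential inequality for minus the squared norm,
    with the rate \<open>- 2 * C\<close>.\<close>
  have "- (norm (x t))\<^sup>2 \<le> - (norm (x 0))\<^sup>2 * exp ((- 2 * C) * t)"
  proof (rule differential_inequality[OF _ _ t])
    fix t assume t: "t \<in> {0..T}"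
    show "((\<lambda>t. - (norm (x t))\<^sup>2) has_real_derivative - (2 * (x t \<bullet> f (x t)))) (at t within {0..T})"
      by (intro DERIV_minus has_real_derivative_norm_power2 x t)
    show "- (2 * (x t \<bullet> f (x t))) \<le> - 2 * C * - (norm (x t))\<^sup>2"
      using inner[of t] by (auto simp: abs_le_iff)
  qed
  then have "(norm (x 0) * exp (- (C * t)))\<^sup>2 \<le> (norm (x t))\<^sup>2"
    by (simp add: power_mult_distrib exp_double[symmetric] mult.assoc)
  then show "norm (x 0) * exp (- (C * t)) \<le> norm (x t)" by (rule power2_le_imp_le) simp
qed

lemma at_within_atLeast_Icc:
  fixes t :: real
  assumes "a \<le> t" "t < b"
  shows "at t within {a..b} = at t within {a..}"
  by (rule at_within_nhd[where S = "{..<b}"]) (use assms in auto)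

lemma integral_has_vector_derivative_atLeast:
  fixes h :: "real \<Rightarrow> 'a::banach"
  assumes "continuous_on {a..} h" and "a \<le> t"
  shows "((\<lambda>u. integral {a..u} h) has_vector_derivative h t) (at t within {a..})"
proof -
  have "((\<lambda>u. integral {a..u} h) has_vector_derivative h t) (at t within {a..t+1})"
    using assms by (intro integral_has_vector_derivative continuous_on_subset[OF assms(1)]) auto
  then show ?thesis using at_within_atLeast_Icc[of a t "t + 1"] assms by simp
qed

text \<open>Picard iteration in an exponentially weighted norm: the unknown is
  \<open>z t = exp (- 2 * K * t) *\<^sub>R x t\<close>, and the weight makes the integral operator a
  contraction on the whole half-line at once, so no local solutions have to be continued. Taking
  \<open>K = L + 1\<close> only ensures \<open>K > 0\<close>.\<close>

lemma global_solution_of_lipschitz: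
  fixes g :: "'a::banach \<Rightarrow> 'a"
  assumes lip: "L-lipschitz_on UNIV g"
  obtains x where "x 0 = x0"
    and "\<And>t. 0 \<le> t \<Longrightarrow> (x has_vector_derivative g (x t)) (at t within {0..})"
proof -
  define K where "K = L + 1"
  have K: "K-lipschitz_on UNIV g" "K > 0"
    using lip lipschitz_on_nonneg[OF lip] unfolding K_def by (auto intro: lipschitz_on_le)
  define h where "h z r = g (exp (2 * K * r) *\<^sub>R apply_bcontfun z r)" for z :: "real \<Rightarrow>\<^sub>C 'a" and r
  \<comment> \<open>\<open>P\<close> is the integral operator written for the weighted unknown.
    Bounded continuous functions live on all of the reals, hence \<open>max 0 t\<close>, which
    freezes the value at 0 for negative times.\<close>
  define P where "P z t = exp (- 2 * K * max 0 t) *\<^sub>R (x0 + integral {0..max 0 t} (h z))" for z t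
  have cont_h: "continuous_on S (h z)" for S z
    unfolding h_def
    by (intro continuous_on_compose2[OF lipschitz_on_continuous_on[OF K(1)]] continuous_intros) auto
  have int_h: "h z integrable_on {0..s}" for z s
    by (rule integrable_continuous_real) (rule cont_h)
  have int_exp: "((\<lambda>r. c * exp (2 * K * r)) has_integral c * (exp (2 * K * s) - 1) / (2 * K)) {0..s}"
    if "0 \<le> s" for s c
  proof -
    have "((\<lambda>r. c * exp (2 * K * r)) has_integral
        c * exp (2 * K * s) / (2 * K) - c * exp (2 * K * 0) / (2 * K)) {0..s}"
      by (rule fundamental_theorem_of_calculus[OF that],
          unfold has_real_derivative_iff_has_vector_derivative[symmetric])
         (use K in \<open>auto intro!: derivative_eq_intros\<close>)
    then show ?thesis by (simp add: diff_divide_distrib right_diff_distrib)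
  qed
  \<comment> \<open>This one estimate gives both that \<open>P z\<close> is bounded and, with
    \<open>c = K * dist z w\<close>, the contraction factor
    \<open>K / (2 * K) = 1 / 2\<close>.\<close>
  have weight: "exp (- 2 * K * s) * (c * (exp (2 * K * s) - 1) / (2 * K)) \<le> c / (2 * K)"
    if "0 \<le> s" "0 \<le> c" for s c
  proof -
    have "exp (- 2 * K * s) * (c * (exp (2 * K * s) - 1) / (2 * K)) = c * (1 - exp (- 2 * K * s)) / (2 * K)"
      by (simp add: field_simps exp_minus)
    also have "\<dots> \<le> c / (2 * K)"
      using that K by (intro divide_right_mono) (auto simp: mult_left_le)
    finally show ?thesis .
  qed
  have P_bcontfun: "P z \<in> bcontfun" for z
  proof (rule bcontfun_normI)
    have "continuous_on {0..} (\<lambda>u. integral {0..u} (h z))"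
      using integral_has_vector_derivative_atLeast[of 0 "h z", OF cont_h]
      by (meson atLeast_iff continuous_on_eq_continuous_within has_vector_derivative_continuous)
    then have "continuous_on UNIV (\<lambda>t. integral {0..max 0 t} (h z))"
      by (rule continuous_on_compose2) (auto intro!: continuous_intros)
    then show "continuous_on UNIV (P z)" unfolding P_def by (intro continuous_intros)
    fix t :: real
    define s where "s = max 0 t"
    define c where "c = norm (g 0) + K * norm z"
    have c: "0 \<le> c" using K by (simp add: c_def)
    have "norm (h z r) \<le> c * exp (2 * K * r)" if "r \<in> {0..s}" for r
    proof -
      have "norm (h z r) \<le> norm (g 0) + K * norm (exp (2 * K * r) *\<^sub>R apply_bcontfun z r)"
        using lipschitz_onD[OF K(1), of "exp (2 * K * r) *\<^sub>R apply_bcontfun z r" 0]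
          norm_triangle_sub[of "h z r" "g 0"]
        unfolding h_def by (simp add: dist_norm)
      also have "\<dots> \<le> norm (g 0) * exp (2 * K * r) + K * (exp (2 * K * r) * norm z)"
        using K that norm_bounded[of z r]
        by (intro add_mono mult_left_mono) (auto simp: mult_le_cancel_left1)
      finally show ?thesis by (simp add: c_def algebra_simps)
    qed
    then have "norm (integral {0..s} (h z)) \<le> integral {0..s} (\<lambda>r. c * exp (2 * K * r))"
      using int_exp[of s c] by (intro integral_norm_bound_integral int_h) (auto simp: s_def)
    also have "\<dots> = c * (exp (2 * K * s) - 1) / (2 * K)"
      by (intro integral_unique int_exp) (simp add: s_def)
    finally have "norm (P z t) \<le> exp (- 2 * K * s) * (norm x0 + c * (exp (2 * K * s) - 1) / (2 * K))"
      unfolding P_def s_def[symmetric] by (auto intro!: mult_left_mono norm_triangle_le)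
    also have "\<dots> \<le> norm x0 + c / (2 * K)"
      unfolding distrib_left using weight[of s c] c K
      by (intro add_mono) (auto simp: s_def mult_le_cancel_right2)
    finally show "norm (P z t) \<le> norm x0 + c / (2 * K)" .
  qed
  define Q where "Q z = Bcontfun (P z)" for z
  have Q: "apply_bcontfun (Q z) = P z" for z
    unfolding Q_def using P_bcontfun by (rule Bcontfun_inverse)
  have "dist (Q z) (Q w) \<le> 1 / 2 * dist z w" for z w
  proof (rule dist_bound)
    fix t :: real
    define s where "s = max 0 t"
    define c where "c = K * dist z w"
    have "norm (h z r - h w r) \<le> c * exp (2 * K * r)" if "r \<in> {0..s}" for r
    proof -
      have "norm (h z r - h w r) \<le> K * norm (exp (2 * K * r) *\<^sub>R (apply_bcontfun z r - apply_bcontfun w r))"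
        using lipschitz_onD[OF K(1), of "exp (2 * K * r) *\<^sub>R apply_bcontfun z r" "exp (2 * K * r) *\<^sub>R apply_bcontfun w r"]
        unfolding h_def by (simp add: dist_norm scaleR_diff_right)
      also have "\<dots> = K * (exp (2 * K * r) * dist (apply_bcontfun z r) (apply_bcontfun w r))"
        by (simp add: dist_norm)
      also have "\<dots> \<le> K * (exp (2 * K * r) * dist z w)"
        using K by (intro mult_left_mono dist_bounded) auto
      finally show ?thesis by (simp add: c_def algebra_simps)
    qed
    then have "norm (integral {0..s} (\<lambda>r. h z r - h w r)) \<le> integral {0..s} (\<lambda>r. c * exp (2 * K * r))"
      using int_exp[of s c] by (intro integral_norm_bound_integral integrable_diff int_h) (auto simp: s_def)
    also have "\<dots> = c * (exp (2 * K * s) - 1) / (2 * K)"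
      by (intro integral_unique int_exp) (simp add: s_def)
    finally have bound: "norm (integral {0..s} (h z) - integral {0..s} (h w)) \<le> c * (exp (2 * K * s) - 1) / (2 * K)"
      by (simp add: integral_diff int_h)
    have "dist (P z t) (P w t) = exp (- 2 * K * s) * norm (integral {0..s} (h z) - integral {0..s} (h w))"
      unfolding P_def s_def[symmetric] dist_norm by (simp flip: scaleR_diff_right)
    also have "\<dots> \<le> exp (- 2 * K * s) * (c * (exp (2 * K * s) - 1) / (2 * K))"
      using bound by (intro mult_left_mono) auto
    also have "\<dots> \<le> c / (2 * K)" using weight[of s c] K by (auto simp: s_def c_def)
    also have "\<dots> = 1 / 2 * dist z w" using K by (simp add: c_def)
    finally show "dist (apply_bcontfun (Q z) t) (apply_bcontfun (Q w) t) \<le> 1 / 2 * dist z w"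
      by (simp add: Q)
  qed
  then have "\<exists>!z. Q z = z" by (intro banach_fix_type[of "1/2"]) auto
  then obtain z where z: "Q z = z" by blast
  define x where "x t = exp (2 * K * t) *\<^sub>R apply_bcontfun z t" for t
  have x_eq: "x t = x0 + integral {0..t} (h z)" if "0 \<le> t" for t
  proof -
    have "x t = exp (2 * K * t) *\<^sub>R P z t" using Q[of z] z by (simp add: x_def)
    then show ?thesis using that by (simp add: P_def flip: exp_add)
  qed
  show ?thesis
  proof
    show "x 0 = x0" using x_eq[of 0] by simp
    fix t :: real assume t: "0 \<le> t"
    have "((\<lambda>t. x0 + integral {0..t} (h z)) has_vector_derivative 0 + h z t) (at t within {0..})"
      by (intro derivative_intros integral_has_vector_derivative_atLeast cont_h t)
    then have "(x has_vector_derivative h z t) (at t within {0..})"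
      using t by (auto intro: has_vector_derivative_transform[of t "{0..}" x, rotated 2] simp: x_eq)
    then show "(x has_vector_derivative g (x t)) (at t within {0..})" by (simp add: h_def x_def)
  qed
qed

text \<open>Precomposing \<open>f\<close> with the projection onto a ball makes it globally
  Lipschitz. Linear growth bounds the truncated solution a priori, so up to time \<open>m\<close> it
  stays where the truncation is inactive; the pieces agree by uniqueness and are glued.\<close>

lemma global_solution_of_linear_growth:
  fixes f :: "'a::euclidean_space \<Rightarrow> 'a"
  assumes lip: "\<And>R. \<exists>L. L-lipschitz_on (cball 0 R) f"
    and growth: "\<And>z. norm (f z) \<le> C * norm z" and C: "0 \<le> C"
  obtains x where "x 0 = x0"
    and "\<And>t. 0 \<le> t \<Longrightarrow> (x has_vector_derivative f (x t)) (at t within {0..})"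
proof -
  \<comment> \<open>The a priori bound on a solution up to time \<open>m\<close>, used as the
    truncation radius.\<close>
  define R where "R m = norm x0 * exp (C * real m)" for m :: nat
  define p where "p m = closest_point (cball (0::'a) (R m))" for m
  have R: "0 \<le> R m" for m by (simp add: R_def)
  have p_lip: "1-lipschitz_on UNIV (p m)" for m
    using R[of m] unfolding p_def by (auto intro!: lipschitz_onI closest_point_lipschitz simp: not_less)
  have p_mem: "p m z \<in> cball 0 (R m)" for m z
    unfolding p_def using R[of m] by (intro closest_point_in_set) (auto simp: not_less)
  have p_self: "p m z = z" if "norm z \<le> R m" for m z
    unfolding p_def using that by (intro closest_point_self) auto
  have p_norm: "norm (p m z) \<le> norm z" for m z
    using lipschitz_onD[OF p_lip[of m], of z 0] p_self[of 0 m] R by simp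
  have "\<exists>X. X 0 = x0 \<and> (\<forall>t\<ge>0. (X has_vector_derivative f (p m (X t))) (at t within {0..}))" for m
  proof -
    obtain L where L: "L-lipschitz_on (cball 0 (R m)) f" using lip by blast
    have "(L * 1)-lipschitz_on UNIV (\<lambda>z. f (p m z))"
      by (rule lipschitz_on_compose2[OF p_lip]) (rule lipschitz_on_subset[OF L], use p_mem in auto)
    from global_solution_of_lipschitz[OF this, of x0] show ?thesis by metis
  qed
  then obtain X where X0: "\<And>m. X m 0 = x0"
    and X: "\<And>m t. 0 \<le> t \<Longrightarrow> (X m has_vector_derivative f (p m (X m t))) (at t within {0..})"
    by metis
  have X_within: "(X m has_vector_derivative f (p m (X m t))) (at t within {0..T})" if "t \<in> {0..T}" for m t T
    using X[of t m] that by (auto intro: has_vector_derivative_within_subset)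
  have X_bound: "norm (X m t) \<le> R m" if "t \<in> {0..real m}" for m t
  proof -
    have p_growth: "norm (f (p m z)) \<le> C * norm z" for z
      using growth[of "p m z"] mult_left_mono[OF p_norm[of m z] C] by linarith
    have "norm (X m t) \<le> norm (X m 0) * exp (C * t)"
      by (rule solution_growth(1)[where f = "\<lambda>z. f (p m z)", OF X_within p_growth that])
    also have "\<dots> \<le> R m"
      using that C by (auto simp: X0 R_def intro!: mult_left_mono)
    finally show ?thesis .
  qed
  have X_eq: "X m t = X k t" if "t \<in> {0..T}" "T \<le> real m" "T \<le> real k" for m k t T
  proof -
    obtain L where L: "L-lipschitz_on (cball 0 (max (R m) (R k))) f" using lip by blast
    have "norm (X m t - X k t) \<le> norm (X m 0 - X k 0) * exp (L * t)"
    proof (rule solutions_distance[OF _ _ _ L \<open>t \<in> {0..T}\<close>])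
      fix s assume s: "s \<in> {0..T}"
      show "(X m has_vector_derivative f (X m s)) (at s within {0..T})"
        using X_within[of s T m] X_bound[of s m] p_self[of "X m s" m] s that by auto
      show "(X k has_vector_derivative f (X k s)) (at s within {0..T})"
        using X_within[of s T k] X_bound[of s k] p_self[of "X k s" k] s that by auto
      show "X m s \<in> cball 0 (max (R m) (R k)) \<and> X k s \<in> cball 0 (max (R m) (R k))"
        using X_bound[of s m] X_bound[of s k] s that by auto
    qed
    then show ?thesis by (simp add: X0)
  qed
  define x where "x t = X (nat \<lceil>t\<rceil>) t" for t
  have x_eq: "x t = X m t" if "0 \<le> t" "t \<le> real m" for t m
    unfolding x_def by (rule X_eq[of t t]) (use that in \<open>auto simp: of_nat_ceiling\<close>)
  show ?thesis
  proof
    show "x 0 = x0" by (simp add: x_def X0)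
    fix t :: real assume t: "0 \<le> t"
    \<comment> \<open>One more than the ceiling: \<open>t\<close> must lie strictly below
      \<open>m\<close> for the derivative within \<open>{0..m}\<close> to be the one within
      \<open>{0..}\<close>.\<close>
    define m where "m = Suc (nat \<lceil>t\<rceil>)"
    have m: "t < real m" unfolding m_def using t by linarith
    have "(X m has_vector_derivative f (X m t)) (at t within {0..real m})"
      using X_within[of t "real m" m] X_bound[of t m] p_self[of "X m t" m] t m by auto
    then have "(x has_vector_derivative f (X m t)) (at t within {0..real m})"
      by (rule has_vector_derivative_transform[rotated 2]) (use t m x_eq in auto)
    moreover have "X m t = x t" using x_eq[of t m] t m by simp
    ultimately have "(x has_vector_derivative f (x t)) (at t within {0..real m})" by simp
    then show "(x has_vector_derivative f (x t)) (at t within {0..})"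
      using at_within_atLeast_Icc[OF t m] by simp
  qed
qed

lemma solution_unique:
  fixes f :: "'a::real_inner \<Rightarrow> 'a"
  assumes lip: "\<And>R. \<exists>L. L-lipschitz_on (cball 0 R) f"
    and x: "\<And>t. 0 \<le> t \<Longrightarrow> (x has_vector_derivative f (x t)) (at t within {0..})"
    and y: "\<And>t. 0 \<le> t \<Longrightarrow> (y has_vector_derivative f (y t)) (at t within {0..})"
    and eq: "x 0 = y 0" and t: "0 \<le> t"
  shows "x t = y t"
proof -
  have sub: "(z has_vector_derivative f (z r)) (at r within {0..t})"
    if "\<And>t. 0 \<le> t \<Longrightarrow> (z has_vector_derivative f (z t)) (at t within {0..})" "r \<in> {0..t}" for z r
    using that(1)[of r] that(2) by (auto intro: has_vector_derivative_within_subset)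
  have bounded: "bounded (z ` {0..t})"
    if "\<And>t. 0 \<le> t \<Longrightarrow> (z has_vector_derivative f (z t)) (at t within {0..})" for z
  proof -
    have "continuous_on {0..} z"
      using that by (meson atLeast_iff continuous_on_eq_continuous_within has_vector_derivative_continuous)
    then have "continuous_on {0..t} z" by (rule continuous_on_subset) auto
    then show ?thesis by (intro compact_imp_bounded compact_continuous_image) auto
  qed
  have "bounded (x ` {0..t} \<union> y ` {0..t})" using bounded[OF x] bounded[OF y] by simp
  then obtain R where R: "\<And>z. z \<in> x ` {0..t} \<union> y ` {0..t} \<Longrightarrow> norm z \<le> R"
    unfolding bounded_iff by blast
  obtain L where L: "L-lipschitz_on (cball 0 R) f" using lip by blast
  have "norm (x t - y t) \<le> norm (x 0 - y 0) * exp (L * t)"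
    by (rule solutions_distance[of t x f y, OF _ _ _ L])
       (use sub[OF x] sub[OF y] R t in auto)
  then show ?thesis using eq by simp
qed

text \<open>The new clock \<open>s\<close> satisfies \<open>s' = 1 / \<gamma> (y t)\<close>, and
  composing \<open>y\<close> with its inverse restores the speed \<open>f\<close>. That
  \<open>s\<close> runs through all of \<open>[0, \<infinity>)\<close>, so that the new solution is
  global, comes from the convergence of \<open>y\<close>: along the orbit \<open>\<gamma>\<close>
  approaches \<open>\<gamma> l\<close> and the clock rate stays bounded below.\<close>

lemma time_change:
  fixes y :: "real \<Rightarrow> 'a::real_normed_vector"
  assumes \<gamma>: "continuous_on UNIV \<gamma>" "\<And>z. \<gamma> z > 0"
    and y: "\<And>t. 0 \<le> t \<Longrightarrow> (y has_vector_derivative (1 / \<gamma> (y t)) *\<^sub>R f (y t)) (at t within {0..})"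
    and lim: "(y \<longlongrightarrow> l) at_top"
  obtains x where "x 0 = y 0"
    and "\<And>t. 0 \<le> t \<Longrightarrow> (x has_vector_derivative f (x t)) (at t within {0..})"
    and "(x \<longlongrightarrow> l) at_top"
proof -
  \<comment> \<open>Freezing the rate for negative times turns 0 into an interior point of the
    domain of \<open>s\<close>, so the inverse function rules also apply at the initial
    time.\<close>
  define k where "k t = 1 / \<gamma> (y (max 0 t))" for t
  define s where "s t = integral {-1..t} k - integral {-1..0} k" for t
  have cont_y: "continuous_on {0..} y"
    using y by (meson atLeast_iff continuous_on_eq_continuous_within has_vector_derivative_continuous)
  have cont_k: "continuous_on UNIV k"
    unfolding k_def
    by (intro continuous_intros continuous_on_compose2[OF \<gamma>(1)] continuous_on_compose2[OF cont_y])
       (use \<gamma>(2) in \<open>auto simp: less_imp_neq[THEN not_sym]\<close>)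
  have k_pos: "k t > 0" for t using \<gamma>(2) by (simp add: k_def)
  have der_s: "(s has_real_derivative k t) (at t)" if "-1 < t" for t
  proof -
    have "((\<lambda>u. integral {-1..u} k) has_vector_derivative k t) (at t within {-1..})"
      using that by (intro integral_has_vector_derivative_atLeast continuous_on_subset[OF cont_k]) auto
    then have "((\<lambda>u. integral {-1..u} k) has_real_derivative k t) (at t)"
      using at_within_interior[of t "{-1..}"] that by (simp add: has_real_derivative_iff_has_vector_derivative)
    then show ?thesis unfolding s_def by (auto intro!: derivative_eq_intros)
  qed
  have s_mono: "s t < s t'" if "-1 < t" "t < t'" for t t'
    using that der_s k_pos by (intro DERIV_pos_imp_increasing[of t t' s]) (auto intro: less_le_trans)
  have s0: "s 0 = 0" by (simp add: s_def)
  have s_cont: "isCont s t" if "-1 < t" for t using der_s[OF that] by (rule DERIV_isCont)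
  have "(k \<longlongrightarrow> 1 / \<gamma> l) at_top"
  proof -
    have "((\<lambda>t. y (max 0 t)) \<longlongrightarrow> l) at_top"
      using lim by (rule Lim_transform_eventually) (use eventually_ge_at_top[of 0] in eventually_elim, simp)
    moreover have "isCont \<gamma> l" using \<gamma>(1) by (simp add: continuous_on_eq_continuous_at)
    ultimately show ?thesis
      unfolding k_def using \<gamma>(2)[of l] by (intro tendsto_intros isCont_tendsto_compose[of l \<gamma>]) auto
  qed
  then have "\<forall>\<^sub>F t in at_top. 1 / (2 * \<gamma> l) < k t"
    using \<gamma>(2)[of l] by (intro order_tendstoD) (auto simp: field_simps)
  then obtain t0 where t0: "0 \<le> t0" "\<And>t. t0 \<le> t \<Longrightarrow> 1 / (2 * \<gamma> l) < k t"
    unfolding eventually_at_top_linorder by (metis max.bounded_iff max.cobounded1)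
  have s_large: "\<exists>t\<ge>0. u \<le> s t" for u
  proof -
    define \<kappa> where "\<kappa> = 1 / (2 * \<gamma> l)"
    have \<kappa>: "\<kappa> > 0" using \<gamma>(2) by (simp add: \<kappa>_def)
    define t where "t = t0 + 1 + max 0 ((u - s t0) / \<kappa>)"
    have "t0 < t" by (simp add: t_def)
    then obtain z where z: "t0 < z" "z < t" "s t - s t0 = (t - t0) * k z"
      using MVT2[of t0 t s k] der_s t0(1) by auto
    have "(t - t0) * \<kappa> \<le> (t - t0) * k z"
      using t0(2)[of z] z by (intro mult_left_mono) (auto simp: \<kappa>_def)
    moreover have "u - s t0 \<le> (t - t0) * \<kappa>"
      using \<kappa> unfolding t_def by (auto simp: field_simps max_def)
    ultimately have "u \<le> s t" using z(3) by linarith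
    then show ?thesis using t0 \<open>t0 < t\<close> by (intro exI[of _ t]) auto
  qed
  \<comment> \<open>The level \<open>s (-1/2)\<close> is just a value below \<open>s 0 = 0\<close>
    that is attained inside the extended domain.\<close>
  have s_surj: "\<exists>t>-1. s t = u" if "s (-1/2) \<le> u" for u
  proof -
    obtain t where t: "0 \<le> t" "u \<le> s t" using s_large by blast
    have "\<exists>z\<ge>-1/2. z \<le> t \<and> s z = u"
      using that t by (intro IVT) (auto intro: s_cont)
    then show ?thesis by force
  qed
  define \<tau> where "\<tau> u = (THE t. -1 < t \<and> s t = u)" for u
  have \<tau>_s: "\<tau> (s t) = t" if "-1 < t" for t
    unfolding \<tau>_def using that s_mono by (intro the_equality) (auto, metis linorder_neqE_linordered_idom less_irrefl)
  have s_\<tau>: "s (\<tau> u) = u \<and> -1 < \<tau> u" if "s (-1/2) \<le> u" for u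
    using s_surj[OF that] \<tau>_s by auto
  have neg: "s (-1/2) < 0" using s_mono[of "-1/2" 0] s0 by simp
  have \<tau>_nonneg: "0 \<le> \<tau> u" if "0 \<le> u" for u
    using s_\<tau>[of u] s_mono[of "\<tau> u" 0] that neg s0 by force
  have \<tau>0: "\<tau> 0 = 0" using \<tau>_s[of 0] s0 by simp
  have der_\<tau>: "(\<tau> has_real_derivative inverse (k (\<tau> u))) (at u)" if "0 \<le> u" for u
  proof (rule DERIV_inverse_function[where f = s and a = "s (-1/2)" and b = "u + 1"])
    show "(s has_real_derivative k (\<tau> u)) (at (\<tau> u))" using \<tau>_nonneg[OF that] by (intro der_s) auto
    show "k (\<tau> u) \<noteq> 0" using k_pos[of "\<tau> u"] by simp
    show "s (-1/2) < u" using neg that by simp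
    show "s (\<tau> v) = v" if "s (-1/2) < v" for v using s_\<tau>[of v] that by simp
    have near: "-1 < v" if "\<bar>v - \<tau> u\<bar> \<le> 1/2" for v
      using \<tau>_nonneg[OF \<open>0 \<le> u\<close>] that by linarith
    have "isCont \<tau> (s (\<tau> u))"
      by (rule isCont_inverse_function[where f = s and x = "\<tau> u" and d = "1/2"])
         (use near in \<open>auto intro!: \<tau>_s s_cont\<close>)
    then show "isCont \<tau> u" using s_\<tau>[of u] neg that by simp
  qed simp
  show ?thesis
  proof
    show "(y \<circ> \<tau>) 0 = y 0" by (simp add: \<tau>0)
    fix u :: real assume u: "0 \<le> u"
    have "((y \<circ> \<tau>) has_vector_derivative inverse (k (\<tau> u)) *\<^sub>R ((1 / \<gamma> (y (\<tau> u))) *\<^sub>R f (y (\<tau> u)))) (at u within {0..})"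
    proof (rule vector_diff_chain_within)
      show "(\<tau> has_vector_derivative inverse (k (\<tau> u))) (at u within {0..})"
        using der_\<tau>[OF u] has_field_derivative_at_within
        by (auto simp: has_real_derivative_iff_has_vector_derivative[symmetric])
      show "(y has_vector_derivative (1 / \<gamma> (y (\<tau> u))) *\<^sub>R f (y (\<tau> u))) (at (\<tau> u) within \<tau> ` {0..})"
        using y[of "\<tau> u"] \<tau>_nonneg u by (auto intro: has_vector_derivative_within_subset)
    qed
    then show "((y \<circ> \<tau>) has_vector_derivative f ((y \<circ> \<tau>) u)) (at u within {0..})"
      using \<gamma>(2)[of "y (\<tau> u)"] \<tau>_nonneg[OF u] by (simp add: k_def max_def)
  next
    have "filterlim \<tau> at_top at_top"
      unfolding filterlim_at_top
    proof
      fix Z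
      have "Z \<le> \<tau> u" if "max 0 (s (max 0 Z)) \<le> u" for u
        using s_\<tau>[of u] s_mono[of "\<tau> u" "max 0 Z"] that neg by force
      then show "\<forall>\<^sub>F u in at_top. Z \<le> \<tau> u"
        unfolding eventually_at_top_linorder by blast
    qed
    then show "((y \<circ> \<tau>) \<longlongrightarrow> l) at_top"
      unfolding comp_def by (rule filterlim_compose[OF lim])
  qed
qed

section \<open>Continuously differentiable functions\<close>

text \<open>Continuity of the derivative is asked for one direction at a time, which in finite
  dimension is the same as continuity in operator norm. The derivative is the full one at each
  point, even if \<open>S\<close> is closed.\<close>

definition C1_on :: "'a set \<Rightarrow> ('a::euclidean_space \<Rightarrow> 'b::real_normed_vector) \<Rightarrow> bool" where
  "C1_on S f \<longleftrightarrow> (\<forall>x\<in>S. f differentiable at x) \<and>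
     (\<forall>v. continuous_on S (\<lambda>x. frechet_derivative f (at x) v))"

lemma C1_onI:
  assumes "\<And>x. x \<in> S \<Longrightarrow> (f has_derivative f' x) (at x)"
    and "\<And>v. continuous_on S (\<lambda>x. f' x v)"
  shows "C1_on S f"
proof -
  have "frechet_derivative f (at x) = f' x" if "x \<in> S" for x
    using frechet_derivative_at[OF assms(1)[OF that]] by simp
  then show ?thesis
    unfolding C1_on_def using assms(1) assms(2)
    by (auto simp: differentiable_def cong: continuous_on_cong)
qed

lemma C1_on_has_derivative:
  "C1_on S f \<Longrightarrow> x \<in> S \<Longrightarrow> (f has_derivative frechet_derivative f (at x)) (at x)"
  by (simp add: C1_on_def frechet_derivative_works)

lemma C1_on_continuous_derivative:
  "C1_on S f \<Longrightarrow> continuous_on S (\<lambda>x. frechet_derivative f (at x) v)"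
  by (simp add: C1_on_def)

lemma C1_on_subset: "C1_on S f \<Longrightarrow> T \<subseteq> S \<Longrightarrow> C1_on T f"
  by (auto simp: C1_on_def intro: continuous_on_subset)

lemma C1_on_continuous_on: "C1_on S f \<Longrightarrow> continuous_on S f"
  by (meson C1_on_has_derivative continuous_at_imp_continuous_on has_derivative_continuous)

lemma C1_on_frechet_derivative_tendsto:
  fixes f :: "'a::euclidean_space \<Rightarrow> 'b::real_normed_vector"
  assumes "C1_on S f" "open S" "x \<in> S"
  shows "((\<lambda>y. frechet_derivative f (at y) v) \<longlongrightarrow> frechet_derivative f (at x) v) (nhds x)"
  using continuous_on_eq_continuous_at[OF assms(2)] C1_on_continuous_derivative[OF assms(1), of v] assms(3)
  by (auto simp: continuous_at tendsto_at_iff_tendsto_nhds)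

text \<open>Passes from convergence on basis vectors, which \<open>C1_on\<close> provides, to bounds
  on operator norms.\<close>

lemma norm_linear_le_sum_Basis:
  fixes g :: "'a::euclidean_space \<Rightarrow> 'b::real_normed_vector"
  assumes "linear g"
  shows "norm (g v) \<le> (\<Sum>b\<in>Basis. norm (g b)) * norm v"
proof -
  have "g v = (\<Sum>b\<in>Basis. (v \<bullet> b) *\<^sub>R g b)"
    using linear_sum[OF assms, of "\<lambda>b. (v \<bullet> b) *\<^sub>R b" Basis]
    by (simp add: euclidean_representation linear_cmul[OF assms])
  also have "norm \<dots> \<le> (\<Sum>b\<in>Basis. norm v * norm (g b))"
    by (rule sum_norm_le) (simp add: Basis_le_norm mult_right_mono)
  finally show ?thesis by (simp add: sum_distrib_left mult.commute)
qed

text \<open>Strict differentiability: both points may move. It is the mean value inequality for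
  \<open>f\<close> minus its linearization at \<open>x\<close>, whose derivative is small near
  \<open>x\<close>.\<close>

lemma C1_on_strict_derivative:
  fixes f :: "'a::euclidean_space \<Rightarrow> 'b::real_normed_vector"
  assumes f: "C1_on S f" and S: "open S" "x \<in> S" and e: "e > 0"
  obtains d where "d > 0" "ball x d \<subseteq> S"
    and "\<And>y z. y \<in> ball x d \<Longrightarrow> z \<in> ball x d \<Longrightarrow>
           norm (f z - f y - frechet_derivative f (at x) (z - y)) \<le> e * norm (z - y)"
proof -
  let ?D = "\<lambda>y. frechet_derivative f (at y)"
  have lin: "bounded_linear (?D y)" if "y \<in> S" for y
    using C1_on_has_derivative[OF f that] by (rule has_derivative_bounded_linear)
  have "((\<lambda>y. \<Sum>b\<in>Basis. norm (?D y b - ?D x b)) \<longlongrightarrow> (\<Sum>b\<in>Basis. norm (?D x b - ?D x b))) (nhds x)"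
    by (intro tendsto_intros C1_on_frechet_derivative_tendsto[OF f S])
  then have "\<forall>\<^sub>F y in nhds x. (\<Sum>b\<in>Basis. norm (?D y b - ?D x b)) < e"
    using e by (intro order_tendstoD(2)) auto
  moreover have "\<forall>\<^sub>F y in nhds x. y \<in> S" using S by (rule eventually_nhds_in_open)
  ultimately have "\<forall>\<^sub>F y in nhds x. y \<in> S \<and> (\<Sum>b\<in>Basis. norm (?D y b - ?D x b)) < e"
    by eventually_elim auto
  then obtain d where d: "d > 0" "\<And>y. dist y x < d \<Longrightarrow> y \<in> S \<and> (\<Sum>b\<in>Basis. norm (?D y b - ?D x b)) < e"
    unfolding eventually_nhds_metric by blast
  have sub: "ball x d \<subseteq> S" using d(2) by (auto simp: dist_commute)
  show ?thesis
  proof (rule that[OF d(1) sub])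
    fix y z assume yz: "y \<in> ball x d" "z \<in> ball x d"
    have "norm (f z - f y - ?D x (z - y)) \<le> norm (z - y) * e"
    proof (rule differentiable_bound_linearization[where S = "ball x d" and f' = ?D])
      show "y + t *\<^sub>R (z - y) \<in> ball x d" if "t \<in> {0..1}" for t
        using convexD_alt[OF convex_ball yz, of t] that by (simp add: algebra_simps)
      show "(f has_derivative ?D w) (at w within ball x d)" if "w \<in> ball x d" for w
        by (rule has_derivative_at_withinI[OF C1_on_has_derivative[OF f]]) (use sub that in blast)
      show "onorm (?D w - ?D x) \<le> e" if "w \<in> ball x d" for w
      proof (rule onorm_bound)
        fix v
        have "linear (\<lambda>v. ?D w v - ?D x v)"
          using lin sub that S by (intro linear_compose_sub bounded_linear.linear) auto
        then have "norm (?D w v - ?D x v) \<le> (\<Sum>b\<in>Basis. norm (?D w b - ?D x b)) * norm v"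
          by (rule norm_linear_le_sum_Basis)
        also have "\<dots> \<le> e * norm v"
          using d(2)[of w] that by (intro mult_right_mono) (auto simp: dist_commute)
        finally show "norm ((?D w - ?D x) v) \<le> e * norm v" by simp
      qed (use e in auto)
      show "x \<in> ball x d" using d by simp
    qed
    then show "norm (f z - f y - ?D x (z - y)) \<le> e * norm (z - y)" by (simp add: mult.commute)
  qed
qed

text \<open>Base point, direction and step size vary together along an arbitrary filter. This is
  what makes the Euler estimate uniform in a neighbourhood of the base point and not only
  pointwise.\<close>

lemma C1_on_difference_quotient:
  fixes f :: "'a::euclidean_space \<Rightarrow> 'b::real_normed_vector"
  assumes f: "C1_on S f" and S: "open S" "x \<in> S"
    and P: "(P \<longlongrightarrow> x) F" and Q: "(Q \<longlongrightarrow> q) F" and h: "(h \<longlongrightarrow> 0) F" "\<forall>\<^sub>F i in F. h i > 0"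
  shows "((\<lambda>i. (f (P i + h i *\<^sub>R Q i) - f (P i)) /\<^sub>R h i) \<longlongrightarrow> frechet_derivative f (at x) q) F"
proof -
  let ?D = "frechet_derivative f (at x)"
  have D: "bounded_linear ?D"
    using C1_on_has_derivative[OF f S(2)] by (rule has_derivative_bounded_linear)
  have PQ: "((\<lambda>i. P i + h i *\<^sub>R Q i) \<longlongrightarrow> x) F"
    using tendsto_add[OF P tendsto_scaleR[OF h(1) Q]] by simp
  have "((\<lambda>i. (f (P i + h i *\<^sub>R Q i) - f (P i)) /\<^sub>R h i - ?D (Q i)) \<longlongrightarrow> 0) F"
    unfolding tendsto_iff
  proof safe
    fix e :: real assume e: "e > 0"
    \<comment> \<open>Eventually \<open>norm (Q i) < norm q + 1\<close>, so an error of
      \<open>e'\<close> per unit length stays below \<open>e\<close>.\<close>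
    define e' where "e' = e / (norm q + 2)"
    have q2: "norm q + 2 > 0" by (simp add: add_nonneg_pos)
    have e': "e' > 0" using e q2 by (simp add: e'_def)
    obtain d where d: "d > 0" and strict: "\<And>y z. y \<in> ball x d \<Longrightarrow> z \<in> ball x d \<Longrightarrow>
           norm (f z - f y - ?D (z - y)) \<le> e' * norm (z - y)"
      using C1_on_strict_derivative[OF f S e'] by metis
    have "\<forall>\<^sub>F i in F. norm (Q i) < norm q + 1"
      by (intro order_tendstoD(2)[OF tendsto_norm[OF Q]]) simp
    moreover have "\<forall>\<^sub>F i in F. P i \<in> ball x d"
      using tendstoD[OF P d] by (simp add: dist_commute)
    moreover have "\<forall>\<^sub>F i in F. P i + h i *\<^sub>R Q i \<in> ball x d"
      using tendstoD[OF PQ d] by (simp add: dist_commute)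
    ultimately show "\<forall>\<^sub>F i in F. dist ((f (P i + h i *\<^sub>R Q i) - f (P i)) /\<^sub>R h i - ?D (Q i)) 0 < e"
      using h(2)
    proof eventually_elim
      case (elim i)
      have "norm (f (P i + h i *\<^sub>R Q i) - f (P i) - h i *\<^sub>R ?D (Q i)) \<le> e' * (h i * norm (Q i))"
        using strict[OF elim(2,3)] elim(4) by (simp add: bounded_linear.linear[OF D] linear_cmul)
      then have "norm (f (P i + h i *\<^sub>R Q i) - f (P i) - h i *\<^sub>R ?D (Q i)) / h i \<le> e' * norm (Q i)"
        using elim(4) by (simp add: field_simps)
      also have "norm (f (P i + h i *\<^sub>R Q i) - f (P i) - h i *\<^sub>R ?D (Q i)) / h i
          = norm ((f (P i + h i *\<^sub>R Q i) - f (P i) - h i *\<^sub>R ?D (Q i)) /\<^sub>R h i)"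
        using elim(4) by (simp add: divide_inverse mult.commute)
      also have "e' * norm (Q i) < e' * (norm q + 2)" using elim(1) e' by (intro mult_strict_left_mono) auto
      also have "\<dots> = e" using q2 by (simp add: e'_def)
      finally show ?case using elim(4) by (simp add: scaleR_diff_right)
    qed
  qed
  from tendsto_add[OF this bounded_linear.tendsto[OF D Q]] show ?thesis by simp
qed

lemma C1_on_lipschitz:
  fixes f :: "'a::euclidean_space \<Rightarrow> 'b::real_normed_vector"
  assumes f: "C1_on K f" and K: "compact K" "convex K"
  obtains L where "L-lipschitz_on K f"
proof -
  let ?D = "\<lambda>y. frechet_derivative f (at y)"
  have "continuous_on K (\<lambda>y. \<Sum>b\<in>Basis. norm (?D y b))"
    by (intro continuous_intros C1_on_continuous_derivative[OF f])
  then have "bounded ((\<lambda>y. \<Sum>b\<in>Basis. norm (?D y b)) ` K)"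
    using K by (intro compact_imp_bounded compact_continuous_image)
  then obtain L where L: "\<And>y. y \<in> K \<Longrightarrow> (\<Sum>b\<in>Basis. norm (?D y b)) \<le> L" "L > 0"
    unfolding bounded_pos by (auto simp: sum_nonneg)
  show ?thesis
  proof (rule that, rule lipschitz_onI)
    fix y z assume yz: "y \<in> K" "z \<in> K"
    have "norm (f y - f z) \<le> L * norm (y - z)"
    proof (rule differentiable_bound[OF K(2) _ _ yz])
      show "(f has_derivative ?D w) (at w within K)" if "w \<in> K" for w
        using C1_on_has_derivative[OF f that] by (rule has_derivative_at_withinI)
      show "onorm (?D w) \<le> L" if "w \<in> K" for w
      proof (rule onorm_bound)
        fix v
        have "norm (?D w v) \<le> (\<Sum>b\<in>Basis. norm (?D w b)) * norm v"
          using C1_on_has_derivative[OF f that]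
          by (intro norm_linear_le_sum_Basis has_derivative_linear)
        also have "\<dots> \<le> L * norm v" using L(1)[OF that] by (rule mult_right_mono) simp
        finally show "norm (?D w v) \<le> L * norm v" .
      qed (use L in auto)
    qed
    then show "dist (f y) (f z) \<le> L * dist y z" by (simp add: dist_norm)
  qed (use L in auto)
qed

section \<open>Derivative of the determinant\<close>

lemma det_has_derivative:
  fixes A :: "real ^ 'n::finite ^ 'n"
  shows "(det has_derivative (\<lambda>H. \<Sum>p | p permutes UNIV. of_int (sign p) *
           (\<Sum>i\<in>UNIV. H $ i $ p i * (\<Prod>j\<in>UNIV - {i}. A $ j $ p j)))) (at A)"
proof -
  have entry: "((\<lambda>A :: real ^ 'n ^ 'n. A $ i $ j) has_derivative (\<lambda>H. H $ i $ j)) (at A)" for i j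
    by (intro bounded_linear_imp_has_derivative
        bounded_linear_compose[of "\<lambda>v. v $ j" "\<lambda>A. A $ i"] bounded_linear_vec_nth)
  show ?thesis
    unfolding det_def
    by (rule derivative_eq_intros entry refl | simp)+
qed

lemma C1_on_det: "C1_on UNIV (det :: real ^ 'n::finite ^ 'n \<Rightarrow> real)"
  by (rule C1_onI[OF det_has_derivative]) (intro continuous_intros)

text \<open>A permutation other than the identity moves at least two indices. After the product rule
  removes one factor, an off-diagonal entry of the identity matrix remains, so only the identity
  permutation contributes.\<close>

lemma frechet_derivative_det_mat_1:
  "frechet_derivative det (at (mat 1 :: real ^ 'n::finite ^ 'n)) H = trace H"
proof -
  have "frechet_derivative det (at (mat 1 :: real ^ 'n ^ 'n)) H = (\<Sum>p | p permutes UNIV. of_int (sign p) *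
           (\<Sum>i\<in>UNIV. H $ i $ p i * (\<Prod>j\<in>UNIV - {i}. (mat 1 :: real ^ 'n ^ 'n) $ j $ p j)))"
    by (rule fun_cong[OF frechet_derivative_at[OF det_has_derivative], symmetric])
  also have "\<dots> = (\<Sum>p\<in>{id}. of_int (sign p) *
           (\<Sum>i\<in>UNIV. H $ i $ p i * (\<Prod>j\<in>UNIV - {i}. (mat 1 :: real ^ 'n ^ 'n) $ j $ p j)))"
  proof (intro sum.mono_neutral_right ballI)
    fix p :: "'n \<Rightarrow> 'n" assume p: "p \<in> {p. p permutes UNIV} - {id}"
    have "(\<Prod>j\<in>UNIV - {i}. (mat 1 :: real ^ 'n ^ 'n) $ j $ p j) = 0" for i
    proof -
      have "\<exists>j. j \<noteq> i \<and> p j \<noteq> j"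
      proof (rule ccontr)
        assume *: "\<not> ?thesis"
        have inj: "inj p" using p by (auto intro: permutes_inj)
        have "p i = i"
        proof (rule ccontr)
          assume "p i \<noteq> i"
          then have "p (p i) = p i" using * by auto
          then show False using inj \<open>p i \<noteq> i\<close> by (auto dest: injD)
        qed
        then have "p = id" using * by (intro ext) (metis id_apply)
        then show False using p by simp
      qed
      then obtain j where "j \<noteq> i" "p j \<noteq> j" by blast
      then show ?thesis by (intro prod_zero[OF _ bexI[of _ j]]) (auto simp: mat_def)
    qed
    then have "H $ i $ p i * (\<Prod>j\<in>UNIV - {i}. (mat 1 :: real ^ 'n ^ 'n) $ j $ p j) = 0" for i
      by (simp del: prod_zero_iff)
    then show "of_int (sign p) * (\<Sum>i\<in>UNIV. H $ i $ p i * (\<Prod>j\<in>UNIV - {i}. (mat 1 :: real ^ 'n ^ 'n) $ j $ p j)) = 0"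
      by (simp only: sum.neutral_const mult_zero_right)
  qed (auto simp: permutes_id)
  also have "\<dots> = trace H" by (simp add: mat_def trace_def sign_id)
  finally show ?thesis .
qed

section \<open>Closure properties of continuously differentiable functions\<close>

lemma C1_on_const: "C1_on S (\<lambda>x. c)"
  by (rule C1_onI[of S _ "\<lambda>_ _. 0"]) auto

lemma C1_on_bounded_linear: "bounded_linear f \<Longrightarrow> C1_on S f"
  by (rule C1_onI[of S _ "\<lambda>_. f"]) (auto intro: bounded_linear_imp_has_derivative)

lemma C1_on_add: "C1_on S f \<Longrightarrow> C1_on S g \<Longrightarrow> C1_on S (\<lambda>x. f x + g x)"
  by (rule C1_onI[OF has_derivative_add])
     (auto intro: C1_on_has_derivative intro!: continuous_intros C1_on_continuous_derivative)

lemma C1_on_sum: "(\<And>i. i \<in> I \<Longrightarrow> C1_on S (f i)) \<Longrightarrow> C1_on S (\<lambda>x. \<Sum>i\<in>I. f i x)"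
  by (induction I rule: infinite_finite_induct) (auto intro: C1_on_const C1_on_add)

lemma (in bounded_linear) C1_on: "C1_on S g \<Longrightarrow> C1_on S (\<lambda>x. f (g x))"
  by (rule C1_onI[OF has_derivative])
     (auto intro: C1_on_has_derivative intro!: continuous_on C1_on_continuous_derivative)

lemma (in bounded_bilinear) C1_on:
  assumes f: "C1_on S f" and g: "C1_on S g"
  shows "C1_on S (\<lambda>x. prod (f x) (g x))"
proof (rule C1_onI)
  show "((\<lambda>x. prod (f x) (g x)) has_derivative
      (\<lambda>v. prod (f x) (frechet_derivative g (at x) v) + prod (frechet_derivative f (at x) v) (g x))) (at x)"
    if "x \<in> S" for x
    by (rule FDERIV[OF C1_on_has_derivative[OF f that] C1_on_has_derivative[OF g that]])
  show "continuous_on S (\<lambda>x. prod (f x) (frechet_derivative g (at x) v) + prod (frechet_derivative f (at x) v) (g x))" for v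
    by (rule continuous_on_add; rule continuous_on)
       (rule C1_on_continuous_on[OF f] C1_on_continuous_on[OF g]
          C1_on_continuous_derivative[OF f] C1_on_continuous_derivative[OF g])+
qed

lemmas C1_on_scaleR = bounded_bilinear.C1_on[OF bounded_bilinear_scaleR]
  and C1_on_mult = bounded_bilinear.C1_on[OF bounded_bilinear_mult]
  and C1_on_inner = bounded_bilinear.C1_on[OF bounded_bilinear_inner]

lemma C1_on_compose_real:
  assumes g: "C1_on S g" and \<phi>: "\<And>x. x \<in> S \<Longrightarrow> (\<phi> has_real_derivative \<phi>' (g x)) (at (g x))"
    and \<phi>': "continuous_on (g ` S) \<phi>'"
  shows "C1_on S (\<lambda>x. \<phi> (g x))"
proof (rule C1_onI)
  fix x assume x: "x \<in> S"
  show "((\<lambda>x. \<phi> (g x)) has_derivative (\<lambda>v. \<phi>' (g x) * frechet_derivative g (at x) v)) (at x)"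
    by (rule has_derivative_compose[OF C1_on_has_derivative[OF g x] \<phi>[OF x, unfolded has_field_derivative_def]])
next
  show "continuous_on S (\<lambda>x. \<phi>' (g x) * frechet_derivative g (at x) v)" for v
    by (intro continuous_intros C1_on_continuous_derivative[OF g]
        continuous_on_compose2[OF \<phi>' C1_on_continuous_on[OF g]]) auto
qed

lemma C1_on_inverse:
  fixes g :: "'a::euclidean_space \<Rightarrow> real"
  assumes "C1_on S g" "\<And>x. x \<in> S \<Longrightarrow> g x \<noteq> 0"
  shows "C1_on S (\<lambda>x. inverse (g x))"
  by (rule C1_on_compose_real[where g = g and \<phi> = inverse and \<phi>' = "\<lambda>u. - (inverse u ^ 2)"])
     (use assms in \<open>auto intro!: derivative_eq_intros continuous_intros simp: power2_eq_square\<close>)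

lemma C1_on_sqrt:
  fixes g :: "'a::euclidean_space \<Rightarrow> real"
  assumes "C1_on S g" "\<And>x. x \<in> S \<Longrightarrow> g x > 0"
  shows "C1_on S (\<lambda>x. sqrt (g x))"
  by (rule C1_on_compose_real[where g = g and \<phi> = sqrt and \<phi>' = "\<lambda>u. inverse (sqrt u) / 2"])
     (use assms in \<open>auto intro!: DERIV_real_sqrt continuous_intros simp: less_imp_neq[THEN not_sym]\<close>)

lemma C1_on_powr:
  fixes g :: "'a::euclidean_space \<Rightarrow> real"
  assumes "C1_on S g" "\<And>x. x \<in> S \<Longrightarrow> g x > 0"
  shows "C1_on S (\<lambda>x. g x powr r)"
  by (rule C1_on_compose_real[where g = g and \<phi> = "\<lambda>u. u powr r" and \<phi>' = "\<lambda>u. r * u powr (r - 1)"])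
     (use assms in \<open>auto intro!: has_real_derivative_powr continuous_intros simp: less_imp_neq[THEN not_sym]\<close>)

lemma C1_on_real_polynomial_function: "real_polynomial_function p \<Longrightarrow> C1_on S p"
  by (induction p rule: real_polynomial_function.induct)
     (auto intro: C1_on_bounded_linear C1_on_const C1_on_add C1_on_mult)

lemma C1_on_polynomial_function:
  fixes p :: "'a::euclidean_space \<Rightarrow> 'b::euclidean_space"
  assumes "polynomial_function p"
  shows "C1_on S p"
proof -
  have "C1_on S (\<lambda>x. \<Sum>b\<in>Basis. (p x \<bullet> b) *\<^sub>R b)"
    using assms
    by (intro C1_on_sum C1_on_scaleR C1_on_const C1_on_real_polynomial_function)
       (simp add: polynomial_function_iff_Basis_inner)
  then show ?thesis by (simp add: euclidean_representation)
qed

definition divergence :: "(real ^ 'n::finite \<Rightarrow> real ^ 'n) \<Rightarrow> real ^ 'n \<Rightarrow> real" where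
  "divergence f x = trace (matrix (frechet_derivative f (at x)))"

text \<open>The product rule, in the form in which the Euler step estimates below take positivity of
  the divergence.\<close>

lemma divergence_scaleR:
  fixes f :: "real ^ 'n::finite \<Rightarrow> real ^ 'n"
  assumes f: "(f has_derivative f') (at x)" and \<rho>: "(\<rho> has_derivative \<rho>') (at x)"
  shows "divergence (\<lambda>y. \<rho> y *\<^sub>R f y) x = \<rho>' (f x) + \<rho> x * trace (matrix f')"
proof -
  have der: "((\<lambda>y. \<rho> y *\<^sub>R f y) has_derivative (\<lambda>v. \<rho> x *\<^sub>R f' v + \<rho>' v *\<^sub>R f x)) (at x)"
    by (rule has_derivative_scaleR[OF \<rho> f])
  have "\<rho>' (f x) = \<rho>' (\<Sum>i\<in>UNIV. f x $ i *\<^sub>R axis i 1)"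
    using basis_expansion[of "f x"] by (simp add: scalar_mult_eq_scaleR)
  also have "\<dots> = (\<Sum>i\<in>UNIV. f x $ i * \<rho>' (axis i 1))"
    using has_derivative_linear[OF \<rho>] by (simp add: linear_sum linear_cmul)
  finally show ?thesis
    unfolding divergence_def frechet_derivative_at[OF der, symmetric]
    by (simp add: trace_def matrix_def sum.distrib sum_distrib_left mult.commute)
qed

section \<open>Change of variables under an Euler step\<close>

text \<open>At \<open>h = 0\<close> the derivative of \<open>\<rho> (y + h *\<^sub>R f y)\<close>
  times the Jacobian determinant is the divergence of \<open>\<rho> f\<close>. Taking the limit
  jointly in \<open>y\<close> and \<open>h\<close> makes the resulting growth uniform near
  \<open>x\<close>.\<close>

lemma euler_jacobian_growth_local:
  fixes f :: "real ^ 'n::finite \<Rightarrow> real ^ 'n" and \<rho> :: "real ^ 'n \<Rightarrow> real"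
  assumes f: "C1_on X f" and \<rho>: "C1_on X \<rho>" and X: "open X" "x \<in> X" and pos: "\<rho> x > 0"
    and div: "frechet_derivative \<rho> (at x) (f x) + \<rho> x * trace (matrix (frechet_derivative f (at x))) > 0"
  obtains r where "r > 0"
    and "\<And>y h. y \<in> ball x r \<Longrightarrow> 0 < h \<Longrightarrow> h < r \<Longrightarrow> y \<in> X \<and> y + h *\<^sub>R f y \<in> X \<and>
      (1 + r * h) * \<rho> y \<le> \<rho> (y + h *\<^sub>R f y) * det (mat 1 + h *\<^sub>R matrix (frechet_derivative f (at y)))"
proof -
  define M where "M y = matrix (frechet_derivative f (at y))" for y
  define F where "F = nhds x \<times>\<^sub>F at_right (0::real)"
  define Y where "Y z = fst z + snd z *\<^sub>R f (fst z)" for z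
  define c where "c = frechet_derivative \<rho> (at x) (f x) + \<rho> x * trace (M x)"
  \<comment> \<open>Half of the relative growth rate at \<open>x\<close>; the other half,
    \<open>c - \<kappa> * \<rho> x = c / 2\<close>, absorbs the error terms.\<close>
  define \<kappa> where "\<kappa> = c / (2 * \<rho> x)"
  have c: "c > 0" "\<kappa> > 0" using div pos by (simp_all add: c_def M_def \<kappa>_def)
  have fst: "(fst \<longlongrightarrow> x) F" unfolding F_def by (rule filterlim_fst)
  have "filterlim snd (at_right 0) F" unfolding F_def by (rule filterlim_snd)
  then have snd: "(snd \<longlongrightarrow> 0) F" "\<forall>\<^sub>F z in F. snd z > 0"
    by (auto simp: filterlim_at elim: eventually_mono)
  have cont: "((\<lambda>z. g (u z)) \<longlongrightarrow> g x) F" if "C1_on X g" "(u \<longlongrightarrow> x) F" for g :: "real ^ 'n \<Rightarrow> 'b::real_normed_vector" and u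
    using C1_on_continuous_on[OF that(1)] X by (intro isCont_tendsto_compose[OF _ that(2)])
      (simp add: continuous_on_eq_continuous_at)
  have Y: "(Y \<longlongrightarrow> x) F"
    using tendsto_add[OF fst tendsto_scaleR[OF snd(1) cont[OF f fst]]] by (simp add: Y_def[abs_def])
  have M: "((\<lambda>z. M (fst z)) \<longlongrightarrow> M x) F"
  proof (intro vec_tendstoI)
    fix i j
    show "((\<lambda>z. M (fst z) $ i $ j) \<longlongrightarrow> M x $ i $ j) F"
      unfolding M_def matrix_def
      using filterlim_compose[OF C1_on_frechet_derivative_tendsto[OF f X, of "axis j 1"] fst]
      by (auto intro!: tendsto_vec_nth)
  qed
  have T1: "((\<lambda>z. (\<rho> (Y z) - \<rho> (fst z)) /\<^sub>R snd z) \<longlongrightarrow> frechet_derivative \<rho> (at x) (f x)) F"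
    unfolding Y_def using fst cont[OF f fst] snd by (rule C1_on_difference_quotient[OF \<rho> X])
  have T2: "((\<lambda>z. (det (mat 1 + snd z *\<^sub>R M (fst z)) - det (mat 1 :: real ^ 'n ^ 'n)) /\<^sub>R snd z) \<longlongrightarrow> trace (M x)) F"
    unfolding frechet_derivative_det_mat_1[symmetric]
    using tendsto_const M snd by (rule C1_on_difference_quotient[OF C1_on_det open_UNIV UNIV_I])
  \<comment> \<open>The increment is split as \<open>\<rho> (Y) * det - \<rho> = (\<rho> (Y) -
    \<rho>) + \<rho> (Y) * (det - 1)\<close>, which gives the two parts of the divergence as
    separate limits.\<close>
  have "((\<lambda>z. (\<rho> (Y z) - \<rho> (fst z)) /\<^sub>R snd z
          + \<rho> (Y z) * ((det (mat 1 + snd z *\<^sub>R M (fst z)) - det (mat 1 :: real ^ 'n ^ 'n)) /\<^sub>R snd z)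
          - \<kappa> * \<rho> (fst z)) \<longlongrightarrow> c - \<kappa> * \<rho> x) F"
    unfolding c_def by (intro tendsto_intros T1 T2 cont[OF \<rho> Y] cont[OF \<rho> fst])
  moreover have "c - \<kappa> * \<rho> x > 0" using c pos by (simp add: \<kappa>_def)
  ultimately have "\<forall>\<^sub>F z in F. 0 < (\<rho> (Y z) - \<rho> (fst z)) /\<^sub>R snd z
          + \<rho> (Y z) * ((det (mat 1 + snd z *\<^sub>R M (fst z)) - det (mat 1 :: real ^ 'n ^ 'n)) /\<^sub>R snd z)
          - \<kappa> * \<rho> (fst z)"
    by (rule order_tendstoD(1))
  moreover have "\<forall>\<^sub>F z in F. Y z \<in> X" using topological_tendstoD[OF Y X] .
  moreover have "\<forall>\<^sub>F z in F. fst z \<in> X" using topological_tendstoD[OF fst X] .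
  moreover have "\<forall>\<^sub>F z in F. 0 < \<rho> (fst z)" using order_tendstoD(1)[OF cont[OF \<rho> fst] pos] .
  ultimately have "\<forall>\<^sub>F z in F. fst z \<in> X \<and> Y z \<in> X \<and> 0 < \<rho> (fst z) \<and>
      (1 + \<kappa> * snd z) * \<rho> (fst z) \<le> \<rho> (Y z) * det (mat 1 + snd z *\<^sub>R M (fst z))"
    using snd(2)
  proof eventually_elim
    case (elim z)
    have "0 < snd z * ((\<rho> (Y z) - \<rho> (fst z)) /\<^sub>R snd z
          + \<rho> (Y z) * ((det (mat 1 + snd z *\<^sub>R M (fst z)) - det (mat 1 :: real ^ 'n ^ 'n)) /\<^sub>R snd z)
          - \<kappa> * \<rho> (fst z))"
      using elim by simp
    also have "\<dots> = \<rho> (Y z) * det (mat 1 + snd z *\<^sub>R M (fst z)) - (1 + \<kappa> * snd z) * \<rho> (fst z)"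
      using elim(5) by (simp add: field_simps)
    finally show ?case using elim by simp
  qed
  then obtain P Q where PQ: "\<forall>\<^sub>F y in nhds x. P y" "\<forall>\<^sub>F h in at_right (0::real). Q h"
    and *: "\<And>y h. P y \<Longrightarrow> Q h \<Longrightarrow> y \<in> X \<and> y + h *\<^sub>R f y \<in> X \<and> 0 < \<rho> y \<and>
      (1 + \<kappa> * h) * \<rho> y \<le> \<rho> (y + h *\<^sub>R f y) * det (mat 1 + h *\<^sub>R M y)"
    unfolding F_def eventually_prod_filter Y_def by fastforce
  obtain r1 where r1: "r1 > 0" "\<And>y. dist y x < r1 \<Longrightarrow> P y"
    using PQ(1) unfolding eventually_nhds_metric by blast
  obtain r2 where r2: "r2 > 0" "\<And>h. 0 < h \<Longrightarrow> h < r2 \<Longrightarrow> Q h"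
    using PQ(2) unfolding eventually_at_right_field by blast
  \<comment> \<open>A single \<open>r\<close> serves as radius for the base points, bound on the
    step size and growth rate.\<close>
  define r where "r = min \<kappa> (min r1 r2)"
  show ?thesis
  proof (rule that[of r])
    show "r > 0" using c r1 r2 by (simp add: r_def)
    fix y h assume "y \<in> ball x r" "0 < h" "h < r"
    then have yh: "y \<in> X \<and> y + h *\<^sub>R f y \<in> X \<and> 0 < \<rho> y \<and>
      (1 + \<kappa> * h) * \<rho> y \<le> \<rho> (y + h *\<^sub>R f y) * det (mat 1 + h *\<^sub>R M y)"
      by (intro * r1 r2) (auto simp: r_def dist_commute)
    have "(1 + r * h) * \<rho> y \<le> (1 + \<kappa> * h) * \<rho> y"
      using yh \<open>0 < h\<close> by (intro mult_right_mono add_mono) (auto simp: r_def)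
    from yh order_trans[OF this] show "y \<in> X \<and> y + h *\<^sub>R f y \<in> X \<and>
      (1 + r * h) * \<rho> y \<le> \<rho> (y + h *\<^sub>R f y) * det (mat 1 + h *\<^sub>R matrix (frechet_derivative f (at y)))"
      unfolding M_def by blast
  qed
qed

text \<open>The local estimates persist when \<open>r\<close> shrinks, so a finite subcover and the
  least of its radii give one \<open>r\<close> for the whole compact set.\<close>

lemma euler_jacobian_growth:
  fixes f :: "real ^ 'n::finite \<Rightarrow> real ^ 'n" and \<rho> :: "real ^ 'n \<Rightarrow> real"
  assumes f: "C1_on X f" and \<rho>: "C1_on X \<rho>" and X: "open X" and K: "compact K" "K \<subseteq> X"
    and pos: "\<And>x. x \<in> X \<Longrightarrow> \<rho> x > 0"
    and div: "\<And>x. x \<in> X \<Longrightarrow>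
      frechet_derivative \<rho> (at x) (f x) + \<rho> x * trace (matrix (frechet_derivative f (at x))) > 0"
  obtains r where "r > 0"
    and "\<And>y h. y \<in> K \<Longrightarrow> 0 < h \<Longrightarrow> h < r \<Longrightarrow> y + h *\<^sub>R f y \<in> X \<and>
      (1 + r * h) * \<rho> y \<le> \<rho> (y + h *\<^sub>R f y) * det (mat 1 + h *\<^sub>R matrix (frechet_derivative f (at y)))"
proof -
  define good where "good r y \<longleftrightarrow> (\<forall>h. 0 < h \<longrightarrow> h < r \<longrightarrow> y + h *\<^sub>R f y \<in> X \<and>
      (1 + r * h) * \<rho> y \<le> \<rho> (y + h *\<^sub>R f y) * det (mat 1 + h *\<^sub>R matrix (frechet_derivative f (at y))))" for r y
  have good_mono: "good r' y" if "good r y" "r' \<le> r" "y \<in> K" for r r' y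
    unfolding good_def
  proof (intro allI impI)
    fix h assume h: "0 < h" "h < r'"
    have "\<rho> y > 0" using pos K that by auto
    then have "(1 + r' * h) * \<rho> y \<le> (1 + r * h) * \<rho> y"
      using h that by (intro mult_right_mono add_mono) auto
    with that h show "y + h *\<^sub>R f y \<in> X \<and>
      (1 + r' * h) * \<rho> y \<le> \<rho> (y + h *\<^sub>R f y) * det (mat 1 + h *\<^sub>R matrix (frechet_derivative f (at y)))"
      unfolding good_def by force
  qed
  have "\<exists>r>0. \<forall>y\<in>ball x r. good r y" if "x \<in> K" for x
  proof -
    have x: "x \<in> X" using that K by auto
    obtain r where r: "r > 0" and step: "\<And>y h. y \<in> ball x r \<Longrightarrow> 0 < h \<Longrightarrow> h < r \<Longrightarrow> y \<in> X \<and> y + h *\<^sub>R f y \<in> X \<and>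
      (1 + r * h) * \<rho> y \<le> \<rho> (y + h *\<^sub>R f y) * det (mat 1 + h *\<^sub>R matrix (frechet_derivative f (at y)))"
      using euler_jacobian_growth_local[OF f \<rho> X x pos[OF x] div[OF x]] by blast
    have "good r y" if "y \<in> ball x r" for y
      unfolding good_def using step[OF that] by blast
    with r show ?thesis by blast
  qed
  then obtain R where R: "\<And>x. x \<in> K \<Longrightarrow> R x > 0 \<and> (\<forall>y\<in>ball x (R x). good (R x) y)"
    by metis
  have "K \<subseteq> (\<Union>x\<in>K. ball x (R x))" using R by force
  then obtain D where D: "D \<subseteq> K" "finite D" "K \<subseteq> (\<Union>x\<in>D. ball x (R x))"
    using compactE_image[OF K(1), of K "\<lambda>x. ball x (R x)"] by auto
  \<comment> \<open>The extra 1 keeps the minimum defined when the subcover is empty.\<close>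
  define r where "r = Min (insert 1 (R ` D))"
  have r: "r > 0" "\<And>x. x \<in> D \<Longrightarrow> r \<le> R x"
    using D R by (auto simp: r_def)
  have "good r y" if y: "y \<in> K" for y
  proof -
    obtain x where x: "x \<in> D" "y \<in> ball x (R x)" using D(3) y by blast
    then have "good (R x) y" using R D(1) by blast
    then show ?thesis using r(2)[OF x(1)] y by (rule good_mono)
  qed
  then have "y + h *\<^sub>R f y \<in> X \<and>
      (1 + r * h) * \<rho> y \<le> \<rho> (y + h *\<^sub>R f y) * det (mat 1 + h *\<^sub>R matrix (frechet_derivative f (at y)))"
    if "y \<in> K" "0 < h" "h < r" for y h
    using that unfolding good_def by blast
  with r(1) show ?thesis by (rule that)
qed

section \<open>Mass of the image of a compact set under an Euler step\<close>

lemma nn_integral_compact_continuous: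
  fixes \<rho> :: "'a::euclidean_space \<Rightarrow> real"
  assumes Z: "compact Z" and \<rho>: "continuous_on Z \<rho>" "\<And>x. x \<in> Z \<Longrightarrow> 0 \<le> \<rho> x"
  shows "(\<integral>\<^sup>+x\<in>Z. ennreal (\<rho> x) \<partial>lborel) = ennreal (integral Z \<rho>)"
proof -
  have int: "set_integrable lborel Z \<rho>"
    unfolding set_integrable_def using borel_integrable_compact[OF Z \<rho>(1)] .
  have "(\<integral>\<^sup>+x\<in>Z. ennreal (\<rho> x) \<partial>lborel) = (\<integral>\<^sup>+x. ennreal (indicator Z x *\<^sub>R \<rho> x) \<partial>lborel)"
    by (intro nn_integral_cong) (auto simp: indicator_def)
  also have "\<dots> = ennreal (LINT x:Z|lborel. \<rho> x)"
    unfolding set_lebesgue_integral_def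
    using int \<rho>(2) by (intro nn_integral_eq_integral) (auto simp: set_integrable_def indicator_def)
  also have "(LINT x:Z|lborel. \<rho> x) = integral Z \<rho>"
    using int by (rule set_borel_integral_eq_integral)
  finally show ?thesis .
qed

lemma integral_change_of_variables_real_valued:
  fixes \<rho> :: "real ^ 'n::{finite,wellorder} \<Rightarrow> real"
  assumes Z: "compact Z"
    and g: "\<And>x. x \<in> Z \<Longrightarrow> (g has_derivative g' x) (at x within Z)" "inj_on g Z"
    and \<rho>: "continuous_on (g ` Z) \<rho>"
  shows "(\<lambda>x. \<bar>det (matrix (g' x))\<bar> * \<rho> (g x)) integrable_on Z"
    and "integral Z (\<lambda>x. \<bar>det (matrix (g' x))\<bar> * \<rho> (g x)) = integral (g ` Z) \<rho>"
proof -
  \<comment> \<open>The substitution rule is applied to a vector-valued integrand, so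
    \<open>\<rho>\<close> is wrapped as a vector with one component and read off again.\<close>
  define v where "v x = (vec (\<rho> x) :: real ^ 1)" for x
  have gZ: "compact (g ` Z)"
    using g(1) by (intro compact_continuous_image Z) (meson has_derivative_continuous continuous_on_eq_continuous_within)
  have "set_integrable lborel (g ` Z) v"
    unfolding set_integrable_def v_def using \<rho>
    by (intro borel_integrable_compact[OF gZ]) (auto simp: vec_def intro!: continuous_on_vec_lambda)
  then have v: "v absolutely_integrable_on (g ` Z)"
    unfolding set_integrable_def
    by (subst integrable_completion) (auto dest: borel_measurable_integrable)
  have cov: "(\<lambda>x. \<bar>det (matrix (g' x))\<bar> *\<^sub>R v (g x)) absolutely_integrable_on Z \<and>
     integral Z (\<lambda>x. \<bar>det (matrix (g' x))\<bar> *\<^sub>R v (g x)) = integral (g ` Z) v"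
    using v g Z by (subst has_absolute_integral_change_of_variables) (auto simp: compact_imp_closed borel_closed)
  have int: "(\<lambda>x. \<bar>det (matrix (g' x))\<bar> *\<^sub>R v (g x)) integrable_on Z"
    using cov set_lebesgue_integral_eq_integral(1) by blast
  from integrable_component[OF int, of "axis 1 1"]
  show "(\<lambda>x. \<bar>det (matrix (g' x))\<bar> * \<rho> (g x)) integrable_on Z"
    by (simp add: v_def inner_axis)
  have "integral Z (\<lambda>x. \<bar>det (matrix (g' x))\<bar> * \<rho> (g x)) = integral Z (\<lambda>x. (\<bar>det (matrix (g' x))\<bar> *\<^sub>R v (g x)) $ 1)"
    by (simp add: v_def)
  also have "\<dots> = integral (g ` Z) v $ 1" 
    using integral_component_eq_cart[OF int, of 1] cov by metis
  also have "\<dots> = integral (g ` Z) \<rho>"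
    using v set_lebesgue_integral_eq_integral(1)[OF v] by (simp add: v_def flip: integral_component_eq_cart)
  finally show "integral Z (\<lambda>x. \<bar>det (matrix (g' x))\<bar> * \<rho> (g x)) = integral (g ` Z) \<rho>" .
qed

text \<open>The pointwise growth of density times Jacobian is integrated over \<open>Z\<close> and
  the variables are changed. The rate \<open>r\<close> depends only on \<open>K\<close>, not on
  \<open>Z\<close> or \<open>h\<close>; this allows many steps to be chained with the same
  rate.\<close>

lemma euler_step_wellorder:
  fixes f :: "real ^ 'n::{finite,wellorder} \<Rightarrow> real ^ 'n::{finite,wellorder}"
    and \<rho> :: "real ^ 'n::{finite,wellorder} \<Rightarrow> real"
  assumes f: "C1_on X f" and \<rho>: "C1_on X \<rho>" and X: "open X" and K: "compact K" "K \<subseteq> X"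
    and pos: "\<And>x. x \<in> X \<Longrightarrow> \<rho> x > 0"
    and div: "\<And>x. x \<in> X \<Longrightarrow>
      frechet_derivative \<rho> (at x) (f x) + \<rho> x * trace (matrix (frechet_derivative f (at x))) > 0"
  obtains r where "r > 0"
    and "\<And>h Z. 0 < h \<Longrightarrow> h < r \<Longrightarrow> compact Z \<Longrightarrow> Z \<subseteq> K \<Longrightarrow> inj_on (\<lambda>y. y + h *\<^sub>R f y) Z \<Longrightarrow>
      ennreal (1 + r * h) * (\<integral>\<^sup>+x\<in>Z. ennreal (\<rho> x) \<partial>lborel)
        \<le> (\<integral>\<^sup>+x\<in>(\<lambda>y. y + h *\<^sub>R f y) ` Z. ennreal (\<rho> x) \<partial>lborel)"
proof -
  obtain r where r: "r > 0" and step: "\<And>y h. y \<in> K \<Longrightarrow> 0 < h \<Longrightarrow> h < r \<Longrightarrow> y + h *\<^sub>R f y \<in> X \<and>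
      (1 + r * h) * \<rho> y \<le> \<rho> (y + h *\<^sub>R f y) * det (mat 1 + h *\<^sub>R matrix (frechet_derivative f (at y)))"
    using euler_jacobian_growth[OF f \<rho> X K pos div] by blast
  show ?thesis
  proof (rule that[OF r])
    fix h Z assume h: "0 < h" "h < r" and Z: "compact Z" "Z \<subseteq> K"
    define E where "E y = y + h *\<^sub>R f y" for y
    define E' where "E' y v = v + h *\<^sub>R frechet_derivative f (at y) v" for y v
    assume "inj_on (\<lambda>y. y + h *\<^sub>R f y) Z"
    then have inj: "inj_on E Z" by (simp add: E_def[abs_def])
    have ZX: "Z \<subseteq> X" using Z K by auto
    have EX: "E ` Z \<subseteq> X" using step h Z by (auto simp: E_def)
    have der: "(E has_derivative E' y) (at y within Z)" if "y \<in> Z" for y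
      unfolding E_def E'_def
      by (intro derivative_intros has_derivative_at_withinI[OF C1_on_has_derivative[OF f]]) (use that ZX in auto)
    have mat_E': "matrix (E' y) = mat 1 + h *\<^sub>R matrix (frechet_derivative f (at y))" for y
      by (simp add: E'_def matrix_def mat_def axis_def vec_eq_iff)
    have cont_E: "continuous_on Z E"
      using der by (meson has_derivative_continuous continuous_on_eq_continuous_within)
    have cont_\<rho>: "continuous_on S \<rho>" if "S \<subseteq> X" for S
      using C1_on_continuous_on[OF \<rho>] that by (rule continuous_on_subset)
    have EZ: "compact (E ` Z)" using cont_E Z by (intro compact_continuous_image)
    have "(1 + r * h) * integral Z \<rho> = integral Z (\<lambda>y. (1 + r * h) * \<rho> y)" by simp
    also have "\<dots> \<le> integral Z (\<lambda>y. \<bar>det (matrix (E' y))\<bar> * \<rho> (E y))"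
    proof (rule integral_le)
      have "set_integrable lborel Z (\<lambda>y. (1 + r * h) * \<rho> y)"
        unfolding set_integrable_def
        by (intro borel_integrable_compact Z continuous_intros cont_\<rho> ZX)
      then show "(\<lambda>y. (1 + r * h) * \<rho> y) integrable_on Z"
        by (rule set_borel_integral_eq_integral)
      show "(\<lambda>y. \<bar>det (matrix (E' y))\<bar> * \<rho> (E y)) integrable_on Z"
        by (rule integral_change_of_variables_real_valued[OF Z(1) der inj cont_\<rho>[OF EX]])
      fix y assume y: "y \<in> Z"
      have "(1 + r * h) * \<rho> y \<le> \<rho> (E y) * det (matrix (E' y))"
        using step[of y h] y h Z by (auto simp: E_def mat_E')
      also have "\<dots> \<le> \<rho> (E y) * \<bar>det (matrix (E' y))\<bar>"
        using pos[of "E y"] EX y by (intro mult_left_mono) auto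
      finally show "(1 + r * h) * \<rho> y \<le> \<bar>det (matrix (E' y))\<bar> * \<rho> (E y)" by (simp add: mult.commute)
    qed
    also have "\<dots> = integral (E ` Z) \<rho>"
      by (rule integral_change_of_variables_real_valued[OF Z(1) der inj cont_\<rho>[OF EX]])
    finally have "(1 + r * h) * integral Z \<rho> \<le> integral (E ` Z) \<rho>" .
    then have "ennreal (1 + r * h) * ennreal (integral Z \<rho>) \<le> ennreal (integral (E ` Z) \<rho>)"
      using r h by (subst ennreal_mult'[symmetric]) (auto intro: ennreal_leI)
    moreover have "(\<integral>\<^sup>+x\<in>Z. ennreal (\<rho> x) \<partial>lborel) = ennreal (integral Z \<rho>)"
      using pos ZX by (intro nn_integral_compact_continuous Z cont_\<rho>) (auto simp: less_imp_le)
    moreover have "(\<integral>\<^sup>+x\<in>E ` Z. ennreal (\<rho> x) \<partial>lborel) = ennreal (integral (E ` Z) \<rho>)"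
      using pos EX by (intro nn_integral_compact_continuous EZ cont_\<rho>) (auto simp: less_imp_le)
    ultimately show "ennreal (1 + r * h) * (\<integral>\<^sup>+x\<in>Z. ennreal (\<rho> x) \<partial>lborel)
        \<le> (\<integral>\<^sup>+x\<in>(\<lambda>y. y + h *\<^sub>R f y) ` Z. ennreal (\<rho> x) \<partial>lborel)"
      by (simp only: E_def[abs_def])
  qed
qed

text \<open>The change of variables theorem of the library needs a well-ordered index type;
  a copy of a finite type can be equipped with one.\<close>

typedef 'a wo = "UNIV :: 'a set" morphisms of_wo to_wo by simp

lemma bij_of_wo: "bij of_wo"
  by (metis bij_def injI of_wo_inject surj_def to_wo_inverse UNIV_I)

instance wo :: (finite) finite
proof
  have "finite (range (of_wo :: 'a wo \<Rightarrow> 'a))" by simp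
  then show "finite (UNIV :: 'a wo set)" by (rule finite_imageD) (simp add: bij_is_inj bij_of_wo)
qed

definition wo_index :: "'a::finite wo \<Rightarrow> nat" where
  "wo_index = (SOME f. inj f)"

lemma inj_wo_index: "inj wo_index"
proof -
  have "\<exists>f :: 'a::finite wo \<Rightarrow> nat. inj f" using finite_imp_inj_to_nat_seg[of "UNIV :: 'a wo set"] by auto
  then show ?thesis unfolding wo_index_def by (rule someI_ex)
qed

instantiation wo :: (finite) wellorder
begin

definition "a \<le> b \<longleftrightarrow> wo_index a \<le> wo_index b" for a b :: "'a wo"
definition "a < b \<longleftrightarrow> wo_index a < wo_index b" for a b :: "'a wo"

instance
proof
  fix P :: "'a wo \<Rightarrow> bool" and a assume "\<And>x. (\<And>y. y < x \<Longrightarrow> P y) \<Longrightarrow> P x"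
  then show "P a" unfolding less_wo_def by (rule measure_induct_rule[of wo_index]) blast
qed (auto simp: less_eq_wo_def less_wo_def dest: injD[OF inj_wo_index])

end

definition wo_vec :: "real ^ 'n::finite \<Rightarrow> real ^ 'n wo" where "wo_vec x = (\<chi> i. x $ of_wo i)"
definition unwo_vec :: "real ^ 'n::finite wo \<Rightarrow> real ^ 'n" where "unwo_vec y = (\<chi> i. y $ to_wo i)"

lemma unwo_wo [simp]: "unwo_vec (wo_vec x) = x" "wo_vec (unwo_vec y) = y"
  by (simp_all add: wo_vec_def unwo_vec_def vec_eq_iff to_wo_inverse of_wo_inverse)

lemma bounded_linear_wo: "bounded_linear wo_vec" "bounded_linear unwo_vec"
proof -
  have "linear wo_vec" "linear unwo_vec"
    by (auto simp: wo_vec_def unwo_vec_def vec_eq_iff intro!: linearI)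
  then show "bounded_linear wo_vec" "bounded_linear unwo_vec"
    by (simp_all add: linear_conv_bounded_linear)
qed

lemma prod_Basis_cart: "(\<Prod>b\<in>Basis. f b) = (\<Prod>i\<in>UNIV. f (axis i 1))" for f :: "real ^ 'n::finite \<Rightarrow> 'a::comm_monoid_mult"
proof -
  have B: "(Basis :: (real ^ 'n) set) = range (\<lambda>i. axis i 1)" by (auto simp: Basis_vec_def)
  show ?thesis unfolding B by (subst prod.reindex) (auto simp: inj_on_def axis_eq_axis)
qed

text \<open>Renaming coordinates permutes the side lengths of a box, and the volumes of boxes
  determine Lebesgue measure.\<close>

lemma distr_wo_vec: "distr lborel borel (wo_vec :: real ^ 'n::finite \<Rightarrow> _) = lborel"
proof (rule lborel_eqI[symmetric])
  fix l u :: "real ^ 'n wo" assume le: "\<And>b. b \<in> Basis \<Longrightarrow> l \<bullet> b \<le> u \<bullet> b"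
  have le': "l $ i \<le> u $ i" for i using le[of "axis i 1"] by (simp add: inner_axis)
  have meas: "(wo_vec :: real ^ 'n \<Rightarrow> _) \<in> borel_measurable borel"
    by (intro borel_measurable_continuous_onI bounded_linear.continuous_on[OF bounded_linear_wo(1)] continuous_intros)
  have "wo_vec -` box l u = box (unwo_vec l) (unwo_vec u)"
    unfolding mem_box_cart vimage_def wo_vec_def unwo_vec_def set_eq_iff
    by (auto simp: mem_box_cart) (metis of_wo_inverse to_wo_inverse UNIV_I)+
  then have "emeasure (distr lborel borel wo_vec) (box l u) = emeasure lborel (box (unwo_vec l) (unwo_vec u))"
    using meas by (subst emeasure_distr) auto
  also have "\<dots> = (\<Prod>b\<in>Basis. (unwo_vec u - unwo_vec l) \<bullet> b)"
    by (intro emeasure_lborel_box) (use le' in \<open>auto simp: Basis_vec_def inner_axis unwo_vec_def\<close>)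
  also have "(\<Prod>b\<in>Basis. (unwo_vec u - unwo_vec l) \<bullet> b) = (\<Prod>i\<in>UNIV. u $ to_wo i - l $ to_wo i)"
    by (simp add: prod_Basis_cart inner_axis unwo_vec_def)
  also have "\<dots> = (\<Prod>i\<in>UNIV. u $ i - l $ i)"
    by (rule prod.reindex_bij_betw)
       (metis bij_betw_def inj_onI of_wo_inverse surjI to_wo_inject UNIV_I)
  also have "\<dots> = (\<Prod>b\<in>Basis. (u - l) \<bullet> b)"
    by (simp add: prod_Basis_cart inner_axis)
  finally show "emeasure (distr lborel borel wo_vec) (box l u) = (\<Prod>b\<in>Basis. (u - l) \<bullet> b)" .
qed simp

lemma nn_integral_wo_vec:
  fixes \<rho> :: "real ^ 'n::finite \<Rightarrow> real"
  assumes Z: "compact Z" and \<rho>: "continuous_on Z \<rho>"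
  shows "(\<integral>\<^sup>+y\<in>wo_vec ` Z. ennreal (\<rho> (unwo_vec y)) \<partial>lborel) = (\<integral>\<^sup>+x\<in>Z. ennreal (\<rho> x) \<partial>lborel)"
proof -
  have meas: "(wo_vec :: real ^ 'n \<Rightarrow> _) \<in> borel_measurable borel"
    by (intro borel_measurable_continuous_onI bounded_linear.continuous_on[OF bounded_linear_wo(1)] continuous_intros)
  have "compact (wo_vec ` Z)"
    by (intro compact_continuous_image bounded_linear.continuous_on[OF bounded_linear_wo(1)] continuous_intros Z)
  moreover have "continuous_on (wo_vec ` Z) (\<lambda>y. \<rho> (unwo_vec y))"
    by (intro continuous_on_compose2[OF \<rho>] bounded_linear.continuous_on[OF bounded_linear_wo(2)] continuous_intros) auto
  ultimately have "(\<lambda>y. indicator (wo_vec ` Z) y *\<^sub>R \<rho> (unwo_vec y)) \<in> borel_measurable borel"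
    by (intro borel_measurable_continuous_on_indicator) (auto simp: borel_closed compact_imp_closed)
  then have g: "(\<lambda>y. ennreal (indicator (wo_vec ` Z) y *\<^sub>R \<rho> (unwo_vec y))) \<in> borel_measurable borel"
    by simp
  have "(\<integral>\<^sup>+y\<in>wo_vec ` Z. ennreal (\<rho> (unwo_vec y)) \<partial>lborel)
      = (\<integral>\<^sup>+y. ennreal (indicator (wo_vec ` Z) y *\<^sub>R \<rho> (unwo_vec y)) \<partial>distr lborel borel wo_vec)"
    unfolding distr_wo_vec by (intro nn_integral_cong) (auto simp: indicator_def)
  also have "\<dots> = (\<integral>\<^sup>+x. ennreal (indicator (wo_vec ` Z) (wo_vec x) *\<^sub>R \<rho> x) \<partial>lborel)"
    using g meas by (subst nn_integral_distr) auto
  also have "\<dots> = (\<integral>\<^sup>+x\<in>Z. ennreal (\<rho> x) \<partial>lborel)"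
    by (intro nn_integral_cong) (auto simp: indicator_def, metis unwo_wo(1))
  finally show ?thesis .
qed

text \<open>Everything is transported along the renaming of coordinates; the trace is unaffected
  because rows and columns are renamed together.\<close>

lemma euler_step:
  fixes f :: "real ^ 'n::finite \<Rightarrow> real ^ 'n" and \<rho> :: "real ^ 'n \<Rightarrow> real"
  assumes f: "C1_on X f" and \<rho>: "C1_on X \<rho>" and X: "open X" and K: "compact K" "K \<subseteq> X"
    and pos: "\<And>x. x \<in> X \<Longrightarrow> \<rho> x > 0"
    and div: "\<And>x. x \<in> X \<Longrightarrow>
      frechet_derivative \<rho> (at x) (f x) + \<rho> x * trace (matrix (frechet_derivative f (at x))) > 0"
  obtains r where "r > 0"
    and "\<And>h Z. 0 < h \<Longrightarrow> h < r \<Longrightarrow> compact Z \<Longrightarrow> Z \<subseteq> K \<Longrightarrow> inj_on (\<lambda>y. y + h *\<^sub>R f y) Z \<Longrightarrow>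
      (\<lambda>y. y + h *\<^sub>R f y) ` Z \<subseteq> X \<Longrightarrow>
      ennreal (1 + r * h) * (\<integral>\<^sup>+x\<in>Z. ennreal (\<rho> x) \<partial>lborel)
        \<le> (\<integral>\<^sup>+x\<in>(\<lambda>y. y + h *\<^sub>R f y) ` Z. ennreal (\<rho> x) \<partial>lborel)"
proof -
  define f' where "f' y = wo_vec (f (unwo_vec y))" for y
  define \<rho>' where "\<rho>' y = \<rho> (unwo_vec y)" for y
  define X' where "X' = unwo_vec -` X"
  note [continuous_intros] = bounded_linear.continuous_on[OF bounded_linear_wo(1)]
    bounded_linear.continuous_on[OF bounded_linear_wo(2)]
  have der_f: "(f' has_derivative (\<lambda>v. wo_vec (frechet_derivative f (at (unwo_vec y)) (unwo_vec v)))) (at y)"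
    if "y \<in> X'" for y
    unfolding f'_def
    by (intro bounded_linear.has_derivative[OF bounded_linear_wo(1)]
        has_derivative_compose[OF bounded_linear_imp_has_derivative[OF bounded_linear_wo(2)]] C1_on_has_derivative[OF f])
       (use that in \<open>simp add: X'_def\<close>)
  have der_\<rho>: "(\<rho>' has_derivative (\<lambda>v. frechet_derivative \<rho> (at (unwo_vec y)) (unwo_vec v))) (at y)"
    if "y \<in> X'" for y
    unfolding \<rho>'_def
    by (intro has_derivative_compose[OF bounded_linear_imp_has_derivative[OF bounded_linear_wo(2)]] C1_on_has_derivative[OF \<rho>])
       (use that in \<open>simp add: X'_def\<close>)
  have f': "C1_on X' f'"
    by (rule C1_onI[OF der_f])
       (auto intro!: continuous_intros continuous_on_compose2[OF C1_on_continuous_derivative[OF f]] simp: X'_def)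
  have \<rho>': "C1_on X' \<rho>'"
    by (rule C1_onI[OF der_\<rho>])
       (auto intro!: continuous_intros continuous_on_compose2[OF C1_on_continuous_derivative[OF \<rho>]] simp: X'_def)
  have X': "open X'"
    unfolding X'_def by (rule open_vimage[OF X]) (intro continuous_intros)
  have K': "compact (wo_vec ` K)" "wo_vec ` K \<subseteq> X'"
    using K by (auto simp: X'_def intro!: compact_continuous_image continuous_intros)
  have pos': "\<rho>' y > 0" if "y \<in> X'" for y using pos that by (simp add: X'_def \<rho>'_def)
  have div': "frechet_derivative \<rho>' (at y) (f' y) + \<rho>' y * trace (matrix (frechet_derivative f' (at y))) > 0"
    if "y \<in> X'" for y
  proof -
    have axis: "unwo_vec (axis i 1) = axis (of_wo i) 1" for i
      by (simp add: unwo_vec_def axis_def vec_eq_iff) (metis of_wo_inverse to_wo_inverse UNIV_I)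
    have "trace (matrix (frechet_derivative f' (at y)))
        = (\<Sum>i\<in>UNIV. frechet_derivative f (at (unwo_vec y)) (axis (of_wo i) 1) $ of_wo i)"
      by (simp add: trace_def matrix_def axis wo_vec_def flip: frechet_derivative_at[OF der_f[OF that]])
    also have "\<dots> = (\<Sum>i\<in>UNIV. frechet_derivative f (at (unwo_vec y)) (axis i 1) $ i)"
      by (rule sum.reindex_bij_betw[OF bij_of_wo])
    also have "\<dots> = trace (matrix (frechet_derivative f (at (unwo_vec y))))"
      by (simp add: trace_def matrix_def)
    finally show ?thesis
      using div[of "unwo_vec y"] that
      unfolding frechet_derivative_at[OF der_\<rho>[OF that], symmetric]
      by (simp add: X'_def f'_def \<rho>'_def)
  qed
  obtain r where r: "r > 0" and step: "\<And>h Z. 0 < h \<Longrightarrow> h < r \<Longrightarrow> compact Z \<Longrightarrow> Z \<subseteq> wo_vec ` K \<Longrightarrow>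
      inj_on (\<lambda>y. y + h *\<^sub>R f' y) Z \<Longrightarrow>
      ennreal (1 + r * h) * (\<integral>\<^sup>+x\<in>Z. ennreal (\<rho>' x) \<partial>lborel)
        \<le> (\<integral>\<^sup>+x\<in>(\<lambda>y. y + h *\<^sub>R f' y) ` Z. ennreal (\<rho>' x) \<partial>lborel)"
    using euler_step_wellorder[OF f' \<rho>' X' K' pos' div'] by blast
  show ?thesis
  proof (rule that[OF r])
    fix h Z assume h: "0 < h" "h < r" and Z: "compact Z" "Z \<subseteq> K"
    define E where "E y = y + h *\<^sub>R f y" for y
    assume "inj_on (\<lambda>y. y + h *\<^sub>R f y) Z" and "(\<lambda>y. y + h *\<^sub>R f y) ` Z \<subseteq> X"
    then have inj: "inj_on E Z" and EX: "E ` Z \<subseteq> X" by (simp_all add: E_def[abs_def])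
    have wo_E: "wo_vec y + h *\<^sub>R f' (wo_vec y) = wo_vec (E y)" for y
      by (simp add: f'_def E_def linear_simps[OF bounded_linear_wo(1)])
    have wo_inj: "wo_vec x = wo_vec y \<Longrightarrow> x = y" for x y :: "real ^ 'n" by (metis unwo_wo(1))
    have img: "(\<lambda>y. y + h *\<^sub>R f' y) ` wo_vec ` Z = wo_vec ` E ` Z" by (simp add: image_image wo_E)
    have cont: "continuous_on S \<rho>" if "S \<subseteq> X" for S
      using C1_on_continuous_on[OF \<rho>] that by (rule continuous_on_subset)
    have EZ: "compact (E ` Z)"
      unfolding E_def using Z K
      by (intro compact_continuous_image continuous_intros continuous_on_subset[OF C1_on_continuous_on[OF f]]) auto
    have "ennreal (1 + r * h) * (\<integral>\<^sup>+x\<in>wo_vec ` Z. ennreal (\<rho>' x) \<partial>lborel)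
        \<le> (\<integral>\<^sup>+x\<in>(\<lambda>y. y + h *\<^sub>R f' y) ` wo_vec ` Z. ennreal (\<rho>' x) \<partial>lborel)"
      by (intro step h compact_continuous_image continuous_intros Z image_mono inj_onI)
         (use inj in \<open>auto simp: wo_E inj_on_def intro!: arg_cong[of _ _ wo_vec] dest!: wo_inj\<close>)
    moreover have "(\<integral>\<^sup>+x\<in>wo_vec ` Z. ennreal (\<rho>' x) \<partial>lborel) = (\<integral>\<^sup>+x\<in>Z. ennreal (\<rho> x) \<partial>lborel)"
      unfolding \<rho>'_def using Z K by (intro nn_integral_wo_vec cont) auto
    moreover have "(\<integral>\<^sup>+x\<in>wo_vec ` E ` Z. ennreal (\<rho>' x) \<partial>lborel) = (\<integral>\<^sup>+x\<in>E ` Z. ennreal (\<rho> x) \<partial>lborel)"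
      unfolding \<rho>'_def using EX by (intro nn_integral_wo_vec cont EZ)
    ultimately show "ennreal (1 + r * h) * (\<integral>\<^sup>+x\<in>Z. ennreal (\<rho> x) \<partial>lborel)
        \<le> (\<integral>\<^sup>+x\<in>(\<lambda>y. y + h *\<^sub>R f y) ` Z. ennreal (\<rho> x) \<partial>lborel)"
      unfolding img by (simp add: E_def[abs_def])
  qed
qed

section \<open>Recurrence\<close>

text \<open>Let \<open>W\<close> be the recurrent points inside \<open>P\<close>. Enlarging
  \<open>W\<close> to the points that reach it within \<open>n\<close> steps can only increase the
  mass lost by pulling back, yet this loss is at most the mass of the points of \<open>W\<close>
  that fail to return within \<open>n + 1\<close> steps. That tends to 0, so pulling back
  \<open>W\<close> loses nothing, which \<open>strict\<close> permits only for a null set.\<close>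

lemma recurrent_set_null:
  fixes T :: "'a \<Rightarrow> 'a"
  assumes T [measurable]: "T \<in> measurable M M" and space: "space M = UNIV"
    and le: "\<And>Y. Y \<in> sets M \<Longrightarrow> emeasure M (T -` Y) \<le> emeasure M Y"
    and strict: "\<And>Y. Y \<in> fmeasurable M \<Longrightarrow> 0 < emeasure M Y \<Longrightarrow> emeasure M (T -` Y) < emeasure M Y"
    and P: "P \<in> fmeasurable M"
  shows "{x. \<exists>\<^sub>\<infinity>n. (T ^^ n) x \<in> P} \<in> null_sets M"
proof -
  define Z where "Z = {x. \<exists>\<^sub>\<infinity>n. (T ^^ n) x \<in> P}"
  \<comment> \<open>\<open>Z\<close> may have infinite mass, so the argument runs on its part inside
    \<open>P\<close>.\<close>
  define W where "W = Z \<inter> P"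
  have vim: "T -` Y \<in> sets M" if "Y \<in> sets M" for Y
    using measurable_sets[OF T that] space by simp
  have vimn: "(T ^^ n) -` Y \<in> sets M" if "Y \<in> sets M" for n Y
    using measurable_sets[OF measurable_compose_n[OF T] that] space by simp
  have vimf: "T -` Y \<in> fmeasurable M" if "Y \<in> fmeasurable M" for Y
    using le[of Y] vim that by (auto simp: fmeasurable_def intro: le_less_trans)
  have Z_sets: "Z \<in> sets M"
  proof -
    have "Z = (\<Inter>m. \<Union>n\<in>{m<..}. (T ^^ n) -` P)"
      unfolding Z_def INFM_nat by (auto simp: Bex_def)
    also have "\<dots> \<in> sets M"
      using P sets.top[of M] space by (intro sets.countable_INT'' sets.countable_UN'' vimn) (auto simp: fmeasurable_def)
    finally show ?thesis .
  qed
  have Z_shift: "(T ^^ k) x \<in> Z" if "x \<in> Z" for x k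
    unfolding Z_def INFM_nat
  proof safe
    fix m
    from that obtain n where n: "n > m + k" "(T ^^ n) x \<in> P" unfolding Z_def INFM_nat by blast
    then have "(T ^^ (n - k)) ((T ^^ k) x) \<in> P" by (simp add: funpow_add[symmetric, THEN fun_cong, unfolded comp_def])
    with n show "\<exists>n>m. (T ^^ n) ((T ^^ k) x) \<in> P" by (intro exI[of _ "n - k"]) auto
  qed
  have W: "W \<in> fmeasurable M"
    using Z_sets P unfolding W_def by (metis fmeasurable_Int_fmeasurable inf_commute)
  then have W_sets: "W \<in> sets M" by (simp add: fmeasurable_def)
  \<comment> \<open>\<open>U n\<close> consists of the points that are in \<open>W\<close> at one of
    the times 0 to \<open>n\<close>. The recursive form exhibits \<open>U (Suc n)\<close> as a
    preimage plus \<open>W\<close>.\<close>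
  define U where "U = rec_nat W (\<lambda>_ V. W \<union> T -` V)"
  have U0: "U 0 = W" and US: "U (Suc n) = W \<union> T -` U n" for n by (simp_all add: U_def)
  have U: "U n \<in> fmeasurable M" for n
    by (induction n) (auto simp: U0 US intro!: fmeasurable.Un vimf W)
  have U_mono: "U n \<subseteq> U (Suc n)" for n
    by (induction n) (auto simp: U0 US)
  have W_U: "W \<subseteq> U n" for n by (cases n) (auto simp: U0 US)
  have in_U: "y \<in> U j" if "(T ^^ j) y \<in> W" for y j
    using that by (induction j arbitrary: y) (auto simp: U0 US funpow_swap1)
  have returns: "\<exists>n. T x \<in> U n" if "x \<in> W" for x
  proof -
    from that obtain n where n: "n > 0" "(T ^^ n) x \<in> P" unfolding W_def Z_def INFM_nat by blast
    then have "(T ^^ n) x \<in> W" using Z_shift[of x n] that by (simp add: W_def)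
    with n(1) have "(T ^^ (n - 1)) (T x) \<in> W" by (cases n) (auto simp: funpow_swap1)
    then show ?thesis using in_U by blast
  qed
  \<comment> \<open>The mass lost by pulling back along T is monotone in the set.\<close>
  define loss where "loss Y = measure M Y - measure M (T -` Y)" for Y
  have loss_nonneg: "0 \<le> loss Y" if "Y \<in> fmeasurable M" for Y
    using le[of Y] that vimf[OF that]
    by (auto simp: loss_def fmeasurable_def measure_def intro!: enn2real_mono)
  have loss_mono: "loss W \<le> loss (U n)" for n
  proof -
    have "measure M (U n) = measure M W + measure M (U n - W)"
      using measure_Un2[OF W fmeasurable.Diff[OF U[of n] W]] W_U[of n] measure_Un2[OF W U[of n]]
      by (simp add: Un_absorb1)
    moreover have "measure M (T -` U n) = measure M (T -` W) + measure M (T -` (U n - W))"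
      using measure_Un2[OF vimf[OF W] vimf[OF U[of n]]] W_U[of n]
      by (simp add: Un_absorb1 vimage_mono vimage_Diff)
    ultimately show ?thesis
      using loss_nonneg[OF fmeasurable.Diff[OF U[of n] W]] by (simp add: loss_def)
  qed
  \<comment> \<open>Since \<open>U n\<close> lies in \<open>U (Suc n)\<close>, its mass exceeds that
    of its preimage by at most the part of \<open>W\<close> outside this preimage.\<close>
  have loss_le: "loss W \<le> measure M (W - T -` U n)" for n
  proof -
    have "measure M (U n) \<le> measure M (U (Suc n))"
      using U_mono U by (intro measure_mono_fmeasurable) (auto simp: fmeasurable_def)
    also have "U (Suc n) = T -` U n \<union> W" by (auto simp: US)
    also have "measure M \<dots> = measure M (T -` U n) + measure M (W - T -` U n)"
      by (rule measure_Un2[OF vimf[OF U] W])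
    finally show ?thesis using loss_mono[of n] by (simp add: loss_def)
  qed
  have lim: "(\<lambda>n. measure M (W - T -` U n)) \<longlonglongrightarrow> measure M (\<Inter>n. W - T -` U n)"
  proof (rule Lim_measure_decseq)
    show "range (\<lambda>n. W - T -` U n) \<subseteq> sets M"
      using W_sets vim U by (auto simp: fmeasurable_def)
    show "decseq (\<lambda>n. W - T -` U n)"
      using U_mono by (intro decseq_SucI) blast
    show "emeasure M (W - T -` U n) \<noteq> \<infinity>" for n
      using fmeasurable.Diff[OF W vimf[OF U[of n]]] by (auto simp: fmeasurable_def)
  qed
  have "(\<Inter>n. W - T -` U n) = {}" using returns by auto
  with lim have "(\<lambda>n. measure M (W - T -` U n)) \<longlonglongrightarrow> 0" by (simp only: measure_empty)
  then have "loss W \<le> 0" by (rule LIMSEQ_le_const) (use loss_le in blast)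
  moreover have "0 < loss W" if "0 < emeasure M W"
  proof -
    have "ennreal (measure M (T -` W)) < ennreal (measure M W)"
      using strict[OF W that] emeasure_eq_measure2[OF W] emeasure_eq_measure2[OF vimf[OF W]] by simp
    then show ?thesis by (simp add: loss_def ennreal_less_iff)
  qed
  ultimately have "emeasure M W = 0" by (metis not_le zero_less_iff_neq_zero)
  then have W_null: "W \<in> null_sets M" using W_sets by (auto simp: null_sets_def)
  have "(T ^^ n) -` W \<in> null_sets M" for n
  proof (induction n)
    case (Suc n)
    have "emeasure M (T -` ((T ^^ n) -` W)) = 0"
      using le[OF null_setsD2[OF Suc]] null_setsD1[OF Suc] by simp
    moreover have "(T ^^ Suc n) -` W = T -` ((T ^^ n) -` W)" by (auto simp: funpow_swap1)
    ultimately have "emeasure M ((T ^^ Suc n) -` W) = 0" by (simp only:)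
    then show ?case using vimn[OF W_sets] by (rule null_setsI)
  qed (simp add: W_null)
  \<comment> \<open>Preimages of null sets are null by \<open>le\<close>, and every recurrent point
    enters \<open>W\<close> at some time.\<close>
  then have "(\<Union>n. (T ^^ n) -` W) \<in> null_sets M" by auto
  moreover have "Z \<subseteq> (\<Union>n. (T ^^ n) -` W)"
  proof
    fix x assume x: "x \<in> Z"
    then obtain n where "(T ^^ n) x \<in> P" unfolding Z_def INFM_nat by blast
    then show "x \<in> (\<Union>n. (T ^^ n) -` W)" using Z_shift[OF x] by (auto simp: W_def)
  qed
  ultimately show ?thesis using Z_sets null_sets_subset unfolding Z_def by blast
qed

section \<open>Expansion of mass by the flow\<close>

lemma vector_derivative_bound:
  fixes g :: "real \<Rightarrow> 'a::real_normed_vector"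
  assumes "a \<le> b"
    and g: "\<And>s. s \<in> {a..b} \<Longrightarrow> (g has_vector_derivative g' s) (at s within {a..b})"
    and B: "\<And>s. s \<in> {a..b} \<Longrightarrow> norm (g' s) \<le> B"
  shows "norm (g b - g a) \<le> B * (b - a)"
proof -
  have "0 \<le> B" using order_trans[OF norm_ge_zero B[of a]] assms(1) by auto
  have "norm (g b - g a) \<le> B * norm (b - a)"
  proof (rule differentiable_bound[where S = "{a..b}" and f' = "\<lambda>s h. h *\<^sub>R g' s"])
    show "(g has_derivative (\<lambda>h. h *\<^sub>R g' s)) (at s within {a..b})" if "s \<in> {a..b}" for s
      using g[OF that] by (simp add: has_vector_derivative_def)
    show "onorm (\<lambda>h. h *\<^sub>R g' s) \<le> B" if "s \<in> {a..b}" for s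
      using B[OF that] \<open>0 \<le> B\<close> by (intro onorm_bound) (auto simp: mult.commute[of B] intro: mult_left_mono)
  qed (use assms(1) in auto)
  then show ?thesis using assms(1) by simp
qed

definition euler_map :: "('a::real_vector \<Rightarrow> 'a) \<Rightarrow> real \<Rightarrow> 'a \<Rightarrow> 'a" where
  "euler_map f h y = y + h *\<^sub>R f y"

text \<open>Convergence of Euler's method: \<open>k\<close> local errors
  \<open>L * M * h\<^sup>2\<close>, each amplified by at most \<open>(1 + L * h) ^ k\<close>. With
  \<open>h = 1 / N\<close> and \<open>k = N\<close> this is of order \<open>1 / N\<close>, uniformly
  in the starting point as long as everything stays in \<open>B\<close>.\<close>

lemma euler_error:
  fixes f :: "'a::real_normed_vector \<Rightarrow> 'a"
  assumes x: "\<And>t. t \<in> {0..real k * h} \<Longrightarrow> (x has_vector_derivative f (x t)) (at t within {0..real k * h})"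
    and B: "\<And>t. t \<in> {0..real k * h} \<Longrightarrow> x t \<in> B"
    and yB: "\<And>j. j < k \<Longrightarrow> (euler_map f h ^^ j) (x 0) \<in> B"
    and L: "L-lipschitz_on B f" and M: "\<And>z. z \<in> B \<Longrightarrow> norm (f z) \<le> M" and h: "0 \<le> h"
  shows "norm (x (real k * h) - (euler_map f h ^^ k) (x 0)) \<le> real k * (L * M * h\<^sup>2) * (1 + L * h) ^ k"
  using x B yB
proof (induction k)
  case (Suc k)
  define t where "t = real k * h"
  define y where "y = (euler_map f h ^^ k) (x 0)"
  have t: "0 \<le> t" "real (Suc k) * h = t + h" "t \<le> t + h" using h by (auto simp: t_def algebra_simps)
  have L0: "0 \<le> L" using L by (rule lipschitz_on_nonneg)
  have M0: "0 \<le> M" using order_trans[OF norm_ge_zero M[of "x 0"]] Suc.prems(2)[of 0] h by auto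
  have sub: "(x has_vector_derivative f (x s)) (at s within S)" if "s \<in> S" "S \<subseteq> {0..t+h}" for s S
    using Suc.prems(1)[of s] that unfolding t(2) by (blast intro: has_vector_derivative_within_subset)
  have IH: "norm (x t - y) \<le> real k * (L * M * h\<^sup>2) * (1 + L * h) ^ k"
    unfolding t_def y_def
  proof (rule Suc.IH)
    show "(x has_vector_derivative f (x s)) (at s within {0..real k * h})" if "s \<in> {0..real k * h}" for s
      using that t h by (intro sub) (auto simp: t_def[symmetric])
    show "x s \<in> B" if "s \<in> {0..real k * h}" for s
      using that t h by (intro Suc.prems(2)) (auto simp: t_def[symmetric])
  qed (use Suc.prems(3) in auto)
  have xB: "x s \<in> B" if "s \<in> {t..t+h}" for s using Suc.prems(2)[of s] that t by auto
  have move: "norm (x s - x t) \<le> M * h" if s: "s \<in> {t..t+h}" for s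
  proof -
    have "norm (x s - x t) \<le> M * (s - t)"
      by (rule vector_derivative_bound[of t s x "\<lambda>s. f (x s)"]) (use s t in \<open>auto intro!: sub M xB\<close>)
    also have "\<dots> \<le> M * h" using s M0 by (intro mult_left_mono) auto
    finally show ?thesis .
  qed
  \<comment> \<open>Local error: during one step the solution moves by at most \<open>M * h\<close>,
    so its velocity changes by at most \<open>L * (M * h)\<close>. Subtracting the linear motion
    leaves exactly this change as derivative.\<close>
  have "norm ((x (t + h) - (t + h) *\<^sub>R f (x t)) - (x t - t *\<^sub>R f (x t))) \<le> L * (M * h) * ((t + h) - t)"
  proof (rule vector_derivative_bound[of t "t + h" _ "\<lambda>s. f (x s) - f (x t)"])
    fix s assume s: "s \<in> {t..t+h}"
    have "((\<lambda>s. x s - s *\<^sub>R f (x t)) has_vector_derivative f (x s) - 1 *\<^sub>R f (x t)) (at s within {t..t+h})"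
      by (intro has_vector_derivative_diff sub
          bounded_linear.has_vector_derivative[OF bounded_linear_scaleR_left has_vector_derivative_id])
         (use s t in auto)
    then show "((\<lambda>s. x s - s *\<^sub>R f (x t)) has_vector_derivative f (x s) - f (x t)) (at s within {t..t+h})"
      by simp
    have "norm (f (x s) - f (x t)) \<le> L * norm (x s - x t)"
      using lipschitz_onD[OF L xB[OF s] xB[of t]] h by (simp add: dist_norm)
    also have "\<dots> \<le> L * (M * h)" using move[OF s] L0 by (rule mult_left_mono)
    finally show "norm (f (x s) - f (x t)) \<le> L * (M * h)" .
  qed (use h in simp)
  then have loc: "norm (x (t + h) - x t - h *\<^sub>R f (x t)) \<le> L * M * h\<^sup>2"
    by (simp add: algebra_simps power2_eq_square)
  have "norm (f (x t) - f y) \<le> L * norm (x t - y)"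
    using lipschitz_onD[OF L xB[of t] Suc.prems(3)[of k]] h by (simp add: dist_norm y_def)
  then have lip: "norm (h *\<^sub>R (f (x t) - f y)) \<le> h * (L * norm (x t - y))"
    using h by (simp add: mult_left_mono)
  have "x (t + h) - euler_map f h y = (x (t + h) - x t - h *\<^sub>R f (x t)) + ((x t - y) + h *\<^sub>R (f (x t) - f y))"
    by (simp add: euler_map_def algebra_simps)
  also have "norm \<dots> \<le> L * M * h\<^sup>2 + (norm (x t - y) + h * (L * norm (x t - y)))"
    by (intro order_trans[OF norm_triangle_ineq] add_mono loc lip order_refl)
  also have "\<dots> = L * M * h\<^sup>2 + (1 + L * h) * norm (x t - y)" by (simp add: algebra_simps)
  \<comment> \<open>The fresh local error is inflated by a power that is at least 1 so that it
    merges with the inductive bound.\<close>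
  also have "\<dots> \<le> L * M * h\<^sup>2 * (1 + L * h) ^ Suc k + (1 + L * h) * (real k * (L * M * h\<^sup>2) * (1 + L * h) ^ k)"
  proof (intro add_mono mult_left_mono IH)
    have "1 \<le> (1 + L * h) ^ Suc k" using L0 h by (intro one_le_power) auto
    then show "L * M * h\<^sup>2 \<le> L * M * h\<^sup>2 * (1 + L * h) ^ Suc k"
      using mult_left_mono[of 1 "(1 + L * h) ^ Suc k" "L * M * h\<^sup>2"] L0 M0 by simp
  qed (use L0 h in auto)
  also have "\<dots> = real (Suc k) * (L * M * h\<^sup>2) * (1 + L * h) ^ Suc k" by (simp add: algebra_simps)
  finally show ?case unfolding t(2) by (simp add: y_def)
qed simp

text \<open>The growth bound rules out finite escape time and also makes the origin an
  equilibrium.\<close>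

locale linear_growth_field =
  fixes f :: "real ^ 'n::finite \<Rightarrow> real ^ 'n" and C :: real
  assumes f_C1: "C1_on UNIV f" and growth: "\<And>x. norm (f x) \<le> C * norm x" and C_pos: "0 < C"
begin

lemma locally_lipschitz: "\<exists>L. L-lipschitz_on (cball 0 R) f"
  using C1_on_lipschitz[OF C1_on_subset[OF f_C1, of "cball 0 R"]] by (metis compact_cball convex_cball subset_UNIV)

text \<open>A trajectory is constrained only on nonnegative times, where it is unique; the chosen
  values at negative times carry no meaning.\<close>

definition flow :: "real ^ 'n \<Rightarrow> real \<Rightarrow> real ^ 'n" where
  "flow x0 = (SOME x. trajectory f x0 x)"

lemma trajectory_flow: "trajectory f x0 (flow x0)"
proof -
  obtain x where "x 0 = x0" "\<And>t. 0 \<le> t \<Longrightarrow> (x has_vector_derivative f (x t)) (at t within {0..})"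
    using global_solution_of_linear_growth[OF locally_lipschitz growth] C_pos by (metis less_imp_le)
  then have "\<exists>x. trajectory f x0 x" by (auto simp: trajectory_def)
  then show ?thesis unfolding flow_def by (rule someI_ex)
qed

lemma flow_0 [simp]: "flow x0 0 = x0"
  and flow_derivative: "0 \<le> t \<Longrightarrow> (flow x0 has_vector_derivative f (flow x0 t)) (at t within {0..})"
  using trajectory_flow[of x0] by (auto simp: trajectory_def)

lemma flow_derivative_Icc:
  "t \<in> {0..T} \<Longrightarrow> (flow x0 has_vector_derivative f (flow x0 t)) (at t within {0..T})"
  using flow_derivative[of t x0] by (auto intro: has_vector_derivative_within_subset)

lemma flow_bounds:
  assumes "0 \<le> t"
  shows "norm (flow x t) \<le> norm x * exp (C * t)" "norm x * exp (- (C * t)) \<le> norm (flow x t)"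
  using solution_growth[OF flow_derivative_Icc growth, of t t x] assms by auto

lemma flow_add:
  assumes "0 \<le> s" "0 \<le> t"
  shows "flow x (s + t) = flow (flow x s) t"
proof (rule solution_unique[OF locally_lipschitz _ _ _ assms(2), of "\<lambda>t. flow x (s + t)"])
  fix t :: real assume t: "0 \<le> t"
  have "((flow x \<circ> (+) s) has_vector_derivative 1 *\<^sub>R f (flow x (s + t))) (at t within {0..})"
  proof (rule vector_diff_chain_within)
    show "((+) s has_vector_derivative 1) (at t within {0..})"
      by (auto intro!: derivative_eq_intros)
    show "(flow x has_vector_derivative f (flow x (s + t))) (at (s + t) within (+) s ` {0..})"
      using flow_derivative[of "s + t" x] assms t by (auto intro: has_vector_derivative_within_subset)
  qed
  then show "((\<lambda>t. flow x (s + t)) has_vector_derivative f (flow x (s + t))) (at t within {0..})"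
    by (simp add: comp_def)
qed (use flow_derivative in auto)

definition time_one :: "real ^ 'n \<Rightarrow> real ^ 'n" where "time_one x = flow x 1"

lemma time_one_funpow: "(time_one ^^ n) x = flow x (real n)"
proof (induction n)
  case (Suc n)
  then show ?case using flow_add[of "real n" 1 x] by (simp add: time_one_def add.commute)
qed simp

lemma continuous_time_one: "continuous_on S time_one"
proof (rule continuous_on_subset)
  show "continuous_on UNIV time_one"
    unfolding continuous_on_eq_continuous_at[OF open_UNIV]
  proof
    fix x :: "real ^ 'n"
    define R where "R = norm x + 1"
    obtain L where L: "L-lipschitz_on (cball 0 (R * exp C)) f" using locally_lipschitz by blast
    have "(exp L)-lipschitz_on (ball x 1) time_one"
    proof (rule lipschitz_onI)
      fix y z assume yz: "y \<in> ball x 1" "z \<in> ball x 1"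
      have in_ball: "flow w t \<in> cball 0 (R * exp C)" if "w \<in> ball x 1" "t \<in> {0..1}" for w t
      proof -
        have "norm w \<le> R" using that norm_triangle_sub[of w x] by (auto simp: R_def dist_norm norm_minus_commute)
        moreover have "exp (C * t) \<le> exp C" using that C_pos by simp
        ultimately have "norm w * exp (C * t) \<le> R * exp C" by (intro mult_mono) (auto simp: R_def)
        then show ?thesis using flow_bounds(1)[of t w] that by auto
      qed
      have "norm (flow y 1 - flow z 1) \<le> norm (flow y 0 - flow z 0) * exp (L * 1)"
        by (rule solutions_distance[OF flow_derivative_Icc flow_derivative_Icc _ L, of 1])
           (use in_ball yz in auto)
      then show "dist (time_one y) (time_one z) \<le> exp L * dist y z"
        by (simp add: time_one_def dist_norm mult.commute)
    qed simp
    then have "continuous_on (ball x 1) time_one" by (rule lipschitz_on_continuous_on)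
    then show "isCont time_one x" by (simp add: continuous_on_eq_continuous_at)
  qed
qed simp

end

text \<open>The density is regular and positive off the origin only, since it will involve a
  negative power of \<open>b\<close>. The last assumption is positivity of the divergence of
  \<open>\<rho> f\<close>, expanded by the product rule.\<close>

locale expanding_density = linear_growth_field f C for f :: "real ^ 'n::finite \<Rightarrow> real ^ 'n" and C +
  fixes \<rho> :: "real ^ 'n \<Rightarrow> real"
  assumes \<rho>_C1: "C1_on (- {0}) \<rho>" and \<rho>_pos: "x \<noteq> 0 \<Longrightarrow> 0 < \<rho> x"
    and divergence_pos: "x \<noteq> 0 \<Longrightarrow>
      0 < frechet_derivative \<rho> (at x) (f x) + \<rho> x * trace (matrix (frechet_derivative f (at x)))"
begin

definition mass :: "(real ^ 'n) measure" where "mass = density lborel (\<lambda>x. ennreal (\<rho> x))"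

lemma \<rho>_continuous: "S \<subseteq> - {0} \<Longrightarrow> continuous_on S \<rho>"
  using C1_on_continuous_on[OF \<rho>_C1] by (rule continuous_on_subset)

lemma \<rho>_measurable [measurable]: "\<rho> \<in> borel_measurable borel"
  by (rule borel_measurable_continuous_countable_exceptions[of "{0}"]) (auto intro: \<rho>_continuous)

lemma sets_mass [simp, measurable_cong]: "sets mass = sets borel" and space_mass [simp]: "space mass = UNIV"
  by (simp_all add: mass_def)

lemma emeasure_mass: "A \<in> sets borel \<Longrightarrow> emeasure mass A = (\<integral>\<^sup>+x\<in>A. ennreal (\<rho> x) \<partial>lborel)"
  by (simp add: mass_def emeasure_density)

lemma emeasure_mass_compact: "compact K \<Longrightarrow> 0 \<notin> K \<Longrightarrow> emeasure mass K < \<infinity>"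
proof -
  assume K: "compact K" "0 \<notin> K"
  have "0 \<le> \<rho> x" if "x \<in> K" for x using K \<rho>_pos[of x] that by (metis less_imp_le)
  then have "emeasure mass K = ennreal (integral K \<rho>)"
    using K by (subst emeasure_mass)
      (auto simp: borel_closed compact_imp_closed intro!: nn_integral_compact_continuous \<rho>_continuous)
  then show ?thesis by simp
qed

text \<open>\<open>N\<close> Euler steps of size \<open>1 / N\<close> multiply the mass by at least
  \<open>(1 + r / N) ^ N\<close>, hence by \<open>1 + r\<close>. Their images approach
  \<open>time_one\<close> of \<open>Y\<close> uniformly, so they enter every closed neighbourhood of
  that compact set, and the bound passes to the limit because the neighbourhoods have finite mass
  and shrink to it.\<close>

lemma emeasure_mass_le_time_one:
  assumes Y: "compact Y" "0 \<notin> Y"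
  obtains r where "r > 0" and "ennreal (1 + r) * emeasure mass Y \<le> emeasure mass (time_one ` Y)"
proof (cases "Y = {}")
  case True
  then show ?thesis using that[of 1] by simp
next
  case False
  obtain b where b: "\<And>y. y \<in> Y \<Longrightarrow> norm y \<le> b" "b > 0"
    using compact_imp_bounded[OF Y(1)] unfolding bounded_pos by blast
  obtain a where a: "\<And>y. y \<in> Y \<Longrightarrow> a \<le> norm y" "a > 0"
  proof -
    obtain y where "y \<in> Y" "\<And>z. z \<in> Y \<Longrightarrow> dist 0 y \<le> dist 0 z"
      using distance_attains_inf[OF compact_imp_closed[OF Y(1)] False, of 0] by blast
    then show ?thesis using Y(2) by (intro that[of "norm y"]) auto
  qed
  \<comment> \<open>One shell for all \<open>N\<close>: an iterate grows at most by
    \<open>(1 + C / N) ^ N \<le> exp C\<close> and shrinks at most by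
    \<open>(1 - C / N) ^ N\<close>, which tends to \<open>exp (- C)\<close> and thus eventually
    exceeds half of it.\<close>
  define K where "K = cball 0 (b * exp C) - ball (0 :: real ^ 'n) (a * (exp (- C) / 2))"
  have K: "compact K" "K \<subseteq> - {0}" unfolding K_def using a by (auto intro: compact_diff)
  obtain r where r: "r > 0" and step: "\<And>h Z. 0 < h \<Longrightarrow> h < r \<Longrightarrow> compact Z \<Longrightarrow> Z \<subseteq> K \<Longrightarrow>
      inj_on (\<lambda>y. y + h *\<^sub>R f y) Z \<Longrightarrow> (\<lambda>y. y + h *\<^sub>R f y) ` Z \<subseteq> - {0} \<Longrightarrow>
      ennreal (1 + r * h) * (\<integral>\<^sup>+x\<in>Z. ennreal (\<rho> x) \<partial>lborel)
        \<le> (\<integral>\<^sup>+x\<in>(\<lambda>y. y + h *\<^sub>R f y) ` Z. ennreal (\<rho> x) \<partial>lborel)"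
  proof (rule euler_step[OF C1_on_subset[OF f_C1 subset_UNIV] \<rho>_C1 open_Compl[OF closed_singleton] K])
  qed (use \<rho>_pos divergence_pos in auto)
  obtain L0 where "L0-lipschitz_on (cball 0 (b * exp C)) f" using locally_lipschitz by blast
  then obtain L where L: "L-lipschitz_on (cball 0 (b * exp C)) f" "L > 0"
    using lipschitz_on_le[of L0 _ f "L0 + 1"] lipschitz_on_nonneg[of L0] by (metis add_nonneg_pos less_add_one less_imp_le zero_less_one)
  define M where "M = C * (b * exp C)"
  define E where "E N = euler_map f (1 / real N)" for N :: nat
  \<comment> \<open>The second condition admits the mass estimate, the third makes an Euler step
    injective on the ball, the fourth keeps the shrinking factor \<open>1 - C / N\<close>
    nonnegative, and the last keeps the iterates in \<open>K\<close>.\<close>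
  define good where "good N \<longleftrightarrow> N > 0 \<and> 1 / real N < r \<and> L / real N < 1 \<and> C / real N \<le> 1 \<and> exp (- C) / 2 \<le> (1 - C / real N) ^ N" for N :: nat
  have "\<forall>\<^sub>F N in sequentially. good N"
  proof -
    have lim: "(\<lambda>N. c / real N) \<longlonglongrightarrow> 0" for c by (rule lim_const_over_n)
    have "\<forall>\<^sub>F N in sequentially. 1 / real N < r" using r lim by (intro order_tendstoD(2))
    moreover have "\<forall>\<^sub>F N in sequentially. L / real N < 1" by (intro order_tendstoD(2)[OF lim]) simp
    moreover have "\<forall>\<^sub>F N in sequentially. C / real N < 1" by (intro order_tendstoD(2)[OF lim]) simp
    moreover have "\<forall>\<^sub>F N in sequentially. exp (- C) / 2 < (1 + (- C) / real N) ^ N"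
      by (intro order_tendstoD(1)[OF tendsto_exp_limit_sequentially]) simp
    ultimately show ?thesis using eventually_gt_at_top[of 0]
      by eventually_elim (auto simp: good_def)
  qed
  then obtain N0 where N0: "\<And>N. N0 \<le> N \<Longrightarrow> good N" unfolding eventually_sequentially by blast
  have iterate_bounds: "norm ((E N ^^ k) y) \<le> norm y * (1 + C / real N) ^ k"
      "norm y * (1 - C / real N) ^ k \<le> norm ((E N ^^ k) y)" if "good N" for N k y
  proof -
    have C_N: "0 \<le> C / real N" "C / real N \<le> 1" using that C_pos by (auto simp: good_def)
    have one: "norm (E N z) \<le> norm z * (1 + C / real N)" "norm z * (1 - C / real N) \<le> norm (E N z)" for z
    proof -
      have "norm ((1 / real N) *\<^sub>R f z) \<le> C / real N * norm z"
        using growth[of z] that by (simp add: good_def divide_right_mono)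
      then show "norm (E N z) \<le> norm z * (1 + C / real N)" "norm z * (1 - C / real N) \<le> norm (E N z)"
        using norm_triangle_ineq[of z "(1 / real N) *\<^sub>R f z"] norm_diff_ineq[of z "(1 / real N) *\<^sub>R f z"]
        unfolding E_def euler_map_def by (simp_all only: distrib_left right_diff_distrib) (simp_all add: mult.commute)
    qed
    show "norm ((E N ^^ k) y) \<le> norm y * (1 + C / real N) ^ k"
    proof (induction k)
      case (Suc k)
      have "norm ((E N ^^ Suc k) y) \<le> norm ((E N ^^ k) y) * (1 + C / real N)" using one(1) by simp
      also have "\<dots> \<le> norm y * (1 + C / real N) ^ k * (1 + C / real N)"
        using Suc C_N by (intro mult_right_mono) auto
      finally show ?case by (simp add: mult_ac)
    qed simp
    show "norm y * (1 - C / real N) ^ k \<le> norm ((E N ^^ k) y)"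
    proof (induction k)
      case (Suc k)
      have "norm y * (1 - C / real N) ^ k * (1 - C / real N) \<le> norm ((E N ^^ k) y) * (1 - C / real N)"
        using Suc C_N by (intro mult_right_mono) auto
      also have "\<dots> \<le> norm ((E N ^^ Suc k) y)" using one(2) by simp
      finally show ?case by (simp add: mult_ac)
    qed simp
  qed
  have iterate_K: "(E N ^^ k) y \<in> K" if "good N" "k \<le> N" "y \<in> Y" for N k y
  proof -
    have N: "0 < N" "C / real N \<le> 1" "exp (- C) / 2 \<le> (1 - C / real N) ^ N" using that(1) by (auto simp: good_def)
    have "(1 + C / real N) ^ k \<le> (1 + C / real N) ^ N" using that C_pos by (intro power_increasing) auto
    also have "\<dots> \<le> exp (C / real N) ^ N" using C_pos by (intro power_mono exp_ge_add_one_self) auto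
    also have "\<dots> = exp C" using N by (simp flip: exp_of_nat_mult)
    finally have "norm ((E N ^^ k) y) \<le> b * exp C"
      using iterate_bounds(1)[OF that(1), of k y] b that(3) C_pos
      by (elim order_trans) (intro mult_mono, auto)
    moreover have "a * (exp (- C) / 2) \<le> norm ((E N ^^ k) y)"
    proof -
      have "exp (- C) / 2 \<le> (1 - C / real N) ^ k"
        using N(3) power_decreasing[OF that(2), of "1 - C / real N"] N C_pos by auto
      then have "a * (exp (- C) / 2) \<le> norm y * (1 - C / real N) ^ k"
        using a that(3) by (intro mult_mono) auto
      then show ?thesis using iterate_bounds(2)[OF that(1), of y k] by linarith
    qed
    ultimately show ?thesis by (auto simp: K_def)
  qed
  have iterate_mass: "compact ((E N ^^ k) ` Y) \<and>
      ennreal ((1 + r / real N) ^ k) * emeasure mass Y \<le> emeasure mass ((E N ^^ k) ` Y)"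
    if "good N" "k \<le> N" for N k
    using that(2)
  proof (induction k)
    case (Suc k)
    define Z where "Z = (E N ^^ k) ` Y"
    have N: "0 < 1 / real N" "1 / real N < r" "L / real N < 1" using that by (auto simp: good_def)
    have Z: "compact Z" "Z \<subseteq> K" and IH: "ennreal ((1 + r / real N) ^ k) * emeasure mass Y \<le> emeasure mass Z"
      using Suc iterate_K[OF that(1)] by (auto simp: Z_def)
    have EZ: "(E N ^^ Suc k) ` Y = E N ` Z" by (auto simp: Z_def image_image)
    have EZ_K: "E N ` Z \<subseteq> K"
      unfolding EZ[symmetric] using iterate_K[OF that(1) Suc.prems] by auto
    have "continuous_on Z (E N)"
      unfolding E_def euler_map_def
      by (intro continuous_intros continuous_on_subset[OF C1_on_continuous_on[OF f_C1]]) auto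
    then have cpt: "compact (E N ` Z)" using Z by (intro compact_continuous_image)
    \<comment> \<open>If two points had the same image, their distance would equal
      \<open>1 / N\<close> times the difference of \<open>f\<close>, which is smaller because
      \<open>L / N < 1\<close>.\<close>
    have "inj_on (E N) Z"
    proof (rule inj_onI, rule ccontr)
      fix y z assume yz: "y \<in> Z" "z \<in> Z" "E N y = E N z" "y \<noteq> z"
      have ball: "y \<in> cball 0 (b * exp C)" "z \<in> cball 0 (b * exp C)"
        using yz(1,2) Z(2) by (auto simp: K_def)
      have "y - z = - ((1 / real N) *\<^sub>R (f y - f z))"
        using yz(3) by (simp add: E_def euler_map_def algebra_simps)
      then have "norm (y - z) = norm (f y - f z) / real N" by (simp del: minus_diff_eq)
      also have "\<dots> \<le> L * norm (y - z) / real N"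
        using lipschitz_onD[OF L(1) ball] by (intro divide_right_mono) (auto simp: dist_norm)
      also have "\<dots> = (L / real N) * norm (y - z)" by simp
      also have "\<dots> < 1 * norm (y - z)" using N yz by (intro mult_strict_right_mono) auto
      finally show False by simp
    qed
    then have "ennreal (1 + r * (1 / real N)) * emeasure mass Z \<le> emeasure mass (E N ` Z)"
      using step[OF N(1,2) Z] EZ_K K(2) Z cpt unfolding E_def euler_map_def
      by (auto simp: emeasure_mass borel_closed compact_imp_closed)
    moreover have "ennreal ((1 + r / real N) ^ Suc k) * emeasure mass Y
        = ennreal (1 + r / real N) * (ennreal ((1 + r / real N) ^ k) * emeasure mass Y)"
      using r by (simp add: ennreal_mult' mult.assoc del: ennreal_plus)
    moreover have "\<dots> \<le> ennreal (1 + r / real N) * emeasure mass Z"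
      using IH by (rule mult_left_mono) simp
    ultimately show ?case using cpt unfolding EZ by simp
  qed (use Y in simp)
  \<comment> \<open>Closed neighbourhoods of the image, cut down to \<open>K\<close> so that they
    are compact, avoid 0 and have finite mass.\<close>
  define V where "V j = K \<inter> {z. infdist z (time_one ` Y) \<le> 1 / real (Suc j)}" for j
  have TY: "compact (time_one ` Y)" by (intro compact_continuous_image continuous_time_one Y)
  have V_compact: "compact (V j)" for j
    unfolding V_def
    by (intro compact_Int_closed K closed_Collect_le continuous_intros)
  have bound: "ennreal (1 + r) * emeasure mass Y \<le> emeasure mass (V j)" for j
  proof -
    have "(\<lambda>N. (L * M * exp L) / real N) \<longlonglongrightarrow> 0" by (rule lim_const_over_n)
    then have "\<forall>\<^sub>F N in sequentially. L * M * exp L / real N < 1 / real (Suc j)"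
      by (rule order_tendstoD(2)) simp
    then obtain N1 where N1: "\<And>N. N1 \<le> N \<Longrightarrow> L * M * exp L / real N < 1 / real (Suc j)"
      unfolding eventually_sequentially by blast
    define N where "N = max N0 N1"
    have N: "good N" "L * M * exp L / real N < 1 / real (Suc j)" using N0 N1 by (auto simp: N_def)
    have N_pos: "0 < N" using N by (simp add: good_def)
    have "(E N ^^ N) ` Y \<subseteq> V j"
    proof
      fix z assume "z \<in> (E N ^^ N) ` Y"
      then obtain y where y: "y \<in> Y" "z = (E N ^^ N) y" by blast
      have "norm (flow y (real N * (1 / real N)) - (euler_map f (1 / real N) ^^ N) (flow y 0))
          \<le> real N * (L * M * (1 / real N)\<^sup>2) * (1 + L * (1 / real N)) ^ N"
      proof (rule euler_error[OF flow_derivative_Icc _ _ L(1)])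
        fix t assume "t \<in> {0..real N * (1 / real N)}"
        then have t: "0 \<le> t" "t \<le> 1" using N_pos by auto
        have "norm (flow y t) \<le> norm y * exp (C * t)" by (rule flow_bounds) fact
        also have "\<dots> \<le> b * exp C" using b y t C_pos by (intro mult_mono) auto
        finally show "flow y t \<in> cball 0 (b * exp C)" by simp
      next
        fix k assume "k < N"
        then show "(euler_map f (1 / real N) ^^ k) (flow y 0) \<in> cball 0 (b * exp C)"
          using iterate_K[OF N(1), of k y] y by (auto simp: K_def E_def)
      next
        fix z :: "real ^ 'n" assume "z \<in> cball 0 (b * exp C)"
        then have "C * norm z \<le> M" using C_pos by (simp add: M_def)
        then show "norm (f z) \<le> M" using growth[of z] by linarith
      qed auto
      also have "\<dots> \<le> real N * (L * M * (1 / real N)\<^sup>2) * exp L"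
      proof (rule mult_left_mono)
        have "(1 + L * (1 / real N)) ^ N \<le> exp (L / real N) ^ N"
          using L by (intro power_mono) (auto intro: exp_ge_add_one_self)
        also have "\<dots> = exp L" using N_pos by (simp flip: exp_of_nat_mult)
        finally show "(1 + L * (1 / real N)) ^ N \<le> exp L" .
      qed (use L b C_pos in \<open>auto simp: M_def\<close>)
      also have "\<dots> = L * M * exp L / real N" using N_pos by (simp add: power2_eq_square field_simps)
      finally have "dist z (time_one y) \<le> 1 / real (Suc j)"
        using N(2) N_pos y(2) by (simp add: time_one_def E_def dist_norm norm_minus_commute)
      then have "infdist z (time_one ` Y) \<le> 1 / real (Suc j)"
        using infdist_le[of "time_one y" "time_one ` Y" z] y(1) by auto
      then show "z \<in> V j" using iterate_K[OF N(1) order_refl y(1)] y(2) by (simp add: V_def)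
    qed
    then have "emeasure mass ((E N ^^ N) ` Y) \<le> emeasure mass (V j)"
      using V_compact by (intro emeasure_mono) (auto simp: borel_closed compact_imp_closed)
    \<comment> \<open>Bernoulli's inequality removes the dependence on \<open>N\<close> from the
      accumulated gain.\<close>
    moreover have "1 + r \<le> (1 + r / real N) ^ N"
    proof -
      have "0 \<le> r / real N" using r by simp
      then have "- 1 \<le> r / real N" by linarith
      then show ?thesis using Bernoulli_inequality[of "r / real N" N] N_pos by simp
    qed
    then have "ennreal (1 + r) * emeasure mass Y \<le> ennreal ((1 + r / real N) ^ N) * emeasure mass Y"
      by (intro mult_right_mono ennreal_leI) auto
    ultimately show ?thesis using iterate_mass[OF N(1) order_refl] by (meson order_trans)
  qed
  have "(\<lambda>j. emeasure mass (V j)) \<longlonglongrightarrow> emeasure mass (\<Inter>j. V j)"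
  proof (rule Lim_emeasure_decseq)
    show "range V \<subseteq> sets mass" using V_compact by (auto simp: borel_closed compact_imp_closed)
    show "decseq V"
      unfolding V_def decseq_def by (auto elim!: order_trans intro!: divide_left_mono)
    show "emeasure mass (V j) \<noteq> \<infinity>" for j
      using emeasure_mass_compact[OF V_compact[of j]] K(2) by (auto simp: V_def)
  qed
  then have "ennreal (1 + r) * emeasure mass Y \<le> emeasure mass (\<Inter>j. V j)"
    using bound by (intro LIMSEQ_le_const) auto
  also have "\<dots> \<le> emeasure mass (time_one ` Y)"
  proof (rule emeasure_mono)
    show "(\<Inter>j. V j) \<subseteq> time_one ` Y"
    proof
      fix z assume z: "z \<in> (\<Inter>j. V j)"
      have "infdist z (time_one ` Y) \<le> 0"
      proof (rule field_le_epsilon)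
        fix e :: real assume "0 < e"
        then obtain j where "1 / real (Suc j) < e" using nat_approx_posE by auto
        moreover have "infdist z (time_one ` Y) \<le> 1 / real (Suc j)" using z by (auto simp: V_def)
        ultimately show "infdist z (time_one ` Y) \<le> 0 + e" by simp
      qed
      then show "z \<in> time_one ` Y"
        using in_closed_iff_infdist_zero[OF compact_imp_closed[OF TY]] False infdist_nonneg[of z "time_one ` Y"] by auto
    qed
  qed (use TY in \<open>auto simp: borel_closed compact_imp_closed\<close>)
  finally show ?thesis using that[OF r] by blast
qed

text \<open>Inner regularity requires a finite measure, but the mass may be infinite near 0 and far
  out. The set is therefore first cut with compact shells exhausting the punctured space; the origin
  itself is a null set.\<close>

lemma emeasure_mass_inner_compact:
  assumes A: "A \<in> sets borel" and c: "c < emeasure mass A"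
  obtains K where "compact K" "K \<subseteq> A" "0 \<notin> K" "c < emeasure mass K"
proof -
  define D where "D j = cball 0 (real (Suc j)) - ball (0 :: real ^ 'n) (1 / real (Suc j))" for j
  have D: "compact (D j)" "0 \<notin> D j" for j by (auto simp: D_def compact_diff)
  then have D_sets [measurable]: "D j \<in> sets borel" for j by (simp add: borel_closed compact_imp_closed)
  have "incseq D"
  proof (rule incseq_SucI)
    fix j
    have "1 / real (Suc (Suc j)) \<le> 1 / real (Suc j)" by (simp add: field_simps)
    then show "D j \<subseteq> D (Suc j)" by (auto simp: D_def)
  qed
  have UN_D: "(\<Union>j. D j) = - {0}"
  proof (intro equalityI subsetI)
    fix x :: "real ^ 'n" assume "x \<in> - {0}"
    then have x: "0 < norm x" by simp
    obtain j1 where j1: "1 / real (Suc j1) < norm x" using nat_approx_posE[OF x] by auto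
    obtain j2 where j2: "norm x < real j2" using reals_Archimedean2 by blast
    have "1 / real (Suc (max j1 j2)) \<le> 1 / real (Suc j1)" by (simp add: field_simps)
    then have "x \<in> D (max j1 j2)" using j1 j2 by (auto simp: D_def)
    then show "x \<in> (\<Union>j. D j)" by blast
  qed (use D in auto)
  have null0: "emeasure mass {0} = 0"
    by (simp add: emeasure_mass nn_integral_null_set)
  have AD: "A \<inter> D j \<in> sets mass" for j using A by simp
  then have UN_AD: "(\<Union>j. A \<inter> D j) \<in> sets mass" by blast
  have "A \<subseteq> (\<Union>j. A \<inter> D j) \<union> {0}" using UN_D by blast
  then have "emeasure mass A \<le> emeasure mass ((\<Union>j. A \<inter> D j) \<union> {0})"
    by (rule emeasure_mono) (use UN_AD in simp)
  also have "\<dots> \<le> emeasure mass (\<Union>j. A \<inter> D j) + emeasure mass {0}"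
    by (rule emeasure_subadditive[OF UN_AD]) simp
  finally have "emeasure mass A \<le> emeasure mass (\<Union>j. A \<inter> D j)" by (simp add: null0)
  also have "\<dots> = (SUP j. emeasure mass (A \<inter> D j))"
  proof (rule SUP_emeasure_incseq[symmetric])
    show "range (\<lambda>j. A \<inter> D j) \<subseteq> sets mass" using AD by blast
    show "incseq (\<lambda>j. A \<inter> D j)" using \<open>incseq D\<close> unfolding incseq_def by blast
  qed
  finally have "c < (SUP j. emeasure mass (A \<inter> D j))" by (rule less_le_trans[OF c])
  then obtain j where j: "c < emeasure mass (A \<inter> D j)"
    unfolding less_SUP_iff by blast
  \<comment> \<open>The mass restricted to one shell, which is finite.\<close>
  define M where "M = density mass (indicator (D j))"
  have M: "emeasure M B = emeasure mass (D j \<inter> B)" if "B \<in> sets borel" for B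
    unfolding M_def using that D_sets by (intro emeasure_restricted) simp_all
  have sets_M: "sets M = sets borel" by (simp add: M_def)
  have "emeasure M (space M) \<noteq> \<infinity>"
    using emeasure_mass_compact[OF D, of j] M[of UNIV] by (simp add: M_def less_top)
  then have "emeasure M (A \<inter> D j) = (SUP K\<in>{K. K \<subseteq> A \<inter> D j \<and> compact K}. emeasure M K)"
    using A by (intro inner_regular sets_M) auto
  moreover have "c < emeasure M (A \<inter> D j)" using j A M[of "A \<inter> D j"] by (simp add: Int_absorb1)
  ultimately obtain K where K: "K \<subseteq> A \<inter> D j" "compact K" "c < emeasure M K"
    by (auto simp: less_SUP_iff)
  have "emeasure M K = emeasure mass K"
    using M[of K] K by (simp add: borel_closed compact_imp_closed Int_absorb1)
  with K D show ?thesis by (intro that[of K]) auto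
qed

lemma time_one_eq_0: "time_one x = 0 \<longleftrightarrow> x = 0"
  using flow_bounds[of 1 x] by (auto simp: time_one_def mult_le_0_iff)

lemma measurable_time_one [measurable]: "time_one \<in> borel_measurable borel"
  by (rule borel_measurable_continuous_onI) (rule continuous_time_one)

lemma vimage_time_one_sets: "Y \<in> sets borel \<Longrightarrow> time_one -` Y \<in> sets borel"
  using measurable_sets[OF measurable_time_one] by simp

lemma compact_time_one_image: "compact K \<Longrightarrow> compact (time_one ` K)"
  by (intro compact_continuous_image continuous_time_one)

text \<open>If the preimage were heavier than \<open>Y\<close>, so would be some compact subset of
  it, whose image lies in \<open>Y\<close> and is at least as heavy.\<close>

lemma emeasure_mass_vimage_le:
  assumes Y: "Y \<in> sets borel"
  shows "emeasure mass (time_one -` Y) \<le> emeasure mass Y"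
proof (rule ccontr)
  assume "\<not> ?thesis"
  then have "emeasure mass Y < emeasure mass (time_one -` Y)" by simp
  then obtain K where K: "compact K" "K \<subseteq> time_one -` Y" "0 \<notin> K" "emeasure mass Y < emeasure mass K"
    using emeasure_mass_inner_compact vimage_time_one_sets[OF Y] by metis
  obtain r where r: "r > 0" "ennreal (1 + r) * emeasure mass K \<le> emeasure mass (time_one ` K)"
    using emeasure_mass_le_time_one K by blast
  have "emeasure mass K \<le> ennreal (1 + r) * emeasure mass K"
    using r(1) mult_right_mono[of 1 "ennreal (1 + r)" "emeasure mass K"] by simp
  also have "\<dots> \<le> emeasure mass (time_one ` K)" by fact
  also have "\<dots> \<le> emeasure mass Y" using K Y by (intro emeasure_mono) auto
  finally show False using K(4) by simp
qed

text \<open>The gain depends on the compact set, so approximating the preimage from inside would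
  lose strictness. Instead one compact part \<open>K\<close> of positive mass is fixed: the full
  preimage of its image gains strictly, and the rest of \<open>Y\<close> obeys the weak
  inequality.\<close>

lemma emeasure_mass_vimage_less:
  assumes Y: "Y \<in> sets borel" "emeasure mass Y < \<infinity>" "0 < emeasure mass Y"
  shows "emeasure mass (time_one -` Y) < emeasure mass Y"
proof (cases "emeasure mass (time_one -` Y) = 0")
  case True
  with Y show ?thesis by simp
next
  case False
  then have "0 < emeasure mass (time_one -` Y)" by (simp add: zero_less_iff_neq_zero)
  then obtain K where K: "compact K" "K \<subseteq> time_one -` Y" "0 \<notin> K" "0 < emeasure mass K"
    using emeasure_mass_inner_compact vimage_time_one_sets[OF Y(1)] by metis
  define K' where "K' = time_one -` time_one ` K"
  have TK: "compact (time_one ` K)" "time_one ` K \<subseteq> Y" "time_one ` K \<in> sets borel"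
    using K compact_time_one_image[OF K(1)] by (auto simp: borel_closed compact_imp_closed)
  have "closed K'"
    unfolding K'_def using TK by (intro closed_vimage continuous_time_one compact_imp_closed)
  \<comment> \<open>The lower growth bound makes the time-one map proper.\<close>
  moreover have "bounded K'"
  proof -
    obtain B where B: "\<And>z. z \<in> time_one ` K \<Longrightarrow> norm z \<le> B"
      using compact_imp_bounded[OF TK(1)] unfolding bounded_iff by blast
    have "norm x \<le> B * exp C" if "x \<in> K'" for x
      using flow_bounds(2)[of 1 x] B[of "time_one x"] that
      by (auto simp: K'_def time_one_def exp_minus field_simps intro: order_trans)
    then show ?thesis unfolding bounded_iff by blast
  qed
  ultimately have K': "compact K'" by (simp add: compact_eq_bounded_closed)
  have "time_one k \<noteq> 0" if "k \<in> K" for k using that K(3) by (auto simp: time_one_eq_0)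
  moreover have "time_one 0 = 0" by (simp add: time_one_eq_0)
  ultimately have "0 \<notin> K'" unfolding K'_def by auto
  obtain r where r: "r > 0" "ennreal (1 + r) * emeasure mass K' \<le> emeasure mass (time_one ` K')"
    using emeasure_mass_le_time_one K' \<open>0 \<notin> K'\<close> by blast
  have K'_sets: "K' \<in> sets borel" using K' by (simp add: borel_closed compact_imp_closed)
  have img: "time_one ` K' = time_one ` K" by (auto simp: K'_def)
  have fin: "emeasure mass K' < \<infinity>" using emeasure_mass_compact K' \<open>0 \<notin> K'\<close> by simp
  have "0 < emeasure mass K'"
    using K(4) emeasure_mono[of K K' mass] K'_sets by (auto simp: K'_def intro: less_le_trans)
  then have "emeasure mass K' < ennreal (1 + r) * emeasure mass K'"
  proof -
    obtain m where m: "emeasure mass K' = ennreal m" "0 \<le> m"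
      using fin by (cases "emeasure mass K'") auto
    then have "0 < m" using \<open>0 < emeasure mass K'\<close> by simp
    then show ?thesis using r(1) by (simp add: m(1) ennreal_mult'[symmetric] ennreal_lessI del: ennreal_plus)
  qed
  also have "\<dots> \<le> emeasure mass (time_one ` K)" using r(2) img by simp
  finally have less: "emeasure mass K' < emeasure mass (time_one ` K)" .
  have diff: "Y - time_one ` K \<in> sets borel" using Y TK by auto
  have fin': "emeasure mass (Y - time_one ` K) < \<infinity>"
    using Y emeasure_mono[of "Y - time_one ` K" Y mass] by (auto intro: le_less_trans)
  \<comment> \<open>\<open>K'\<close> is the entire preimage of the image of \<open>K\<close>, so
    the preimage of \<open>Y\<close> splits along the splitting of \<open>Y\<close>.\<close>
  have "time_one -` Y = K' \<union> time_one -` (Y - time_one ` K)" using TK(2) by (auto simp: K'_def)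
  then have "emeasure mass (time_one -` Y) \<le> emeasure mass K' + emeasure mass (time_one -` (Y - time_one ` K))"
    using K'_sets vimage_time_one_sets[OF diff] by (simp add: emeasure_subadditive)
  also have "\<dots> \<le> emeasure mass K' + emeasure mass (Y - time_one ` K)"
    by (intro add_left_mono emeasure_mass_vimage_le diff)
  also have "\<dots> < emeasure mass (time_one ` K) + emeasure mass (Y - time_one ` K)"
    using less fin' by (simp add: ennreal_add_left_cancel_less add.commute)
  also have "\<dots> = emeasure mass (time_one ` K \<union> (Y - time_one ` K))"
    using TK diff by (intro plus_emeasure) auto
  also have "time_one ` K \<union> (Y - time_one ` K) = Y" using TK by auto
  finally show ?thesis .
qed

text \<open>The outside of every ball about 0 has finite mass, so almost every orbit visits it only
  finitely often at integer times. Countably many balls suffice, and the growth bound covers the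
  times in between.\<close>

lemma AE_flow_tendsto_0:
  assumes fin: "emeasure mass {x. 1 \<le> norm x} < \<infinity>"
  shows "AE x in lborel. (flow x \<longlongrightarrow> 0) at_top"
proof -
  define P where "P j = {x :: real ^ 'n. 1 / real (Suc j) \<le> norm x}" for j
  define Z where "Z j = {x. \<exists>\<^sub>\<infinity>n. (time_one ^^ n) x \<in> P j}" for j
  have P_sets: "P j \<in> sets borel" for j
    unfolding P_def by (intro borel_closed closed_Collect_le continuous_intros)
  have P_fin: "emeasure mass (P j) < \<infinity>" for j
  proof -
    define D where "D = cball 0 1 - ball (0 :: real ^ 'n) (1 / real (Suc j))"
    have D: "compact D" "0 \<notin> D" by (auto simp: D_def compact_diff)
    have sets: "{x :: real ^ 'n. 1 \<le> norm x} \<in> sets borel"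
      by (intro borel_closed closed_Collect_le continuous_intros)
    have "emeasure mass (P j) \<le> emeasure mass ({x. 1 \<le> norm x} \<union> D)"
      using D sets by (intro emeasure_mono) (auto simp: P_def D_def borel_closed compact_imp_closed)
    also have "\<dots> \<le> emeasure mass {x. 1 \<le> norm x} + emeasure mass D"
      using D sets by (intro emeasure_subadditive) (auto simp: borel_closed compact_imp_closed)
    also have "\<dots> < \<infinity>" using fin emeasure_mass_compact[OF D] by simp
    finally show ?thesis .
  qed
  have "Z j \<in> null_sets mass" for j
    unfolding Z_def
  proof (rule recurrent_set_null)
    show "time_one \<in> measurable mass mass" by simp
    show "P j \<in> fmeasurable mass" using P_sets P_fin by (simp add: fmeasurable_def)
  qed (auto simp: fmeasurable_def intro!: emeasure_mass_vimage_le emeasure_mass_vimage_less)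
  \<comment> \<open>A set is null for the mass if the density vanishes almost everywhere on it. As
    \<open>\<rho>\<close> is positive off 0, such a set is Lebesgue null.\<close>
  then have "AE x in lborel. x \<in> Z j \<longrightarrow> ennreal (\<rho> x) = 0" for j
    unfolding mass_def by (subst (asm) null_sets_density_iff) auto
  then have "AE x in lborel. \<forall>j. x \<in> Z j \<longrightarrow> ennreal (\<rho> x) = 0"
    unfolding AE_all_countable by blast
  then show ?thesis
  proof eventually_elim
    case (elim x)
    show ?case
    proof (cases "x = 0")
      case True
      then have "flow x t = 0" if "0 \<le> t" for t using flow_bounds(1)[OF that, of x] by simp
      then have "\<forall>\<^sub>F t in at_top. flow x t = 0" unfolding eventually_at_top_linorder by blast
      then show ?thesis by (rule tendsto_eventually)
    next
      case False
      then have "x \<notin> Z j" for j using elim \<rho>_pos[of x] by (auto simp: ennreal_eq_0_iff)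
      then have "\<not> (\<forall>m. \<exists>n\<ge>m. 1 / real (Suc j) \<le> norm (flow x (real n)))" for j
        unfolding Z_def P_def INFM_nat_le time_one_funpow by blast
      then have ev: "\<forall>\<^sub>F n in sequentially. norm (flow x (real n)) < 1 / real (Suc j)" for j
        unfolding eventually_sequentially by (meson not_le)
      show ?thesis
        unfolding tendsto_iff
      proof safe
        fix e :: real assume "e > 0"
        \<comment> \<open>The norm grows by at most the factor \<open>exp C\<close> between
          consecutive integer times, so the tolerance there is reduced by this factor.\<close>
        then have "0 < e * exp (- C)" by simp
        then obtain j where j: "1 / real (Suc j) < e * exp (- C)" using nat_approx_posE by auto
        obtain n0 where n0: "\<And>n. n0 \<le> n \<Longrightarrow> norm (flow x (real n)) < 1 / real (Suc j)"
          using ev[of j] unfolding eventually_sequentially by blast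
        have "dist (flow x t) 0 < e" if t: "real n0 \<le> t" for t
        proof -
          define n where "n = nat \<lfloor>t\<rfloor>"
          have n: "n0 \<le> n" "real n \<le> t" "t - real n \<le> 1" using t unfolding n_def by linarith+
          have "norm (flow x t) = norm (flow (flow x (real n)) (t - real n))"
            using flow_add[of "real n" "t - real n" x] n by simp
          also have "\<dots> \<le> norm (flow x (real n)) * exp (C * (t - real n))"
            using n by (intro flow_bounds) simp
          also have "\<dots> \<le> norm (flow x (real n)) * exp C"
            using n C_pos by (intro mult_left_mono) auto
          also have "\<dots> < e * exp (- C) * exp C"
            using n0[OF n(1)] j by (intro mult_strict_right_mono) auto
          also have "\<dots> = e" by (simp add: exp_minus)
          finally show ?thesis by simp
        qed
        then show "\<forall>\<^sub>F t in at_top. dist (flow x t) 0 < e"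
          unfolding eventually_at_top_linorder by blast
      qed
    qed
  qed
qed

end

section \<open>The dual Lyapunov theorem\<close>

lemma nn_integral_absolutely_integrable:
  fixes h :: "'a::euclidean_space \<Rightarrow> 'b::euclidean_space"
  assumes "h absolutely_integrable_on S"
  shows "(\<integral>\<^sup>+x\<in>S. ennreal (norm (h x)) \<partial>lebesgue) < \<infinity>"
    and "(\<lambda>x. ennreal (norm (h x)) * indicator S x) \<in> borel_measurable lebesgue"
proof -
  have eq: "ennreal (norm (h x)) * indicator S x = ennreal (norm (indicator S x *\<^sub>R h x))" for x
    by (auto simp: indicator_def)
  have int: "integrable lebesgue (\<lambda>x. indicator S x *\<^sub>R h x)"
    using assms by (simp add: set_integrable_def)
  show "(\<integral>\<^sup>+x\<in>S. ennreal (norm (h x)) \<partial>lebesgue) < \<infinity>"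
    unfolding eq using int by (simp add: integrable_iff_bounded)
  show "(\<lambda>x. ennreal (norm (h x)) * indicator S x) \<in> borel_measurable lebesgue"
    unfolding eq
    by (rule measurable_compose[OF measurable_compose[OF borel_measurable_integrable[OF int] borel_measurable_norm] measurable_ennreal])
qed

text \<open>\<open>\<sigma>\<close> is an auxiliary weight: it keeps the speed factor positive where
  \<open>f\<close> vanishes without spoiling the finiteness of the mass at infinity.\<close>

theorem dual_lyapunov_AE_convergence:
  fixes f :: "real ^ 'n::finite \<Rightarrow> real ^ 'n" and \<rho> \<sigma> :: "real ^ 'n \<Rightarrow> real"
  assumes f: "C1_on UNIV f" "f 0 = 0"
    and \<rho>: "C1_on (- {0}) \<rho>" "\<And>x. x \<noteq> 0 \<Longrightarrow> 0 < \<rho> x"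
    and div: "\<And>x. x \<noteq> 0 \<Longrightarrow> 0 < divergence (\<lambda>y. \<rho> y *\<^sub>R f y) x"
    and int: "(\<lambda>x. (\<rho> x / norm x) *\<^sub>R f x) absolutely_integrable_on {x. 1 \<le> norm x}"
    and \<sigma>: "C1_on UNIV \<sigma>" "\<And>x. 0 < \<sigma> x"
    and int_\<sigma>: "(\<lambda>x. \<rho> x * \<sigma> x) absolutely_integrable_on {x. 1 \<le> norm x}"
  shows "AE x0 in lebesgue. (\<exists>\<xi>. trajectory f x0 \<xi>) \<and> (\<forall>\<xi>. trajectory f x0 \<xi> \<longrightarrow> (\<xi> \<longlongrightarrow> 0) at_top)"
proof -
  \<comment> \<open>A smooth substitute for the larger of \<open>\<sigma>\<close> and
    \<open>|f| / |x|\<close>; the 1 in the denominator removes the singularity at 0.\<close>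
  define \<gamma> where "\<gamma> x = sqrt (\<sigma> x * \<sigma> x + (f x \<bullet> f x) * inverse (1 + x \<bullet> x))" for x
  define g where "g x = inverse (\<gamma> x) *\<^sub>R f x" for x
  define \<rho>g where "\<rho>g x = \<rho> x * \<gamma> x" for x
  have radicand: "0 < \<sigma> x * \<sigma> x + (f x \<bullet> f x) * inverse (1 + x \<bullet> x)" for x
    using \<sigma>(2)[of x] by (intro add_pos_nonneg mult_nonneg_nonneg) (auto simp: add_nonneg_nonneg)
  then have \<gamma>_pos: "0 < \<gamma> x" for x by (simp add: \<gamma>_def)
  have \<gamma>_sq: "(\<gamma> x)\<^sup>2 = (\<sigma> x)\<^sup>2 + (norm (f x))\<^sup>2 / (1 + (norm x)\<^sup>2)" for x
    using radicand[of x] by (simp add: \<gamma>_def power2_eq_square[of "\<sigma> x"] power2_norm_eq_inner divide_inverse)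
  have C1_\<gamma>: "C1_on UNIV \<gamma>"
    unfolding \<gamma>_def using radicand
    by (intro C1_on_sqrt C1_on_add C1_on_mult C1_on_inner C1_on_inverse C1_on_const
        C1_on_bounded_linear bounded_linear_ident \<sigma> f)
       (auto simp: add_nonneg_eq_0_iff)
  have C1_g: "C1_on UNIV g"
    unfolding g_def using \<gamma>_pos
    by (intro C1_on_scaleR C1_on_inverse C1_\<gamma> f) (auto simp: less_imp_neq[THEN not_sym])
  have C1_\<rho>g: "C1_on (- {0}) \<rho>g"
    unfolding \<rho>g_def by (intro C1_on_mult \<rho> C1_on_subset[OF C1_\<gamma>]) auto
  have \<sigma>_le: "\<sigma> x \<le> \<gamma> x" for x
    by (rule power2_le_imp_le) (use \<gamma>_pos[of x] in \<open>auto simp: \<gamma>_sq less_imp_le add_nonneg_nonneg\<close>)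
  have g_sq: "norm (g x) \<le> sqrt (1 + (norm x)\<^sup>2)" for x
  proof -
    have p: "0 < 1 + (norm x)\<^sup>2" by (simp add: add_pos_nonneg)
    have "(norm (f x))\<^sup>2 / (1 + (norm x)\<^sup>2) \<le> (\<gamma> x)\<^sup>2" by (simp add: \<gamma>_sq)
    then have "(norm (f x))\<^sup>2 \<le> (\<gamma> x * sqrt (1 + (norm x)\<^sup>2))\<^sup>2"
      using p by (simp add: power_mult_distrib divide_le_eq less_imp_le)
    then have "norm (f x) \<le> \<gamma> x * sqrt (1 + (norm x)\<^sup>2)"
      by (rule power2_le_imp_le) (use \<gamma>_pos[of x] p in simp)
    then show ?thesis using \<gamma>_pos[of x] by (simp add: g_def field_simps)
  qed
  obtain L where L: "L-lipschitz_on (cball 0 1) f"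
    using C1_on_lipschitz[OF C1_on_subset[OF f(1) subset_UNIV]] by (metis compact_cball convex_cball)
  have "continuous_on (cball 0 1) \<sigma>" using C1_on_continuous_on[OF \<sigma>(1)] by (rule continuous_on_subset) simp
  then obtain z where z: "\<forall>x\<in>cball 0 1. \<sigma> z \<le> \<sigma> x"
    using continuous_attains_inf[of "cball 0 1" \<sigma>] by (metis cball_eq_empty compact_cball not_one_less_zero)
  \<comment> \<open>In the unit ball \<open>f\<close> is Lipschitz with \<open>f 0 = 0\<close> and
    \<open>\<gamma>\<close> is at least the minimum \<open>\<sigma> z\<close>; outside it
    \<open>sqrt (1 + |x|^2) \<le> 2 |x|\<close>.\<close>
  define C where "C = max 2 (L / \<sigma> z)"
  have growth: "norm (g x) \<le> C * norm x" for x
  proof (cases "norm x \<le> 1")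
    case True
    have "norm (f x) \<le> L * norm x" using lipschitz_onD[OF L, of x 0] True f(2) by simp
    moreover have "\<sigma> z \<le> \<gamma> x" using z \<sigma>_le[of x] True by (meson mem_cball_0 order_trans)
    ultimately have "norm (f x) / \<gamma> x \<le> L * norm x / \<sigma> z"
      using \<sigma>(2)[of z] by (intro frac_le) (auto intro: order_trans[OF norm_ge_zero])
    also have "\<dots> \<le> C * norm x" by (simp add: C_def mult_right_mono flip: times_divide_eq_left)
    finally show ?thesis using \<gamma>_pos[of x] by (simp add: g_def divide_inverse mult.commute)
  next
    case False
    then have "1 \<le> (norm x)\<^sup>2" by (simp add: one_le_power)
    then have "1 + (norm x)\<^sup>2 \<le> (2 * norm x)\<^sup>2" by (simp add: power_mult_distrib)
    then have "sqrt (1 + (norm x)\<^sup>2) \<le> 2 * norm x" by (rule real_le_lsqrt[rotated]) simp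
    also have "\<dots> \<le> C * norm x" by (intro mult_right_mono) (auto simp: C_def)
    finally show ?thesis using g_sq[of x] by linarith
  qed
  have \<rho>g_g: "(\<lambda>y. \<rho>g y *\<^sub>R g y) = (\<lambda>y. \<rho> y *\<^sub>R f y)"
    using \<gamma>_pos by (simp add: \<rho>g_def g_def fun_eq_iff less_imp_neq[THEN not_sym])
  interpret expanding_density g C \<rho>g
  proof
    show "0 < C" by (simp add: C_def)
    fix x :: "real ^ 'n" assume x: "x \<noteq> 0"
    show "0 < \<rho>g x" using \<rho>(2)[OF x] \<gamma>_pos by (simp add: \<rho>g_def)
    have "divergence (\<lambda>y. \<rho>g y *\<^sub>R g y) x = frechet_derivative \<rho>g (at x) (g x) + \<rho>g x * trace (matrix (frechet_derivative g (at x)))"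
      using x by (intro divergence_scaleR C1_on_has_derivative[OF C1_g] C1_on_has_derivative[OF C1_\<rho>g]) auto
    then show "0 < frechet_derivative \<rho>g (at x) (g x) + \<rho>g x * trace (matrix (frechet_derivative g (at x)))"
      using div[OF x] by (simp add: \<rho>g_g)
  qed (fact C1_g growth C1_\<rho>g)+
  have "emeasure mass {x. 1 \<le> norm x} < \<infinity>"
  proof -
    let ?S = "{x :: real ^ 'n. 1 \<le> norm x}"
    have S: "?S \<in> sets borel" by (intro borel_closed closed_Collect_le continuous_intros)
    \<comment> \<open>Both terms on the right are integrable at infinity by assumption, which bounds
      the mass there.\<close>
    have bound: "\<rho>g x \<le> norm (\<rho> x * \<sigma> x) + norm ((\<rho> x / norm x) *\<^sub>R f x)" if "1 \<le> norm x" for x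
    proof -
      have "x \<noteq> 0" using that by auto
      then have x: "0 < norm x" "0 < \<rho> x" using \<rho>(2) by auto
      have "(norm (f x))\<^sup>2 / (1 + (norm x)\<^sup>2) \<le> (norm (f x))\<^sup>2 / (norm x)\<^sup>2"
        using x by (intro divide_left_mono) (auto simp: add_pos_pos)
      then have "(\<gamma> x)\<^sup>2 \<le> (\<sigma> x)\<^sup>2 + (norm (f x) / norm x)\<^sup>2" by (simp add: \<gamma>_sq power_divide)
      also have "\<dots> \<le> (\<sigma> x + norm (f x) / norm x)\<^sup>2"
        using \<sigma>(2)[of x] by (simp add: power2_sum)
      finally have "\<gamma> x \<le> \<sigma> x + norm (f x) / norm x"
        by (rule power2_le_imp_le) (use \<sigma>(2)[of x] in \<open>simp add: add_nonneg_nonneg less_imp_le\<close>)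
      then have "\<rho> x * \<gamma> x \<le> \<rho> x * (\<sigma> x + norm (f x) / norm x)" using x by (intro mult_left_mono) auto
      then show ?thesis using x \<sigma>(2)[of x] by (simp add: \<rho>g_def distrib_left abs_mult)
    qed
    have "emeasure mass ?S = (\<integral>\<^sup>+x\<in>?S. ennreal (\<rho>g x) \<partial>lebesgue)"
      by (simp add: emeasure_mass[OF S] nn_integral_completion)
    also have "\<dots> \<le> (\<integral>\<^sup>+x. ennreal (norm (\<rho> x * \<sigma> x)) * indicator ?S x
        + ennreal (norm ((\<rho> x / norm x) *\<^sub>R f x)) * indicator ?S x \<partial>lebesgue)"
      using bound by (intro nn_integral_mono) (auto simp: indicator_def simp flip: ennreal_plus intro!: ennreal_leI)
    also have "\<dots> = (\<integral>\<^sup>+x\<in>?S. ennreal (norm (\<rho> x * \<sigma> x)) \<partial>lebesgue)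
        + (\<integral>\<^sup>+x\<in>?S. ennreal (norm ((\<rho> x / norm x) *\<^sub>R f x)) \<partial>lebesgue)"
      by (intro nn_integral_add nn_integral_absolutely_integrable int int_\<sigma>)
    also have "\<dots> < \<infinity>"
      using nn_integral_absolutely_integrable(1)[OF int] nn_integral_absolutely_integrable(1)[OF int_\<sigma>] by simp
    finally show ?thesis .
  qed
  then have "AE x in lborel. (flow x \<longlongrightarrow> 0) at_top" by (rule AE_flow_tendsto_0)
  then have "AE x in lebesgue. (flow x \<longlongrightarrow> 0) at_top" by (rule AE_completion)
  then show ?thesis
  proof eventually_elim
    case (elim x0)
    \<comment> \<open>Undoing the change of speed produces one global convergent trajectory of
      \<open>f\<close>; by uniqueness every other one agrees with it on nonnegative times.\<close>
    have "continuous_on UNIV \<gamma>" by (rule C1_on_continuous_on[OF C1_\<gamma>])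
    moreover have "(flow x0 has_vector_derivative (1 / \<gamma> (flow x0 t)) *\<^sub>R f (flow x0 t)) (at t within {0..})" if "0 \<le> t" for t
      using flow_derivative[OF that, of x0] by (simp add: g_def divide_inverse)
    ultimately obtain x where x: "x 0 = flow x0 0"
      "\<And>t. 0 \<le> t \<Longrightarrow> (x has_vector_derivative f (x t)) (at t within {0..})" "(x \<longlongrightarrow> 0) at_top"
      by (rule time_change[of \<gamma> "flow x0" f, OF _ \<gamma>_pos _ elim]) (assumption, rule that)
    have lip: "\<exists>L. L-lipschitz_on (cball 0 R) f" for R
      using C1_on_lipschitz[OF C1_on_subset[OF f(1) subset_UNIV]] by (metis compact_cball convex_cball)
    show ?case
    proof (intro conjI exI allI impI)
      show "trajectory f x0 x" using x by (simp add: trajectory_def)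
      fix \<xi> assume "trajectory f x0 \<xi>"
      then have "x t = \<xi> t" if "0 \<le> t" for t
        by (intro solution_unique[where f = f and x = x and y = \<xi>, OF lip x(2) _ _ that])
          (auto simp: trajectory_def x(1))
      then have "\<forall>\<^sub>F t in at_top. x t = \<xi> t" unfolding eventually_at_top_linorder by blast
      then show "(\<xi> \<longlongrightarrow> 0) at_top" by (rule Lim_transform_eventually[OF x(3)])
    qed
  qed
qed

section \<open>The data-driven certificate\<close>

lemma sum_UNIV_Plus: "(\<Sum>k\<in>UNIV. f k) = (\<Sum>i\<in>UNIV. f (Inl i)) + (\<Sum>j\<in>UNIV. f (Inr j))"
  for f :: "'i::finite + 'j::finite \<Rightarrow> 'a::comm_monoid_add"
  unfolding UNIV_Plus_UNIV[symmetric] by (subst sum.Plus) auto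

lemma vstack_nth [simp]: "vstack u v $ Inl i = u $ i" "vstack u v $ Inr j = v $ j"
  by (simp_all add: vstack_def)

lemma hstack_nth [simp]: "hstack M N $ r $ Inl i = M $ r $ i" "hstack M N $ r $ Inr j = N $ r $ j"
  by (simp_all add: hstack_def)

lemma vectorize_nth [simp]: "vectorize M $ p = M $ snd p $ fst p"
  by (simp add: vectorize_def)

lemma sub_on_nth: "sub_on \<sigma> v $ k = (if k \<in> \<sigma> then v $ k else 0)"
  by (simp add: sub_on_def)

lemma sub_on_idem [simp]: "sub_on \<sigma> (sub_on \<sigma> v) = sub_on \<sigma> v"
  by (simp add: sub_on_def vec_eq_iff)

lemma sub_on_add: "sub_on \<sigma> (x + y) = sub_on \<sigma> x + sub_on \<sigma> y" for x y :: "'a::monoid_add ^ 'k::finite"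
  by (simp add: sub_on_def vec_eq_iff)

lemma sub_on_scaleR: "sub_on \<sigma> (c *\<^sub>R x) = c *\<^sub>R sub_on \<sigma> x" for x :: "real ^ 'k::finite"
  by (simp add: sub_on_def vec_eq_iff)

lemma sub_on_compl_add: "sub_on \<sigma> x + sub_on (- \<sigma>) x = x" for x :: "'a::monoid_add ^ 'k::finite"
  by (simp add: sub_on_def vec_eq_iff)

lemma inner_sub_on: "sub_on \<sigma> x \<bullet> y = x \<bullet> sub_on \<sigma> y" for x y :: "real ^ 'k::finite"
  unfolding inner_vec_def by (rule sum.cong) (auto simp: sub_on_nth)

lemma transpose_sub_on_mult: "transpose (sub_on \<sigma> D) *v y = transpose D *v sub_on \<sigma> y"
  for D :: "real ^ 'm::finite ^ 'k::finite"
  by (auto simp: matrix_vector_mult_def transpose_def vec_eq_iff sub_on_nth intro!: sum.cong)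

lemma sub_on_matrix_mult: "sub_on \<sigma> M = sub_on \<sigma> (mat 1) ** M" for M :: "real ^ 'm::finite ^ 'k::finite"
  by (auto simp: matrix_matrix_mult_def sub_on_nth mat_def vec_eq_iff if_distrib[where f = "\<lambda>u. u * v" for v] cong: if_cong)

lemma sub_on_mat_vector: "sub_on \<sigma> (mat 1) *v y = sub_on \<sigma> y" for y :: "real ^ 'k::finite"
  by (auto simp: matrix_vector_mult_def sub_on_nth mat_def vec_eq_iff if_distrib[where f = "\<lambda>u. u * v" for v] cong: if_cong)

lemma uminus_matrix_vector_mult: "(- M) *v y = - (M *v y)" for M :: "real ^ 'm::finite ^ 'k::finite"
  by (simp add: vec_eq_iff matrix_vector_mult_def sum_negf)

text \<open>Subtracting the identity of the complementary block makes the matrix invertible on the whole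
  space and leaves the inverse of the block unchanged.\<close>

lemma inverse_on_neg_gram:
  fixes P :: "real ^ 'k::finite ^ 'm::finite"
  assumes P: "\<And>y. P *v y = P *v sub_on \<sigma> y" and inj: "\<And>y. sub_on \<sigma> y = y \<Longrightarrow> P *v y = 0 \<Longrightarrow> y = 0"
  defines "M \<equiv> - (transpose P ** P)"
  shows "sub_on \<sigma> (inverse_on \<sigma> M) = inverse_on \<sigma> M"
    and "M ** inverse_on \<sigma> M = sub_on \<sigma> (mat 1)" and "inverse_on \<sigma> M ** M = sub_on \<sigma> (mat 1)"
proof -
  define J where "J = (sub_on \<sigma> (mat 1) :: real ^ 'k ^ 'k)"
  have M_vec: "M *v y = - (transpose P *v (P *v y))" for y
    by (simp add: M_def uminus_matrix_vector_mult matrix_vector_mul_assoc)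
  have JJ: "J ** J = J" using sub_on_matrix_mult[of \<sigma> J] by (simp add: J_def)
  have MJ: "M ** J = M"
    by (rule matrix_eq[THEN iffD2]) (simp add: matrix_vector_mul_assoc[symmetric] M_vec J_def sub_on_mat_vector flip: P)
  have "transpose M = M" by (simp add: M_def transpose_def vec_eq_iff matrix_matrix_mult_def mult.commute)
  moreover have "transpose J = J" by (auto simp: J_def transpose_def vec_eq_iff sub_on_nth mat_def)
  ultimately have JM: "J ** M = M" using arg_cong[OF MJ, of transpose] by (simp add: matrix_transpose_mul)
  define M' where "M' = M - (mat 1 - J)"
  have "y = 0" if "M' *v y = 0" for y
  proof -
    \<comment> \<open>The form is minus the squared length of \<open>P *v y\<close> minus that of
      the complementary part of \<open>y\<close>, hence definite.\<close>
    have "y \<bullet> (M' *v y) = - ((P *v y) \<bullet> (P *v y)) - (y \<bullet> y - y \<bullet> sub_on \<sigma> y)"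
      by (simp add: M'_def matrix_vector_mult_diff_rdistrib M_vec J_def sub_on_mat_vector inner_diff_right
          dot_lmul_matrix[symmetric] transpose_matrix_vector inner_commute)
    moreover have "y \<bullet> y - y \<bullet> sub_on \<sigma> y = sub_on (- \<sigma>) y \<bullet> sub_on (- \<sigma>) y"
    proof -
      have "y \<bullet> y = y \<bullet> (sub_on \<sigma> y + sub_on (- \<sigma>) y)" by (simp only: sub_on_compl_add)
      then have "y \<bullet> y = y \<bullet> sub_on \<sigma> y + y \<bullet> sub_on (- \<sigma>) y" by (simp only: inner_add_right)
      then show ?thesis by (simp add: inner_sub_on[of "- \<sigma>" y])
    qed
    ultimately have "((P *v y) \<bullet> (P *v y)) + (sub_on (- \<sigma>) y \<bullet> sub_on (- \<sigma>) y) = 0" using that by simp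
    then have "P *v y = 0" "sub_on (- \<sigma>) y = 0" by (simp_all add: add_nonneg_eq_0_iff)
    then show "y = 0" using inj[of y] sub_on_compl_add[of \<sigma> y] by simp
  qed
  then have "inj ((*v) M')"
    by (intro injI) (metis eq_iff_diff_eq_0 matrix_vector_mult_diff_distrib)
  then obtain B where B: "B ** M' = mat 1" using matrix_left_invertible_injective by blast
  then have B': "M' ** B = mat 1" by (simp add: matrix_left_right_inverse)
  have "M *v (J *v x) = M *v x" "J *v (J *v x) = J *v x" "J *v (M *v x) = M *v x" for x
    by (simp_all only: matrix_vector_mul_assoc MJ JJ JM)
  \<comment> \<open>On the block \<open>M'\<close> coincides with \<open>M\<close>, so
    \<open>B\<close> inverts \<open>M\<close> up to the block identity \<open>J\<close>. The product
    \<open>J ** B\<close> then also vanishes outside the block.\<close>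
  then have "M' ** J = M" "J ** M' = M"
    unfolding matrix_eq M'_def matrix_vector_mul_assoc[symmetric]
    by (simp_all add: matrix_vector_mult_diff_rdistrib matrix_vector_mult_diff_distrib)
  then have BM: "B ** M = J" and MB: "M ** B = J"
    using B B' by (metis matrix_mul_assoc matrix_mul_lid, metis matrix_mul_assoc matrix_mul_rid)
  have "sub_on \<sigma> (J ** B) = J ** B"
    using sub_on_matrix_mult[of \<sigma> "J ** B"] JJ by (simp add: J_def[symmetric] matrix_mul_assoc)
  moreover have "M ** (J ** B) = J" "(J ** B) ** M = J"
    using BM MB MJ JJ by (simp add: matrix_mul_assoc, simp add: matrix_mul_assoc[symmetric])
  ultimately have "\<exists>X. sub_on \<sigma> X = X \<and> M ** X = sub_on \<sigma> (mat 1) \<and> X ** M = sub_on \<sigma> (mat 1)"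
    unfolding J_def by blast
  from someI_ex[OF this] show "sub_on \<sigma> (inverse_on \<sigma> M) = inverse_on \<sigma> M"
    "M ** inverse_on \<sigma> M = sub_on \<sigma> (mat 1)" "inverse_on \<sigma> M ** M = sub_on \<sigma> (mat 1)"
    unfolding inverse_on_def by blast+
qed

section \<open>Positivity over the data-consistent ellipsoid\<close>

lemma SOS_on_quadratic_form_nonneg:
  assumes "SOS_on J Q"
  shows "0 \<le> (\<Sum>i\<in>J. \<Sum>j\<in>J. q i * q j * Q x $ i $ j)"
proof -
  obtain p :: nat and Qh where Q: "\<And>i j. i \<in> J \<Longrightarrow> j \<in> J \<Longrightarrow> Q x $ i $ j = (\<Sum>k<p. Qh k i x * Qh k j x)"
    using assms unfolding SOS_on_def by blast
  have "(\<Sum>i\<in>J. \<Sum>j\<in>J. q i * q j * Q x $ i $ j) = (\<Sum>i\<in>J. \<Sum>j\<in>J. \<Sum>k<p. (q i * Qh k i x) * (q j * Qh k j x))"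
    by (intro sum.cong refl) (simp add: Q sum_distrib_left mult_ac)
  also have "\<dots> = (\<Sum>i\<in>J. \<Sum>k<p. \<Sum>j\<in>J. (q i * Qh k i x) * (q j * Qh k j x))"
    by (intro sum.cong refl sum.swap)
  also have "\<dots> = (\<Sum>k<p. \<Sum>i\<in>J. \<Sum>j\<in>J. (q i * Qh k i x) * (q j * Qh k j x))"
    by (rule sum.swap)
  also have "\<dots> = (\<Sum>k<p. (\<Sum>i\<in>J. q i * Qh k i x)\<^sup>2)"
    by (simp add: power2_eq_square sum_product)
  also have "0 \<le> \<dots>" by (intro sum_nonneg) simp
  finally show ?thesis .
qed

text \<open>Here \<open>\<tau>\<close> is the value of an affine functional at the centre of an
  ellipsoid, \<open>\<rho>\<close> its change along a deviation, and
  \<open>\<pi> \<le> \<nu>\<close> says that the deviation stays in the ellipsoid. Testing the form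
  at \<open>a = sqrt \<nu>\<close>, \<open>t = 1\<close> and replacing \<open>\<pi>\<close> by
  \<open>\<nu>\<close> gives \<open>\<tau> + \<rho> \<ge> \<beta> / 2\<close>; if
  \<open>\<nu> = 0\<close>, the deviation contributes nothing.\<close>

lemma s_lemma_scalar:
  fixes \<nu> \<tau> \<beta> \<rho> \<pi> :: real
  assumes form: "\<And>a t. 0 \<le> a\<^sup>2 * (\<tau> - \<beta>) + 2 * a * (sqrt \<nu> * (t * \<rho>)) + t\<^sup>2 * (\<tau> * \<pi>)"
    and \<pi>: "\<pi> \<le> \<nu>" "0 \<le> \<pi>" and zero: "\<pi> = 0 \<Longrightarrow> \<rho> = 0" and \<beta>: "0 < \<beta>"
  shows "0 < \<tau> + \<rho>"
proof -
  have \<tau>: "\<beta> \<le> \<tau>" using form[of 1 0] by simp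
  show ?thesis
  proof (cases "\<nu> = 0")
    case True
    then show ?thesis using \<pi> zero \<tau> \<beta> by simp
  next
    case False
    then have \<nu>: "0 < \<nu>" using \<pi> by simp
    have sq: "sqrt \<nu> * sqrt \<nu> = \<nu>" using \<nu> by simp
    have "2 * sqrt \<nu> * (sqrt \<nu> * (1 * \<rho>)) = 2 * (sqrt \<nu> * sqrt \<nu>) * \<rho>" by (simp only: mult_ac mult_1)
    then have "0 \<le> \<nu> * (\<tau> - \<beta>) + 2 * \<nu> * \<rho> + \<tau> * \<pi>"
      using form[of "sqrt \<nu>" 1] \<nu> unfolding sq by (simp only: real_sqrt_pow2 less_imp_le) simp
    also have "\<tau> * \<pi> \<le> \<tau> * \<nu>" using \<pi> \<tau> \<beta> by (intro mult_left_mono) auto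
    finally have "0 \<le> \<nu> * (2 * \<tau> - \<beta> + 2 * \<rho>)" by (simp add: algebra_simps)
    then have "0 \<le> 2 * \<tau> - \<beta> + 2 * \<rho>" using \<nu> by (simp add: zero_le_mult_iff)
    then show ?thesis using \<beta> by linarith
  qed
qed

context
  notes [simp del] = transpose_matrix_vector
begin

lemma noise_matrix_mult: "noise_matrix \<phi> *v p = vstack (\<chi> i. \<phi> * p $ Inl i) (\<chi> j. - p $ Inr j)"
  for p :: "real ^ (1 + 'm::finite)"
  unfolding vec_eq_iff
proof
  fix r :: "1 + 'm"
  show "(noise_matrix \<phi> *v p) $ r = vstack (\<chi> i. \<phi> * p $ Inl i) (\<chi> j. - p $ Inr j) $ r"
  proof (cases r)
    case (Inl a)
    then have r: "r = Inl 1" by (simp add: num1_eq_iff)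
    show ?thesis
      by (simp add: r noise_matrix_def matrix_vector_mult_def sum_UNIV_Plus mat_def)
  next
    case (Inr j)
    show ?thesis
      by (simp add: Inr noise_matrix_def matrix_vector_mult_def sum_UNIV_Plus mat_def
          if_distrib[where f = "\<lambda>u. u * v" for v] if_distrib[where f = uminus] cong: if_cong)
  qed
qed

lemma noise_bound_iff: "noise_bound \<phi> W \<longleftrightarrow> (norm (vectorize (transpose W)))\<^sup>2 \<le> \<phi>"
  by (simp add: noise_bound_def Let_def noise_matrix_mult inner_vec_def[of "vstack _ _"] sum_UNIV_Plus
      power2_norm_eq_inner inner_vec_def[of "vectorize _"] sum_negf)

text \<open>\<open>z\<close> is what the known coefficients leave unexplained and \<open>P\<close>
  maps the unknown ones to data. The minus sign of the noise block cancels that of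
  \<open>- P\<close> off the diagonal, and \<open>N22\<close> becomes a negated Gram matrix.\<close>

lemma data_N_blocks:
  fixes Xd :: "real ^ 't::finite ^ 'n::finite" and Fd :: "real ^ 't ^ 'f::finite" and Gd :: "real ^ 't ^ 'g::finite"
  defines "z s v \<equiv> vectorize (transpose Xd) - transpose (sub_on s (data_kron Fd Gd)) *v sub_on s v"
    and "P s \<equiv> transpose (sub_on (- s) (data_kron Fd Gd))"
  shows "blk11 (data_N \<phi> Xd Fd Gd s v) = \<phi> - z s v \<bullet> z s v"
    and "blk12 (data_N \<phi> Xd Fd Gd s v) = transpose (P s) *v z s v"
    and "blk21 (data_N \<phi> Xd Fd Gd s v) = transpose (P s) *v z s v"
    and "blk22 (data_N \<phi> Xd Fd Gd s v) = - (transpose (P s) ** P s)"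
proof -
  define E where "E = vstack (hstack (mat 1 :: real ^ 1 ^ 1) 0) (hstack (columnvector (z s v)) (- P s))"
  have N: "data_N \<phi> Xd Fd Gd s v = transpose E ** (noise_matrix \<phi> ** E)"
    by (simp add: data_N_def Let_def E_def z_def P_def matrix_mul_assoc)
  have \<Phi>E: "(noise_matrix \<phi> ** E) $ r $ c = (case r of Inl i \<Rightarrow> \<phi> * E $ r $ c | Inr j \<Rightarrow> - (E $ r $ c))" for r c
  proof -
    have "(noise_matrix \<phi> ** E) $ r $ c = (noise_matrix \<phi> *v column c E) $ r"
      by (simp add: matrix_matrix_mult_def matrix_vector_mult_def column_def)
    then show ?thesis by (cases r) (simp_all add: noise_matrix_mult column_def)
  qed
  have entry: "data_N \<phi> Xd Fd Gd s v $ c $ c' = \<phi> * (E $ Inl 1 $ c * E $ Inl 1 $ c') - (\<Sum>j\<in>UNIV. E $ Inr j $ c * E $ Inr j $ c')" for c c'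
    unfolding N matrix_matrix_mult_def[of "transpose E"]
    by (simp add: \<Phi>E sum_UNIV_Plus transpose_def sum_negf mult_ac)
  show "blk11 (data_N \<phi> Xd Fd Gd s v) = \<phi> - z s v \<bullet> z s v"
    by (simp add: blk11_def entry) (simp add: E_def mat_def columnvector_def inner_vec_def)
  show "blk12 (data_N \<phi> Xd Fd Gd s v) = transpose (P s) *v z s v"
    by (simp add: blk12_def entry vec_eq_iff)
       (simp add: E_def mat_def columnvector_def matrix_vector_mult_def transpose_def sum_negf mult.commute)
  show "blk21 (data_N \<phi> Xd Fd Gd s v) = transpose (P s) *v z s v"
    by (simp add: blk21_def entry vec_eq_iff)
       (simp add: E_def mat_def columnvector_def matrix_vector_mult_def transpose_def sum_negf mult.commute)
  show "blk22 (data_N \<phi> Xd Fd Gd s v) = - (transpose (P s) ** P s)"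
    by (simp add: blk22_def entry vec_eq_iff)
       (simp add: E_def matrix_matrix_mult_def transpose_def)
qed

lemma transpose_data_kron_mult:
  "(transpose (data_kron Fd Gd) *v y) $ (i, k)
     = (\<Sum>j\<in>UNIV. Fd $ j $ k * y $ Inl (i, j)) + (\<Sum>j\<in>UNIV. Gd $ j $ k * y $ Inr (i, j))"
  for Fd :: "real ^ 't::finite ^ 'f::finite" and Gd :: "real ^ 't ^ 'g::finite" and y :: "real ^ ('n::finite \<times> 'f + 'n \<times> 'g)"
proof -
  have block: "(\<Sum>p\<in>UNIV. kronecker (mat 1) H $ p $ (i, k) * h p) = (\<Sum>j\<in>UNIV. H $ j $ k * h (i, j))"
    for H :: "real ^ 't ^ 'r::finite" and h :: "'n \<times> 'r \<Rightarrow> real"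
  proof -
    have "(\<Sum>p\<in>UNIV. kronecker (mat 1) H $ p $ (i, k) * h p)
        = (\<Sum>i'\<in>UNIV. \<Sum>j\<in>UNIV. if i' = i then H $ j $ k * h (i, j) else 0)"
      unfolding UNIV_Times_UNIV[symmetric] sum.cartesian_product
      by (intro sum.cong) (auto simp: kronecker_def mat_def)
    also have "\<dots> = (\<Sum>j\<in>UNIV. H $ j $ k * h (i, j))"
      by (subst sum.swap) simp
    finally show ?thesis .
  qed
  show ?thesis
    by (simp add: matrix_vector_mult_def transpose_def sum_UNIV_Plus data_kron_def block)
qed

text \<open>Turns the data equation into a linear equation for the stacked coefficients.\<close>

lemma transpose_data_kron_coeff_vec:
  "transpose (data_kron Fd Gd) *v coeff_vec A B = vectorize (transpose (A ** Fd + B ** Gd))"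
  for A :: "real ^ 'f::finite ^ 'n::finite" and B :: "real ^ 'g::finite ^ 'n" and Fd :: "real ^ 't::finite ^ 'f"
  by (simp add: vec_eq_iff transpose_data_kron_mult split_paired_all)
     (simp add: coeff_vec_def transpose_def matrix_matrix_mult_def mult.commute)

text \<open>The map decouples over the rows \<open>i\<close> of the coefficient matrices, and on
  each of them it is the transposed data matrix, injective by full row rank.\<close>

lemma transpose_data_kron_injective:
  fixes Fd :: "real ^ 't::finite ^ 'f::finite" and Gd :: "real ^ 't ^ 'g::finite"
    and y :: "real ^ ('n::finite \<times> 'f + 'n \<times> 'g)"
  assumes rank: "rank (vstack Fd Gd) = CARD('f + 'g)" and y: "transpose (data_kron Fd Gd) *v y = 0"
  shows "y = 0"
proof -
  have inj: "inj ((*v) (transpose (vstack Fd Gd)))"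
    using rank by (simp add: full_rank_injective[symmetric] rank_transpose)
  have "vstack (\<chi> j. y $ Inl (i, j)) (\<chi> j. y $ Inr (i, j)) = 0" for i
  proof -
    have "transpose (vstack Fd Gd) *v vstack (\<chi> j. y $ Inl (i, j)) (\<chi> j. y $ Inr (i, j)) = 0"
      unfolding vec_eq_iff
    proof
      fix k
      have "(transpose (data_kron Fd Gd) *v y) $ (i, k) = 0" by (simp add: y)
      then show "(transpose (vstack Fd Gd) *v vstack (\<chi> j. y $ Inl (i, j)) (\<chi> j. y $ Inr (i, j))) $ k = 0 $ k"
        by (simp add: transpose_data_kron_mult) (simp add: matrix_vector_mult_def transpose_def sum_UNIV_Plus)
    qed
    then show ?thesis using inj by (metis inj_eq matrix_vector_mult_0_right)
  qed
  note zero = this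
  have "y $ Inl (i, j) = 0" for i j using arg_cong[OF zero[of i], of "\<lambda>u. u $ Inl j"] by simp
  moreover have "y $ Inr (i, j) = 0" for i j using arg_cong[OF zero[of i], of "\<lambda>u. u $ Inr j"] by simp
  ultimately have "y $ q = 0" for q by (cases q) auto
  then show ?thesis by (simp add: vec_eq_iff)
qed

text \<open>The certificate evaluated at the test vector \<open>(a, u)\<close>. It is a sum of
  squares only on the unknown indices; \<open>u\<close> is supported there.\<close>

lemma certificate_form:
  fixes x :: "real ^ 'n::finite" and N :: "real ^ (1 + 'k::finite) ^ (1 + 'k)"
  assumes "SOS_on (UNIV <+> - s) (\<lambda>y. certificate N s v (r y) (\<beta> y))" and u: "sub_on (- s) u = u"
  defines "h \<equiv> sub_on (- s) (r x) \<bullet> (inverse_on (- s) (blk22 N) *v blk21 N)" and "k \<equiv> sub_on s (r x) \<bullet> sub_on s v"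
  shows "0 \<le> a\<^sup>2 * (k - h - \<beta> x) + 2 * a * (sqrt (schur_compl (- s) N) * (r x \<bullet> u)) - (k - h) * (u \<bullet> (blk22 N *v u))"
proof -
  define C where "C = certificate N s v (r x) (\<beta> x)"
  define q :: "1 + 'k \<Rightarrow> real" where "q = (\<lambda>i. case i of Inl _ \<Rightarrow> a | Inr i \<Rightarrow> u $ i)"
  have u0: "u $ i = 0" if "i \<notin> - s" for i using arg_cong[OF u, of "\<lambda>u. u $ i"] that by (simp add: sub_on_nth)
  have "0 \<le> (\<Sum>i\<in>UNIV <+> - s. \<Sum>j\<in>UNIV <+> - s. q i * q j * C $ i $ j)"
    using SOS_on_quadratic_form_nonneg[OF assms(1), of q x] by (simp add: C_def)
  also have "\<dots> = (\<Sum>i\<in>UNIV. \<Sum>j\<in>UNIV. q i * q j * C $ i $ j)"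
  proof -
    \<comment> \<open>The test vector vanishes on the padding, so the sums may range over all
      indices.\<close>
    have zero: "q i = 0" if "i \<notin> UNIV <+> - s" for i
      using that u0 by (auto simp: q_def split: sum.splits)
    have "(\<Sum>j\<in>UNIV <+> - s. q i * q j * C $ i $ j) = (\<Sum>j\<in>UNIV. q i * q j * C $ i $ j)" for i
      by (rule sum.mono_neutral_left) (use zero in auto)
    moreover have "(\<Sum>i\<in>UNIV <+> - s. \<Sum>j\<in>UNIV. q i * q j * C $ i $ j) = (\<Sum>i\<in>UNIV. \<Sum>j\<in>UNIV. q i * q j * C $ i $ j)"
      by (rule sum.mono_neutral_left) (use zero in auto)
    ultimately show ?thesis by simp
  qed
  also have "\<dots> = a\<^sup>2 * C $ Inl 1 $ Inl 1 + (\<Sum>j\<in>UNIV. a * u $ j * C $ Inl 1 $ Inr j)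
      + ((\<Sum>i\<in>UNIV. u $ i * a * C $ Inr i $ Inl 1) + (\<Sum>i\<in>UNIV. \<Sum>j\<in>UNIV. u $ i * u $ j * C $ Inr i $ Inr j))"
    by (simp add: sum_UNIV_Plus q_def sum.distrib power2_eq_square)
  also have "C $ Inl 1 $ Inl 1 = k - h - \<beta> x"
    by (simp add: C_def certificate_def Let_def mat_def h_def k_def)
  also have "(\<Sum>j\<in>UNIV. a * u $ j * C $ Inl 1 $ Inr j) = a * (sqrt (schur_compl (- s) N) * (r x \<bullet> u))"
  proof -
    have "r x \<bullet> u = sub_on (- s) (r x) \<bullet> u" by (simp add: inner_sub_on u)
    then show ?thesis
      by (simp add: C_def certificate_def Let_def rowvector_def inner_vec_def sum_distrib_left mult_ac)
  qed
  also have "(\<Sum>i\<in>UNIV. u $ i * a * C $ Inr i $ Inl 1) = a * (sqrt (schur_compl (- s) N) * (r x \<bullet> u))"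
  proof -
    have "r x \<bullet> u = sub_on (- s) (r x) \<bullet> u" by (simp add: inner_sub_on u)
    then show ?thesis
      by (simp add: C_def certificate_def Let_def columnvector_def inner_vec_def sum_distrib_left mult_ac)
  qed
  also have "(\<Sum>i\<in>UNIV. \<Sum>j\<in>UNIV. u $ i * u $ j * C $ Inr i $ Inr j) = (h - k) * (u \<bullet> (blk22 N *v u))"
  proof -
    have "C $ Inr i $ Inr j = (h - k) * blk22 N $ i $ j" for i j
      by (simp add: C_def certificate_def Let_def h_def k_def)
    then show ?thesis by (simp add: inner_vec_def matrix_vector_mult_def sum_distrib_left mult_ac)
  qed
  finally show ?thesis by (simp add: algebra_simps)
qed

text \<open>Completing the square shows that the unknown coefficients consistent with the data lie
  in the ellipsoid with centre \<open>- w\<close>, where \<open>|P *v (y' + w)|^2\<close> is at most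
  the Schur complement. On it the pairing with \<open>r x\<close> equals
  \<open>(k - h) + r x \<bullet> y\<close>, and the scalar S-lemma applies.\<close>

lemma certificate_imp_pos:
  fixes Xd :: "real ^ 't::finite ^ 'n::finite" and Fd :: "real ^ 't ^ 'f::finite" and Gd :: "real ^ 't ^ 'g::finite"
  assumes rank: "rank (vstack Fd Gd) = CARD('f + 'g)"
    and N: "N = data_N \<phi> Xd Fd Gd s v"
    and sos: "SOS_on (UNIV <+> - s) (\<lambda>y. certificate N s v (r y) (\<beta> y))"
    and AB: "(A, B) \<in> Sigma_d \<phi> Xd Fd Gd" and known: "sub_on s (coeff_vec A B) = sub_on s v"
    and \<beta>: "0 < \<beta> x"
  shows "0 < r x \<bullet> coeff_vec A B"
proof -
  define D where "D = (data_kron Fd Gd :: real ^ ('n \<times> 't) ^ _)"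
  define P where "P = transpose (sub_on (- s) D)"
  define z where "z = vectorize (transpose Xd) - transpose (sub_on s D) *v sub_on s v"
  define y' where "y' = sub_on (- s) (coeff_vec A B)"
  define X where "X = inverse_on (- s) (blk22 N)"
  define w where "w = X *v blk21 N"
  \<comment> \<open>Deviation of the unknown coefficients from the centre.\<close>
  define y where "y = y' + w"
  have P_vec: "P *v u = transpose D *v sub_on (- s) u" for u by (simp add: P_def transpose_sub_on_mult)
  have blocks: "blk11 N = \<phi> - z \<bullet> z" "blk12 N = transpose P *v z" "blk21 N = transpose P *v z" "blk22 N = - (transpose P ** P)"
    unfolding N z_def P_def D_def by (rule data_N_blocks)+
  have inj: "u = 0" if "sub_on (- s) u = u" "P *v u = 0" for u
    using transpose_data_kron_injective[OF rank, of u] that by (simp add: P_vec D_def)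
  have X: "sub_on (- s) X = X" "blk22 N ** X = sub_on (- s) (mat 1)"
    using inverse_on_neg_gram[of P "- s"] inj unfolding X_def blocks(4) by (simp_all add: P_vec)
  have PT: "sub_on (- s) (transpose P *v u) = transpose P *v u" for u
    by (simp add: P_def vec_eq_iff matrix_vector_mult_def transpose_def sub_on_nth)
  have w_supp: "sub_on (- s) w = w"
    unfolding w_def by (subst (2) X(1)[symmetric]) 
      (simp add: sub_on_matrix_mult[of _ X] matrix_vector_mul_assoc[symmetric] sub_on_mat_vector)
  have y_supp: "sub_on (- s) y = y" unfolding y_def y'_def by (simp add: sub_on_add w_supp)
  \<comment> \<open>The normal equations: \<open>- w\<close> is the least squares fit, so the
    residual \<open>z + P *v w\<close> is orthogonal to the range of \<open>P\<close>.\<close>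
  have Mw: "- (transpose P *v (P *v w)) = transpose P *v z"
  proof -
    have "- (transpose P *v (P *v w)) = blk22 N *v w"
      by (simp add: blocks(4) uminus_matrix_vector_mult matrix_vector_mul_assoc)
    also have "\<dots> = (blk22 N ** X) *v blk21 N" by (simp add: w_def matrix_vector_mul_assoc)
    also have "\<dots> = transpose P *v z" by (simp add: X(2) sub_on_mat_vector blocks(3) PT)
    finally show ?thesis .
  qed
  have adj: "u \<bullet> (transpose P *v u') = (P *v u) \<bullet> u'" for u u'
    by (simp only: transpose_matrix_vector inner_commute[of u] dot_lmul_matrix) (simp only: inner_commute)
  have zP: "(P *v u) \<bullet> z = - ((P *v u) \<bullet> (P *v w))" for u
    using arg_cong[OF Mw, of "\<lambda>t. u \<bullet> t"] by (simp add: adj)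
  obtain W where W: "Xd = A ** Fd + B ** Gd + W" "noise_bound \<phi> W"
    using AB by (auto simp: Sigma_d_def)
  have "vectorize (transpose W) = z - P *v y'"
  proof -
    have "vectorize (transpose Xd) = transpose D *v coeff_vec A B + vectorize (transpose W)"
      unfolding D_def transpose_data_kron_coeff_vec by (simp add: W(1) vec_eq_iff transpose_def)
    also have "transpose D *v coeff_vec A B = transpose D *v sub_on s (coeff_vec A B) + transpose D *v y'"
      unfolding y'_def matrix_vector_right_distrib[symmetric] sub_on_compl_add ..
    finally show ?thesis by (simp add: z_def P_vec y'_def transpose_sub_on_mult known)
  qed
  then have "(z - P *v y') \<bullet> (z - P *v y') \<le> \<phi>" using W(2) by (simp add: noise_bound_iff power2_norm_eq_inner)
  \<comment> \<open>By that orthogonality the Schur complement is the noise budget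
    \<open>\<phi>\<close> minus the squared least squares residual.\<close>
  moreover have \<nu>: "schur_compl (- s) N = \<phi> - z \<bullet> z + (P *v w) \<bullet> (P *v w)"
  proof -
    have "blk12 N \<bullet> w = w \<bullet> (transpose P *v z)" by (simp add: blocks inner_commute)
    also have "\<dots> = - ((P *v w) \<bullet> (P *v w))" by (simp add: adj zP)
    finally show ?thesis by (simp add: schur_compl_def blocks(1) X_def[symmetric] w_def[symmetric])
  qed
  ultimately have Py: "(P *v y) \<bullet> (P *v y) \<le> schur_compl (- s) N"
    using zP[of y']
    by (simp add: y_def matrix_vector_right_distrib inner_diff_left inner_diff_right inner_add_left inner_add_right inner_commute)
  define h where "h = sub_on (- s) (r x) \<bullet> w"
  define k where "k = sub_on s (r x) \<bullet> sub_on s v"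
  have "0 < (k - h) + r x \<bullet> y"
  proof (rule s_lemma_scalar[OF _ Py _ _ \<beta>])
    fix a t :: real
    have supp: "sub_on (- s) (t *\<^sub>R y) = t *\<^sub>R y"
      by (simp add: sub_on_scaleR y_supp)
    have "blk22 N *v (t *\<^sub>R y) = - t *\<^sub>R (transpose P *v (P *v y))"
      by (simp add: blocks(4) uminus_matrix_vector_mult matrix_vector_mult_scaleR matrix_vector_mul_assoc)
    then have "(t *\<^sub>R y) \<bullet> (blk22 N *v (t *\<^sub>R y)) = - (t\<^sup>2 * ((P *v y) \<bullet> (P *v y)))"
      by (simp add: adj matrix_vector_mult_scaleR power2_eq_square)
    then show "0 \<le> a\<^sup>2 * (k - h - \<beta> x) + 2 * a * (sqrt (schur_compl (- s) N) * (t * (r x \<bullet> y)))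
        + t\<^sup>2 * ((k - h) * ((P *v y) \<bullet> (P *v y)))"
      using certificate_form[OF sos supp, where x = x and a = a]
      by (simp add: h_def k_def w_def X_def algebra_simps)
  next
    show "r x \<bullet> y = 0" if "(P *v y) \<bullet> (P *v y) = 0" using inj[OF y_supp] that by simp
  qed simp
  moreover have "r x \<bullet> coeff_vec A B = k + r x \<bullet> y'"
  proof -
    have "r x \<bullet> coeff_vec A B = r x \<bullet> sub_on s (coeff_vec A B) + r x \<bullet> y'"
      unfolding y'_def inner_add_right[symmetric] sub_on_compl_add ..
    then show ?thesis by (simp add: k_def inner_sub_on known)
  qed
  moreover have "r x \<bullet> y = r x \<bullet> y' + h"
    by (simp add: y_def h_def inner_add_right inner_sub_on w_supp)
  ultimately show ?thesis by simp
qed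

end

section \<open>From the certificate to the closed loop\<close>

lemma SOS_nonneg:
  assumes "SOS q"
  shows "0 \<le> q x"
  using SOS_on_quadratic_form_nonneg[of "UNIV :: 1 set" "\<lambda>x. \<chi> i j. q x" "\<lambda>_. 1" x] assms
  by (simp add: SOS_def)

lemma known_indices_agree:
  assumes "(A, B) \<in> Sigma_pk S A_true B_true"
  shows "sub_on (known_indices S) (coeff_vec A B) = sub_on (known_indices S) (coeff_vec A_true B_true)"
proof -
  have *: "hstack A B $ i $ j = hstack A_true B_true $ i $ j" if "(i, j) \<in> S" for i j
    using assms that by (auto simp: Sigma_pk_def)
  have "coeff_vec A B $ q = coeff_vec A_true B_true $ q" if "q \<in> known_indices S" for q
    using that *[of _ "Inl _"] *[of _ "Inr _"]
    by (cases q) (auto simp: known_indices_def coeff_vec_def transpose_def)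
  then show ?thesis by (simp add: sub_on_def vec_eq_iff)
qed

text \<open>Differentiating \<open>b powr - \<alpha>\<close> lowers the exponent by one; taking
  \<open>b powr (- \<alpha> - 1)\<close> out of both product rule terms leaves exactly the blocks of
  \<open>R_vec\<close>, paired with the coefficients row by row.\<close>

lemma divergence_density_closed_loop:
  fixes aF :: "real ^ 'n::finite \<Rightarrow> real ^ 'f::finite" and Gc :: "real ^ 'n \<Rightarrow> real ^ 'g::finite"
  assumes aF: "C1_on UNIV aF" and Gc: "C1_on UNIV Gc" and b: "C1_on UNIV b" and pos: "0 < b x"
  shows "divergence (\<lambda>y. (b y powr - \<alpha>) *\<^sub>R (A *v aF y + B *v Gc y)) x
    = b x powr (- \<alpha> - 1) * (R_vec \<alpha> b aF Gc x \<bullet> coeff_vec A B)"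
proof -
  define aF' where "aF' = frechet_derivative aF (at x)"
  define Gc' where "Gc' = frechet_derivative Gc (at x)"
  define b' where "b' = frechet_derivative b (at x)"
  define h where "h = A *v aF x + B *v Gc x"
  have der_b: "(b has_derivative b') (at x)" unfolding b'_def by (rule C1_on_has_derivative[OF b]) simp
  have "((\<lambda>y. A *v aF y + B *v Gc y) has_derivative (\<lambda>v. A *v aF' v + B *v Gc' v)) (at x)"
    unfolding aF'_def Gc'_def
    by (intro has_derivative_add bounded_linear.has_derivative[OF matrix_vector_mul_bounded_linear]
        C1_on_has_derivative[OF aF] C1_on_has_derivative[OF Gc]) auto
  moreover have "((\<lambda>y. b y powr - \<alpha>) has_derivative (\<lambda>v. (- \<alpha> * b x powr (- \<alpha> - 1)) * b' v)) (at x)"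
    by (rule has_derivative_compose[OF der_b has_real_derivative_powr[OF pos, unfolded has_field_derivative_def]])
  ultimately have "divergence (\<lambda>y. (b y powr - \<alpha>) *\<^sub>R (A *v aF y + B *v Gc y)) x
      = (- \<alpha> * b x powr (- \<alpha> - 1)) * b' h + b x powr - \<alpha> * trace (matrix (\<lambda>v. A *v aF' v + B *v Gc' v))"
    unfolding h_def by (rule divergence_scaleR)
  also have "b x powr - \<alpha> = b x powr (- \<alpha> - 1) * b x"
    using pos powr_add[of "b x" "- \<alpha> - 1" 1] by simp
  also have "b' h = (\<Sum>i\<in>UNIV. b' (axis i 1) * h $ i)"
  proof -
    have "b' h = b' (\<Sum>i\<in>UNIV. h $ i *\<^sub>R axis i 1)"
      using basis_expansion[of h] by (simp add: scalar_mult_eq_scaleR)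
    also have "\<dots> = (\<Sum>i\<in>UNIV. b' (axis i 1) * h $ i)"
      using has_derivative_linear[OF der_b] by (simp add: linear_sum linear_cmul mult.commute)
    finally show ?thesis .
  qed
  also have "trace (matrix (\<lambda>v. A *v aF' v + B *v Gc' v))
      = (\<Sum>i\<in>UNIV. (A *v aF' (axis i 1)) $ i + (B *v Gc' (axis i 1)) $ i)"
    by (simp add: trace_def matrix_def)
  finally have div: "divergence (\<lambda>y. (b y powr - \<alpha>) *\<^sub>R (A *v aF y + B *v Gc y)) x
      = b x powr (- \<alpha> - 1) * (\<Sum>i\<in>UNIV. b x * ((A *v aF' (axis i 1)) $ i + (B *v Gc' (axis i 1)) $ i)
          - \<alpha> * (b' (axis i 1) * h $ i))"
    by (simp add: sum_subtractf sum_negf algebra_simps sum_distrib_left)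
  have "R_vec \<alpha> b aF Gc x \<bullet> coeff_vec A B
      = (\<Sum>i\<in>UNIV. \<Sum>j\<in>UNIV. (b x * aF' (axis i 1) $ j - \<alpha> * b' (axis i 1) * aF x $ j) * A $ i $ j)
      + (\<Sum>i\<in>UNIV. \<Sum>j\<in>UNIV. (b x * Gc' (axis i 1) $ j - \<alpha> * b' (axis i 1) * Gc x $ j) * B $ i $ j)"
    by (simp add: inner_vec_def sum_UNIV_Plus R_vec_def coeff_vec_def partial_deriv_def transpose_def
        aF'_def Gc'_def b'_def sum.cartesian_product case_prod_unfold flip: UNIV_Times_UNIV)
  also have "\<dots> = (\<Sum>i\<in>UNIV. b x * ((A *v aF' (axis i 1)) $ i + (B *v Gc' (axis i 1)) $ i)
          - \<alpha> * (b' (axis i 1) * h $ i))"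
    unfolding sum.distrib[symmetric] h_def
    by (intro sum.cong refl)
       (simp add: matrix_vector_mult_def sum_subtractf sum_distrib_left algebra_simps)
  finally show ?thesis using div by simp
qed

text \<open>With one factor per coordinate and \<open>x \<bullet> x\<close> at least each squared
  coordinate, the function is dominated by a product of one-dimensional functions
  \<open>1 / (1 + t^2)\<close>, each of finite integral by the arctangent.\<close>

lemma integrable_inverse_power_norm:
  "integrable lborel (\<lambda>x :: real ^ 'n::finite. inverse ((1 + x \<bullet> x) ^ CARD('n)))"
proof (rule integrableI_bounded)
  show "(\<lambda>x :: real ^ 'n. inverse ((1 + x \<bullet> x) ^ CARD('n))) \<in> borel_measurable lborel" by measurable
  define c where "c = (\<integral>\<^sup>+t. ennreal (inverse (1 + t\<^sup>2)) \<partial>lborel)"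
  have c: "c < \<infinity>"
  proof -
    have der: "(arctan has_real_derivative inverse (1 + t\<^sup>2)) (at t)" for t
      using DERIV_arctan[of t] by simp
    have right: "(\<integral>\<^sup>+t\<in>{0..}. ennreal (inverse (1 + t\<^sup>2)) \<partial>lborel) = ennreal (pi / 2 - arctan 0)"
      by (intro nn_integral_FTC_atLeast der tendsto_arctan_at_top) auto
    have left: "(\<integral>\<^sup>+t\<in>{..0}. ennreal (inverse (1 + t\<^sup>2)) \<partial>lborel) = (\<integral>\<^sup>+t\<in>{0..}. ennreal (inverse (1 + t\<^sup>2)) \<partial>lborel)"
      using nn_integral_real_affine[of "\<lambda>t. ennreal (inverse (1 + t\<^sup>2)) * indicator {..0} t" "-1" 0]
      by (simp add: indicator_def)
    have "c \<le> (\<integral>\<^sup>+t. ennreal (inverse (1 + t\<^sup>2)) * indicator {0..} t + ennreal (inverse (1 + t\<^sup>2)) * indicator {..0} t \<partial>lborel)"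
      unfolding c_def by (intro nn_integral_mono) (auto simp: indicator_def)
    also have "\<dots> < \<infinity>"
      by (subst nn_integral_add) (auto simp: left right)
    finally show ?thesis .
  qed
  have "(\<integral>\<^sup>+x. ennreal (norm (inverse ((1 + x \<bullet> x) ^ CARD('n)))) \<partial>(lborel :: (real ^ 'n) measure))
      \<le> (\<integral>\<^sup>+x. (\<Prod>b\<in>Basis. ennreal (inverse (1 + (x \<bullet> b)\<^sup>2))) \<partial>(lborel :: (real ^ 'n) measure))"
  proof (rule nn_integral_mono)
    fix x :: "real ^ 'n"
    have "inverse ((1 + x \<bullet> x) ^ CARD('n)) = (\<Prod>b\<in>(Basis :: (real ^ 'n) set). inverse (1 + x \<bullet> x))"
      by (simp add: power_inverse)
    also have "\<dots> \<le> (\<Prod>b\<in>Basis. inverse (1 + (x \<bullet> b)\<^sup>2))"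
    proof (rule prod_mono)
      fix b :: "real ^ 'n" assume b: "b \<in> Basis"
      have "(x \<bullet> b)\<^sup>2 \<le> x \<bullet> x"
        using power_mono[OF Basis_le_norm[OF b, of x], of 2] by (simp add: power2_norm_eq_inner)
      then show "0 \<le> inverse (1 + x \<bullet> x) \<and> inverse (1 + x \<bullet> x) \<le> inverse (1 + (x \<bullet> b)\<^sup>2)"
        by (auto intro!: le_imp_inverse_le add_pos_nonneg simp: add_nonneg_nonneg)
    qed
    finally have "inverse ((1 + x \<bullet> x) ^ CARD('n)) \<le> (\<Prod>b\<in>Basis. inverse (1 + (x \<bullet> b)\<^sup>2))" .
    moreover have "0 \<le> inverse ((1 + x \<bullet> x) ^ CARD('n))" by (simp add: add_nonneg_nonneg)
    ultimately show "ennreal (norm (inverse ((1 + x \<bullet> x) ^ CARD('n)))) \<le> (\<Prod>b\<in>Basis. ennreal (inverse (1 + (x \<bullet> b)\<^sup>2)))"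
      by (subst prod_ennreal) (auto intro: ennreal_leI)
  qed
  also have "\<dots> = (\<Prod>b\<in>(Basis :: (real ^ 'n) set). c)"
    unfolding c_def by (subst nn_integral_lborel_prod) auto
  also have "\<dots> < \<infinity>" using c by (simp add: power_less_top_ennreal)
  finally show "(\<integral>\<^sup>+x. ennreal (norm (inverse ((1 + x \<bullet> x) ^ CARD('n)))) \<partial>(lborel :: (real ^ 'n) measure)) < \<infinity>" .
qed

text \<open>The weight is \<open>\<theta> * b powr \<alpha> / a\<close> outside the unit ball, so
  that it cancels the density there and leaves the integrable function
  \<open>\<theta>\<close>.\<close>

lemma exists_integrable_weight:
  fixes a b :: "real ^ 'n::finite \<Rightarrow> real"
  assumes a: "C1_on UNIV a" "\<And>x. 0 < a x" and b: "C1_on UNIV b" "\<And>x. x \<noteq> 0 \<Longrightarrow> 0 < b x"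
  obtains \<sigma> where "C1_on UNIV \<sigma>" "\<And>x. 0 < \<sigma> x"
    "(\<lambda>x. a x * b x powr - \<alpha> * \<sigma> x) absolutely_integrable_on {x. 1 \<le> norm x}"
proof -
  \<comment> \<open>The square makes the positive part continuously differentiable at 0.\<close>
  define m where "m u = (max 0 u)\<^sup>2" for u :: real
  have m_nonpos: "m u = 0" if "u \<le> 0" for u using that by (simp add: m_def max_def)
  have der_m: "(m has_real_derivative 2 * max 0 u) (at u)" for u
  proof (cases u "0 :: real" rule: linorder_cases)
      case less
      have "((\<lambda>_. 0) has_real_derivative 2 * max 0 u) (at u)" using less by simp
      then show ?thesis
        by (rule has_field_derivative_transform_within_open[of _ _ _ "{..<0}"]) (use less in \<open>auto simp: m_def max_def\<close>)
    next
      case greater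
      have "((\<lambda>u. u\<^sup>2) has_real_derivative 2 * max 0 u) (at u)"
        using greater by (auto intro!: derivative_eq_intros)
      then show ?thesis
        by (rule has_field_derivative_transform_within_open[of _ _ _ "{0<..}"]) (use greater in \<open>auto simp: m_def max_def\<close>)
    next
      case equal
      have "((\<lambda>h. (m (0 + h) - m 0) / h) \<longlongrightarrow> 0) (at 0)"
      proof (rule Lim_null_comparison)
        show "\<forall>\<^sub>F h in at 0. norm ((m (0 + h) - m 0) / h) \<le> \<bar>h\<bar>"
          by (auto simp: m_def max_def power2_eq_square)
        show "((\<lambda>h :: real. \<bar>h\<bar>) \<longlongrightarrow> 0) (at 0)" by (auto intro!: tendsto_eq_intros)
      qed
      then show ?thesis using equal by (simp add: DERIV_def)
  qed
  define \<theta> where "\<theta> x = inverse ((1 + x \<bullet> x) ^ CARD('n))" for x :: "real ^ 'n"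
  \<comment> \<open>\<open>b\<close> may vanish at the origin; the added term keeps the weight positive there and is zero for \<open>1 \<le> norm x\<close>.\<close>
  define d where "d x = b x + m (1 - x \<bullet> x)" for x
  define \<sigma> where "\<sigma> x = \<theta> x * (d x powr \<alpha> * inverse (a x))" for x
  have pos: "0 < 1 + x \<bullet> x" for x :: "real ^ 'n" by (simp add: add_pos_nonneg)
  have b_nonneg: "0 \<le> b x" for x
  proof (cases "x = 0")
    case True
    have "(b \<longlongrightarrow> b 0) (at 0)"
      using C1_on_continuous_on[OF b(1)] by (simp add: continuous_on_eq_continuous_at isCont_def)
    moreover have "\<forall>\<^sub>F y in at 0. 0 \<le> b y"
      unfolding eventually_at_filter by (rule always_eventually) (auto intro: less_imp_le b(2))
    ultimately have "0 \<le> b 0" by (intro tendsto_lowerbound) auto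
    with True show ?thesis by simp
  qed (use b(2) in \<open>auto intro: less_imp_le\<close>)
  have d_pos: "0 < d x" for x
  proof (cases "x = 0")
    case True
    then show ?thesis using b_nonneg[of 0] by (simp add: d_def m_def)
  qed (use b(2)[of x] in \<open>auto simp: d_def m_def intro: add_pos_nonneg\<close>)
  have C1_inner: "C1_on UNIV (\<lambda>x :: real ^ 'n. x \<bullet> x)"
    by (intro C1_on_inner C1_on_bounded_linear bounded_linear_ident)
  have "C1_on UNIV (\<lambda>x :: real ^ 'n. 1 - x \<bullet> x)"
    using C1_on_add[OF C1_on_const[of UNIV "1 :: real"] C1_on_mult[OF C1_on_const[of UNIV "- 1 :: real"] C1_inner]] by simp
  then have "C1_on UNIV (\<lambda>x :: real ^ 'n. m (1 - x \<bullet> x))"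
    by (rule C1_on_compose_real[where \<phi> = m and \<phi>' = "\<lambda>u. 2 * max 0 u"]) (rule der_m, intro continuous_intros)
  then have C1_d: "C1_on UNIV d" unfolding d_def by (intro C1_on_add b)
  have C1_power: "C1_on UNIV (\<lambda>x :: real ^ 'n. (1 + x \<bullet> x) ^ k)" for k
    by (induction k) (auto intro!: C1_on_const C1_on_mult C1_on_add C1_inner)
  have C1_\<sigma>: "C1_on UNIV \<sigma>"
    unfolding \<sigma>_def \<theta>_def using pos a(2)
    by (intro C1_on_mult C1_on_inverse C1_power C1_on_powr C1_d d_pos a) (auto simp: less_imp_neq[THEN not_sym])
  have \<sigma>_pos: "0 < \<sigma> x" for x
    using pos[of x] d_pos[of x] a(2)[of x] by (simp add: \<sigma>_def \<theta>_def)
  have eq: "a x * b x powr - \<alpha> * \<sigma> x = \<theta> x" if "1 \<le> norm x" for x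
  proof -
    have "1 \<le> x \<bullet> x" using one_le_power[OF that, of 2] by (simp add: power2_norm_eq_inner)
    then have "d x = b x" by (simp add: d_def m_nonpos)
    moreover have "x \<noteq> 0" using that by auto
    then have "0 < b x" by (rule b(2))
    ultimately show ?thesis using a(2)[of x] by (simp add: \<sigma>_def powr_minus field_simps)
  qed
  have "integrable lborel \<theta>" unfolding \<theta>_def by (rule integrable_inverse_power_norm)
  then have "integrable lebesgue \<theta>" by (simp add: integrable_completion borel_measurable_integrable)
  moreover have S: "{x :: real ^ 'n. 1 \<le> norm x} \<in> sets lebesgue"
    by (intro sets_completionI_sets) (auto intro!: borel_closed closed_Collect_le continuous_intros)
  ultimately have "\<theta> absolutely_integrable_on {x. 1 \<le> norm x}"
    unfolding set_integrable_def by (intro integrable_mult_indicator)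
  then have "(\<lambda>x. a x * b x powr - \<alpha> * \<sigma> x) absolutely_integrable_on {x. 1 \<le> norm x}"
    by (subst set_integrable_cong[OF refl]) (use eq in auto)
  with C1_\<sigma> \<sigma>_pos show ?thesis by (rule that)
qed

text \<open>The existence clause in the conclusion keeps the convergence clause from holding
  vacuously for initial states whose solutions escape in finite time.\<close>

theorem theorem2:
  fixes F :: "real ^ 'n::finite \<Rightarrow> real ^ 'f::finite"
    and G :: "real ^ 'n \<Rightarrow> real ^ 'm::finite ^ 'g::finite"
    and A_true :: "real ^ 'f ^ 'n" and B_true :: "real ^ 'g ^ 'n"
    and I :: "real set" and tm :: "'t::{finite,linorder} \<Rightarrow> real"
    and x xdot w :: "real \<Rightarrow> real ^ 'n" and u :: "real \<Rightarrow> real ^ 'm"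
    and \<Phi>11 :: real
    and Xd :: "real ^ 't::{finite,linorder} ^ 'n" and Fd :: "real ^ 't::{finite,linorder} ^ 'f" and Gd :: "real ^ 't::{finite,linorder} ^ 'g"
    and S :: "('n \<times> ('f + 'g)) set"
    and s :: "('n \<times> 'f + 'n \<times> 'g) set"
    and v :: "real ^ ('n \<times> 'f + 'n \<times> 'g)"
    and N :: "real ^ (1 + ('n \<times> 'f + 'n \<times> 'g)) ^ (1 + ('n \<times> 'f + 'n \<times> 'g))"
    and a b \<beta> :: "real ^ 'n \<Rightarrow> real" and c :: "real ^ 'n \<Rightarrow> real ^ 'm"
    and \<alpha> \<epsilon> :: real
    and K :: "real ^ 'n \<Rightarrow> real ^ 'm"
  assumes "polynomial_function F" and "F 0 = 0" and "polynomial_function G"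
    and "is_interval I" and "strict_mono tm" and "range tm \<subseteq> I"
    and "\<And>t. t \<in> I \<Longrightarrow> (x has_vector_derivative xdot t) (at t within I)"
    and "\<And>t. t \<in> I \<Longrightarrow> xdot t = A_true *v F (x t) + B_true *v (G (x t) *v u t) + w t"
    and "\<Phi>11 \<ge> 0" and "noise_bound \<Phi>11 (samples tm w)"
    and "Xd = samples tm xdot"
    and "Fd = samples tm (\<lambda>t. F (x t))"
    and "Gd = block_samples tm (\<lambda>t. G (x t)) ** blockdiag_samples tm u"
    and "rank (vstack Fd Gd) = CARD('f + 'g)"
    and "s = known_indices S"
    and "v = coeff_vec A_true B_true"
    and "N = data_N \<Phi>11 Xd Fd Gd s v"
    and "polynomial_function a" and "polynomial_function b" and "polynomial_function \<beta>"
    and "polynomial_function c"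
    and "\<alpha> > 0" and "\<epsilon> > 0"
    and "\<And>y. y \<noteq> 0 \<Longrightarrow> b y > 0 \<and> \<beta> y > 0"
    and "(\<lambda>y. (a y / (b y powr \<alpha> * norm y)) *\<^sub>R F y) absolutely_integrable_on {y. norm y \<ge> 1}"
    and "(\<lambda>y. (1 / (b y powr \<alpha> * norm y)) *\<^sub>R (G y *v c y)) absolutely_integrable_on {y. norm y \<ge> 1}"
    and "c 0 = 0"
    and "SOS (\<lambda>y. a y - \<epsilon>)"
    and "SOS_on (UNIV <+> - s)
          (\<lambda>y. certificate N s v (R_vec \<alpha> b (\<lambda>z. a z *\<^sub>R F z) (\<lambda>z. G z *v c z) y) (\<beta> y))"
    and "K = (\<lambda>y. (1 / a y) *\<^sub>R c y)"
  shows "\<forall>(A, B) \<in> Sigma_d \<Phi>11 Xd Fd Gd \<inter> Sigma_pk S A_true B_true.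
           AE x0 in lebesgue.
             (\<exists>\<xi>. trajectory (\<lambda>y. A *v F y + B *v (G y *v K y)) x0 \<xi>) \<and>
             (\<forall>\<xi>. trajectory (\<lambda>y. A *v F y + B *v (G y *v K y)) x0 \<xi> \<longrightarrow> (\<xi> \<longlongrightarrow> 0) at_top)"
proof (rule ballI)
  fix AB assume AB_mem: "AB \<in> Sigma_d \<Phi>11 Xd Fd Gd \<inter> Sigma_pk S A_true B_true"
  obtain A B where AB_eq: "AB = (A, B)" by (cases AB)
  have AB: "(A, B) \<in> Sigma_d \<Phi>11 Xd Fd Gd" and pk: "(A, B) \<in> Sigma_pk S A_true B_true"
    using AB_mem by (simp_all add: AB_eq)
  note F = assms(1) and F0 = assms(2) and G = assms(3) and rank = assms(14) and s = assms(15) and v = assms(16)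
    and N = assms(17) and a = assms(18) and b = assms(19) and c = assms(21) and \<epsilon> = assms(23) and pos = assms(24)
    and int_F = assms(25) and int_G = assms(26) and c0 = assms(27) and sos_a = assms(28) and sos = assms(29) and K = assms(30)
  define aF where "aF y = a y *\<^sub>R F y" for y
  define Gc where "Gc y = G y *v c y" for y
  define h where "h y = A *v aF y + B *v Gc y" for y
  define f where "f y = A *v F y + B *v (G y *v K y)" for y
  define \<rho> where "\<rho> y = a y * b y powr - \<alpha>" for y
  \<comment> \<open>The lower bound \<open>\<epsilon>\<close> on \<open>a\<close> makes the
    controller smooth everywhere and the density positive off 0.\<close>
  have a_pos: "0 < a y" for y using SOS_nonneg[OF sos_a, of y] \<epsilon> by simp
  have C1: "C1_on UNIV a" "C1_on UNIV b" "C1_on UNIV F" "C1_on UNIV c"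
    by (intro C1_on_polynomial_function a b F c)+
  have C1_aF: "C1_on UNIV aF" unfolding aF_def by (intro C1_on_scaleR C1)
  have bil: "bounded_bilinear ((*v) :: real ^ 'm ^ 'g \<Rightarrow> _)"
    by (rule bilinear_conv_bounded_bilinear[THEN iffD1])
       (auto simp: bilinear_def intro!: linearI
          simp: matrix_vector_mult_add_rdistrib matrix_vector_right_distrib matrix_vector_mult_scaleR scaleR_matrix_vector_assoc)
  have C1_Gc: "C1_on UNIV Gc"
    unfolding Gc_def by (intro bounded_bilinear.C1_on[OF bil] C1_on_polynomial_function G c)
  have C1_h: "C1_on UNIV h"
    unfolding h_def by (intro C1_on_add bounded_linear.C1_on[OF matrix_vector_mul_bounded_linear] C1_aF C1_Gc)
  have f_eq: "f y = inverse (a y) *\<^sub>R h y" for y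
    using a_pos[of y]
    by (simp add: f_def h_def aF_def Gc_def K matrix_vector_mult_scaleR scaleR_add_right divide_inverse less_imp_neq[THEN not_sym])
  have C1_f: "C1_on UNIV f"
    unfolding f_eq[abs_def] using a_pos by (intro C1_on_scaleR C1_on_inverse C1 C1_h) (auto simp: less_imp_neq[THEN not_sym])
  have C1_\<rho>: "C1_on (- {0}) \<rho>"
    unfolding \<rho>_def using pos by (intro C1_on_mult C1_on_powr C1_on_subset[OF C1(1)] C1_on_subset[OF C1(2)]) auto
  \<comment> \<open>The factor \<open>a\<close> in the density cancels the denominator of the
    controller. This is what makes the divergence linear in the coefficients, with polynomial data
    up to a power of \<open>b\<close>.\<close>
  have \<rho>_f: "(\<lambda>y. \<rho> y *\<^sub>R f y) = (\<lambda>y. (b y powr - \<alpha>) *\<^sub>R (A *v aF y + B *v Gc y))"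
  proof
    fix y show "\<rho> y *\<^sub>R f y = (b y powr - \<alpha>) *\<^sub>R (A *v aF y + B *v Gc y)"
      using a_pos[of y] by (simp add: \<rho>_def f_eq h_def[symmetric] less_imp_neq[THEN not_sym])
  qed
  have div: "0 < divergence (\<lambda>y. \<rho> y *\<^sub>R f y) y" if y: "y \<noteq> 0" for y
  proof -
    have "0 < R_vec \<alpha> b aF Gc y \<bullet> coeff_vec A B"
    proof (rule certificate_imp_pos[where r = "R_vec \<alpha> b aF Gc" and \<beta> = \<beta>, OF rank N _ AB])
      show "SOS_on (UNIV <+> - s) (\<lambda>y. certificate N s v (R_vec \<alpha> b aF Gc y) (\<beta> y))"
        using sos by (simp add: aF_def[abs_def] Gc_def[abs_def])
      show "sub_on s (coeff_vec A B) = sub_on s v" using known_indices_agree[OF pk] by (simp add: s v)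
      show "0 < \<beta> y" using pos[OF y] by simp
    qed
    then show ?thesis
      unfolding \<rho>_f using pos[OF y] divergence_density_closed_loop[OF C1_aF C1_Gc C1(2), of y \<alpha> A B] by simp
  qed
  have int: "(\<lambda>y. (\<rho> y / norm y) *\<^sub>R f y) absolutely_integrable_on {y. 1 \<le> norm y}"
  proof -
    \<comment> \<open>The two integrability hypotheses involve no coefficients; applying the
      constant matrices \<open>A\<close> and \<open>B\<close> yields the flux of any consistent
      system.\<close>
    have "(\<lambda>y. A *v ((a y / (b y powr \<alpha> * norm y)) *\<^sub>R F y)
        + B *v ((1 / (b y powr \<alpha> * norm y)) *\<^sub>R (G y *v c y))) absolutely_integrable_on {y. 1 \<le> norm y}"
      by (intro set_integral_add absolutely_integrable_linear[OF int_F matrix_vector_mul_bounded_linear, unfolded o_def]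
          absolutely_integrable_linear[OF int_G matrix_vector_mul_bounded_linear, unfolded o_def])
    moreover have "A *v ((a y / (b y powr \<alpha> * norm y)) *\<^sub>R F y) + B *v ((1 / (b y powr \<alpha> * norm y)) *\<^sub>R (G y *v c y))
        = (\<rho> y / norm y) *\<^sub>R f y" for y
    proof -
      have "(\<rho> y / norm y) *\<^sub>R f y = (1 / norm y) *\<^sub>R (\<rho> y *\<^sub>R f y)" by simp
      also have "\<rho> y *\<^sub>R f y = (b y powr - \<alpha>) *\<^sub>R (A *v aF y + B *v Gc y)" by (rule fun_cong[OF \<rho>_f])
      finally have "(\<rho> y / norm y) *\<^sub>R f y = (1 / norm y) *\<^sub>R ((b y powr - \<alpha>) *\<^sub>R (A *v aF y + B *v Gc y))" .
      then show ?thesis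
        by (simp add: aF_def Gc_def matrix_vector_mult_scaleR powr_minus scaleR_add_right divide_inverse mult_ac)
    qed
    ultimately show ?thesis by simp
  qed
  obtain \<sigma> where \<sigma>: "C1_on UNIV \<sigma>" "\<And>y. 0 < \<sigma> y"
    "(\<lambda>y. a y * b y powr - \<alpha> * \<sigma> y) absolutely_integrable_on {y. 1 \<le> norm y}"
    using exists_integrable_weight[OF C1(1) a_pos C1(2), of \<alpha>] pos by blast
  have "f 0 = 0" by (simp add: f_def F0 K c0)
  have \<rho>_pos: "0 < \<rho> y" if "y \<noteq> 0" for y using a_pos[of y] pos[OF that] by (simp add: \<rho>_def)
  have "AE x0 in lebesgue. (\<exists>\<xi>. trajectory f x0 \<xi>) \<and> (\<forall>\<xi>. trajectory f x0 \<xi> \<longrightarrow> (\<xi> \<longlongrightarrow> 0) at_top)"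
    by (rule dual_lyapunov_AE_convergence[OF C1_f \<open>f 0 = 0\<close> C1_\<rho> \<rho>_pos div int \<sigma>(1,2)])
       (use \<sigma>(3) in \<open>simp_all add: \<rho>_def\<close>)
  then show "case AB of (A, B) \<Rightarrow> AE x0 in lebesgue.
             (\<exists>\<xi>. trajectory (\<lambda>y. A *v F y + B *v (G y *v K y)) x0 \<xi>) \<and>
             (\<forall>\<xi>. trajectory (\<lambda>y. A *v F y + B *v (G y *v K y)) x0 \<xi> \<longrightarrow> (\<xi> \<longlongrightarrow> 0) at_top)"
    by (simp add: AB_eq f_def[abs_def])
qed

end
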